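(* Let $d\ge1$, let $U\subset\mathbb{R}^d$ be an open set of Lebesgue volume $1$, and for $\lambda>0$ let $\mathcal{X}$ be a homogeneous Poisson point process on $U$ with intensity $\lambda$. For $r>0$ let $G(\mathcal{X},r)$ be the graph with vertex set $\mathcal{X}$ in which two vertices are joined whenever their Euclidean distance is at most $r$, and for $b>0$ let $W_b=\beta\bigl(G(\mathcal{X},b\lambda^{-1/d})\bigr)$, where $\beta(\cdot)$ denotes the independence number. Then, for all $b>0$ small enough, for every $\varepsilon>0$, \[ d_{\mathrm{loc}}\bigl(\mathcal{L}(W_b),\mathrm{TP}(\mathbb{E}W_b,\mathrm{Var}\,W_b)\bigr)=O(\lambda^{-1+\varepsilon})\quad\text{as }\lambda\to\infty. \]
   Context: The independence number of a graph is the maximal number of vertices that can be chosen so that no two of them are adjacent. For integer-supported laws with distribution functions $F,G$ (where $F(j)=\mathbb{P}[X\le j]$), $d_{\mathrm{loc}}(F,G)=\sup_{j\in\mathbb{Z}}|(F(j+1)-F(j))-(G(j+1)-G(j))|$. Translated Poisson: for $\mu\in\mathbb{R}$, $\sigma^2>0$, $Z\sim\mathrm{TP}(\mu,\sigma^2)$ means $Z-\lfloor\mu-\sigma^2\rfloor\sim\mathrm{Po}(\sigma^2+\gamma)$ with $\gamma=\mu-\sigma^2-\lfloor\mu-\sigma^2\rfloor$. "For $b$ small enough" refers to the regime (of Penrose and Yukich) in which $\mathrm{Var}\,W_b\asymp\lambda$ and $d_{\mathrm{K}}$ between the standardized $W_b$ and $N(0,1)$ is $O(\log(\lambda)^{3d}\lambda^{-1/2})$.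 *)

theory Defs
  imports "HOL-Analysis.Analysis" "HOL-Probability.Probability"
begin

definition indep_num :: "real \<Rightarrow> (nat \<Rightarrow> 'a::metric_space) \<Rightarrow> nat \<Rightarrow> nat" where
  "indep_num r xs n = Max {card S | S. S \<subseteq> {..<n} \<and>
      (\<forall>i\<in>S. \<forall>j\<in>S. i \<noteq> j \<longrightarrow> r < dist (xs i) (xs j))}"

text \<open>Law of W_b = independence number of G(X, b lam^(-1/d)), X a homogeneous Poisson
  process of intensity lam on U (vol U = 1): given N = n ~ Po(lam), the points are
  i.i.d. uniform on U.  pW U lam b k = P(W_b = k).\<close>
definition pW :: "'a::euclidean_space set \<Rightarrow> real \<Rightarrow> real \<Rightarrow> nat \<Rightarrow> real" where
  "pW U lam b k = (\<Sum>n. pmf (poisson_pmf lam) n *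
      measure (PiM {..<n} (\<lambda>_. restrict_space lborel U))
        {xs \<in> space (PiM {..<n} (\<lambda>_. restrict_space lborel U)).
           indep_num (b * lam powr (-1 / real DIM('a))) xs n = k})"

definition pW_int :: "'a::euclidean_space set \<Rightarrow> real \<Rightarrow> real \<Rightarrow> int \<Rightarrow> real" where
  "pW_int U lam b j = (if j < 0 then 0 else pW U lam b (nat j))"

definition meanW :: "'a::euclidean_space set \<Rightarrow> real \<Rightarrow> real \<Rightarrow> real" where
  "meanW U lam b = (\<Sum>k. real k * pW U lam b k)"

definition varW :: "'a::euclidean_space set \<Rightarrow> real \<Rightarrow> real \<Rightarrow> real" where
  "varW U lam b = (\<Sum>k. (real k - meanW U lam b)^2 * pW U lam b k)"

definition tp_pmf :: "real \<Rightarrow> real \<Rightarrow> int \<Rightarrow> real" where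
  "tp_pmf mu s2 j = (let m = \<lfloor>mu - s2\<rfloor>; gam = mu - s2 - real_of_int m in
     if j < m then 0 else pmf (poisson_pmf (s2 + gam)) (nat (j - m)))"

text \<open>Local distance between integer-supported laws given by point probabilities:
  sup over j of |P[X = j] - P[Y = j]| (= sup of |(F(j+1)-F(j)) - (G(j+1)-G(j))|).\<close>
definition d_loc :: "(int \<Rightarrow> real) \<Rightarrow> (int \<Rightarrow> real) \<Rightarrow> real" where
  "d_loc p q = (SUP j. \<bar>p j - q j\<bar>)"

end

theory Submission
  imports Defs "HOL-Complex_Analysis.Complex_Analysis"
begin

text \<open>
  Let P be the probability generating function of the independence number W. A cluster-expansion
  argument bounds it on the disc of radius 3: if \<Xi>(t) denotes the unnormalised generating function
  at intensity t, then \<Xi>' is the average over x of the generating function with an extra point at x.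
  Revealing the neighbours of x, then their neighbours, and so on, expresses that quantity through
  \<Xi> itself, because once the explored component is closed the independence number splits
  additively. When the expected number \<kappa> of neighbours is small the exploration is contracting, and
  \<bar>\<Xi>' - z \<Xi>\<bar> \<le> \<eta> \<bar>\<Xi>\<bar> with \<eta> = O(\<kappa>). Hence P(z) exp(-\<lambda>(z - 1)) lies between exp(-\<eta> \<lambda>) and
  exp(\<eta> \<lambda>) in modulus; in particular P has no zeros there.

  So log P(exp(is)) = \<lambda>(exp(is) - 1) + g(s) in the strip \<bar>Im s\<bar> < 1, with \<bar>Re g\<bar> \<le> \<eta> \<lambda>.
  The Borel-Caratheodory and Cauchy inequalities bound the second and third derivatives of g on the real line by multiples of
  \<eta> \<lambda>. The logarithms of the characteristic functions of W and of the translated Poisson law with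
  the same mean and (up to an error below 1) the same variance therefore differ by
  O(t^2 + \<lambda> \<bar>t\<bar>^3), while both characteristic functions are at most exp(-\<lambda> t^2 / 24). Fourier
  inversion gives the bound O(1/\<lambda>) for the local distance.
\<close>

section \<open>Double series\<close>

text \<open>The generating function is needed at complex \<open>z\<close>, where positivity is lost.
  Nor can a bound relative to \<Xi> be assumed, since zeros of \<Xi> are what has to be excluded.
  The exploration therefore starts from a crude bound unrelated to \<Xi>, valid for all pairs of
  revealed and explored sets at once; each pass lowers it by the factor 3/4 until it meets the
  modulus of \<Xi>. In the limit the bound is proportional to that modulus, even if \<Xi> should
  vanish; only the differential inequality then shows that it does not.

  The radius 3 exceeds exp(1), so the strip of half-width 1 is mapped into the disc, and every real
  point has a unit disc inside the strip for the Cauchy estimates. The small parameter is the volume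
  of a ball of radius \<open>b\<close>: the intensity cancels in lam * r^d = b^d, so the threshold
  for \<open>b\<close> depends on the dimension alone. With eta at most 1/2000 the perturbation
  \<open>g\<close> uses up at most half of the quadratic decay available from the Poisson factor.
  Equal means remove the linear term from the difference of the exponents; the fractional part in
  the translated Poisson law causes the t^2 term.\<close>

lemma infsum_eq_suminf: "f summable_on (UNIV :: nat set) \<Longrightarrow> infsum f UNIV = suminf f"
  for f :: "nat \<Rightarrow> 'b::banach"
  by (rule sums_unique[OF has_sum_imp_sums[OF has_sum_infsum]])

context
  fixes b :: "nat \<Rightarrow> nat \<Rightarrow> 'b::banach" and x y :: "nat \<Rightarrow> real"
  assumes b: "\<And>k j. norm (b k j) \<le> x k * y j"
    and x: "summable x" "\<And>k. 0 \<le> x k" and y: "summable y" "\<And>k. 0 \<le> y k"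
begin

lemma double_series_summable_on: "(\<lambda>(k,j). b k j) summable_on UNIV \<times> UNIV"
proof -
  have "(\<lambda>p. norm (case p of (k, j) \<Rightarrow> x k * y j)) summable_on UNIV \<times> UNIV"
    unfolding Infinite_Sum.abs_summable_on_Sigma_iff
  proof (intro conjI ballI)
    show s: "(\<lambda>j. norm (case (k, j) of (k, j) \<Rightarrow> x k * y j)) summable_on UNIV" for k
    proof -
      have "norm (norm (x k * y j)) = x k * y j" for j using x y by simp
      then have "summable (\<lambda>j. norm (norm (x k * y j)))"
        using summable_mult[OF y(1), of "x k"] by simp
      then show ?thesis by (simp add: norm_summable_imp_summable_on)
    qed
    have eq: "infsum (\<lambda>j. norm (x k * y j)) UNIV = x k * suminf y" for k
      using infsum_eq_suminf[OF s[of k]] x y by (simp add: suminf_mult)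
    have "norm (norm (x k * suminf y)) = x k * suminf y" for k
      using x y suminf_nonneg[of y] by simp
    then have "summable (\<lambda>k. norm (norm (x k * suminf y)))"
      using summable_mult2[OF x(1), of "suminf y"] by simp
    then have "(\<lambda>k. norm (x k * suminf y)) summable_on UNIV"
      by (rule norm_summable_imp_summable_on)
    then show "(\<lambda>k. norm (\<Sum>\<^sub>\<infinity>j. norm (case (k, j) of (k, j) \<Rightarrow> x k * y j))) summable_on UNIV"
      using eq by simp
  qed
  then have "(\<lambda>p. norm (case p of (k, j) \<Rightarrow> b k j)) summable_on UNIV \<times> UNIV"
    by (rule Infinite_Sum.abs_summable_on_comparison_test) (use b x y in \<open>auto simp: abs_mult\<close>)
  then show ?thesis by (rule abs_summable_summable)
qed

lemma double_series_summable_on_rows: "b k summable_on UNIV" "(\<lambda>k. b k j) summable_on UNIV"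
proof -
  have "summable (\<lambda>j. norm (b k j))"
    by (rule summable_comparison_test'[OF summable_mult[OF y(1), of "x k"], of 0]) (use b in simp)
  then show "b k summable_on UNIV" by (rule norm_summable_imp_summable_on)
  have "summable (\<lambda>k. norm (b k j))"
    by (rule summable_comparison_test'[OF summable_mult2[OF x(1), of "y j"], of 0]) (use b in simp)
  then show "(\<lambda>k. b k j) summable_on UNIV" by (rule norm_summable_imp_summable_on)
qed

lemma suminf_suminf_eq_infsum: "(\<Sum>k. \<Sum>j. b k j) = infsum (\<lambda>(k,j). b k j) (UNIV \<times> UNIV)"
proof -
  have "(\<Sum>k. \<Sum>j. b k j) = (\<Sum>\<^sub>\<infinity>k. \<Sum>\<^sub>\<infinity>j. b k j)"
    using summable_on_Sigma_banach[OF double_series_summable_on]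
    by (simp add: infsum_eq_suminf double_series_summable_on_rows)
  also have "\<dots> = infsum (\<lambda>(k,j). b k j) (UNIV \<times> UNIV)"
    by (rule infsum_Sigma'_banach[OF double_series_summable_on])
  finally show ?thesis .
qed

lemma suminf_suminf_swap: "(\<Sum>k. \<Sum>j. b k j) = (\<Sum>j. \<Sum>k. b k j)"
proof -
  have s': "(\<lambda>(j,k). b k j) summable_on UNIV \<times> UNIV"
    using double_series_summable_on by (subst summable_on_swap) simp
  have "(\<Sum>j. \<Sum>k. b k j) = (\<Sum>\<^sub>\<infinity>j. \<Sum>\<^sub>\<infinity>k. b k j)"
    using summable_on_Sigma_banach[OF s'] by (simp add: infsum_eq_suminf double_series_summable_on_rows)
  also have "\<dots> = (\<Sum>\<^sub>\<infinity>k. \<Sum>\<^sub>\<infinity>j. b k j)"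
    by (rule infsum_swap_banach[OF s'])
  also have "\<dots> = (\<Sum>k. \<Sum>j. b k j)"
    using summable_on_Sigma_banach[OF double_series_summable_on]
    by (simp add: infsum_eq_suminf double_series_summable_on_rows)
  finally show ?thesis by simp
qed

text \<open>The reordering by \<open>n = k + j\<close> behind a Cauchy product; the product bound
  \<open>x k * y j\<close> supplies absolute summability on the whole quadrant.\<close>

lemma suminf_suminf_diagonal: "(\<Sum>k. \<Sum>j. b k j) = (\<Sum>n. \<Sum>k\<le>n. b k (n - k))"
proof -
  have bij: "bij_betw (\<lambda>(n,k). (k, n - k)) (SIGMA n:UNIV. {..n}) (UNIV \<times> (UNIV :: nat set))"
    by (rule bij_betw_byWitness[where f' = "\<lambda>(k,j). (k + j, k)"]) auto
  have bij': "(\<lambda>(n,k). b k (n - k)) summable_on (SIGMA n:UNIV. {..n})"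
    using summable_on_reindex_bij_betw[OF bij, of "\<lambda>(k,j). b k j"] double_series_summable_on
    by (simp add: case_prod_beta')
  have "(\<Sum>k. \<Sum>j. b k j) = infsum (\<lambda>(k,j). b k j) (UNIV \<times> UNIV)"
    by (rule suminf_suminf_eq_infsum)
  also have "\<dots> = infsum (\<lambda>(n,k). b k (n - k)) (SIGMA n:UNIV. {..n})"
    using infsum_reindex_bij_betw[OF bij, of "\<lambda>(k,j). b k j"] by (simp add: case_prod_beta')
  also have "\<dots> = (\<Sum>\<^sub>\<infinity>n. \<Sum>\<^sub>\<infinity>k\<in>{..n}. b k (n - k))"
    by (rule infsum_Sigma'_banach[OF bij', symmetric])
  also have "\<dots> = (\<Sum>n. \<Sum>k\<le>n. b k (n - k))"
    using summable_on_Sigma_banach[OF bij'] by (simp add: infsum_eq_suminf)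
  finally show ?thesis .
qed

end

section \<open>Adding points of a Poisson process\<close>

locale config_model = prob_space M for M :: "'a measure" +
  fixes R :: real
  assumes R_ge1: "1 \<le> R"
begin

definition cfg :: "'a set set" where
  "cfg = {S. finite S \<and> S \<subseteq> space M}"

text \<open>Measurability is required only along images of tuples, so no sigma-algebra on the space
  of finite sets is needed. Growth of order \<open>R ^ card S\<close> makes the Poisson series
  converge. The value 0 outside \<open>cfg\<close> lets identities hold between functions, not
  merely on \<open>cfg\<close>.\<close>

definition admissible :: "('a set \<Rightarrow> complex) \<Rightarrow> bool" where
  "admissible F \<longleftrightarrow> (\<forall>S. S \<notin> cfg \<longrightarrow> F S = 0) \<and>
     (\<forall>n. (\<lambda>x. F (x ` {..<n::nat})) \<in> borel_measurable (PiM {..<n} (\<lambda>_. M))) \<and>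
     (\<exists>C\<ge>0. \<forall>S\<in>cfg. norm (F S) \<le> C * R ^ card S)"

definition weight :: "('a \<Rightarrow> real) \<Rightarrow> bool" where
  "weight w \<longleftrightarrow> w \<in> borel_measurable M \<and> (\<exists>K. \<forall>x\<in>space M. \<bar>w x\<bar> \<le> K)"

definition mass :: "('a \<Rightarrow> real) \<Rightarrow> real" where
  "mass w = (\<integral>x. \<bar>w x\<bar> \<partial>M)"

text \<open>The generator of the calculus: its \<open>n\<close>-th power integrates over
  \<open>n\<close> added points, so \<open>expop\<close> is the exponential of this
  operator.\<close>

definition addop :: "('a \<Rightarrow> real) \<Rightarrow> ('a set \<Rightarrow> complex) \<Rightarrow> 'a set \<Rightarrow> complex" where
  "addop w F S = (if S \<in> cfg then \<integral>x. w x *\<^sub>R F (insert x S) \<partial>M else 0)"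

text \<open>For w \<ge> 0, \<open>expop w F {}\<close> is exp(\<integral>w) times the expectation of F at a Poisson process of
  intensity w. Signed weights are needed to write the removal of points in the same way.\<close>

definition expop :: "('a \<Rightarrow> real) \<Rightarrow> ('a set \<Rightarrow> complex) \<Rightarrow> 'a set \<Rightarrow> complex" where
  "expop w F S = (\<Sum>n. (addop w ^^ n) F S /\<^sub>R fact n)"

lemma cfg_empty [simp]: "{} \<in> cfg"
  by (simp add: cfg_def)

lemma cfg_insert [simp]: "insert x S \<in> cfg \<longleftrightarrow> x \<in> space M \<and> S \<in> cfg"
  by (auto simp: cfg_def)

lemma cfg_Un [simp]: "S \<union> T \<in> cfg \<longleftrightarrow> S \<in> cfg \<and> T \<in> cfg"
  by (auto simp: cfg_def)

lemma cfg_image: "x \<in> space (PiM {..<n::nat} (\<lambda>_. M)) \<Longrightarrow> x ` {..<n} \<in> cfg"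
  by (auto simp: cfg_def space_PiM PiE_def Pi_def)

lemma cfg_finite: "S \<in> cfg \<Longrightarrow> finite S"
  by (simp add: cfg_def)

lemma admissible_outside: "admissible F \<Longrightarrow> S \<notin> cfg \<Longrightarrow> F S = 0"
  by (simp add: admissible_def)

lemma admissible_measurable:
  "admissible F \<Longrightarrow> (\<lambda>x. F (x ` {..<n::nat})) \<in> borel_measurable (PiM {..<n} (\<lambda>_. M))"
  by (simp add: admissible_def)

lemma admissible_bound:
  assumes "admissible F"
  obtains C where "0 \<le> C" "\<And>S. S \<in> cfg \<Longrightarrow> norm (F S) \<le> C * R ^ card S"
  using assms unfolding admissible_def by blast

lemma weight_const [simp]: "weight (\<lambda>_. c)"
  by (auto simp: weight_def)

lemma weight_add: "weight w1 \<Longrightarrow> weight w2 \<Longrightarrow> weight (\<lambda>x. w1 x + w2 x)"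
proof -
  assume a: "weight w1" "weight w2"
  then obtain K1 K2 where "\<forall>x\<in>space M. \<bar>w1 x\<bar> \<le> K1" "\<forall>x\<in>space M. \<bar>w2 x\<bar> \<le> K2"
    unfolding weight_def by blast
  then have "\<forall>x\<in>space M. \<bar>w1 x + w2 x\<bar> \<le> K1 + K2"
    by fastforce
  then show ?thesis
    using a unfolding weight_def by (auto intro: borel_measurable_add)
qed

lemma weight_integrable:
  assumes "weight w"
  shows "integrable M w" "integrable M (\<lambda>x. \<bar>w x\<bar>)"
proof -
  obtain K where "\<forall>x\<in>space M. \<bar>w x\<bar> \<le> K" using assms unfolding weight_def by blast
  then show "integrable M w"
    by (intro integrable_const_bound[of _ K]) (use assms in \<open>auto simp: weight_def\<close>)
  then show "integrable M (\<lambda>x. \<bar>w x\<bar>)" by simp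
qed

lemma mass_nonneg: "0 \<le> mass w"
  by (simp add: mass_def)

text \<open>Admissibility speaks only about images of tuples, so \<open>S\<close> is enumerated and
  the two variable points are placed in two further coordinates.\<close>

lemma measurable_insert2:
  assumes F: "admissible F" and S: "S \<in> cfg"
  shows "(\<lambda>p. F (insert (fst p) (insert (snd p) S))) \<in> borel_measurable (M \<Otimes>\<^sub>M M)"
proof -
  obtain k and s :: "nat \<Rightarrow> 'a" where s: "S = s ` {i. i < k}"
    using finite_imp_nat_seg_image_inj_on[OF cfg_finite[OF S]] by metis
  have sM: "s i \<in> space M" if "i < k" for i
    using S that by (auto simp: s cfg_def)
  define g where "g = (\<lambda>p. (\<lambda>i\<in>{..<k+2}. if i < k then s i else if i = k then fst p else snd p))"
  have g: "g \<in> measurable (M \<Otimes>\<^sub>M M) (PiM {..<k+2} (\<lambda>_. M))"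
    unfolding g_def
  proof (rule measurable_restrict)
    fix i assume "i \<in> {..<k+2}"
    show "(\<lambda>p. if i < k then s i else if i = k then fst p else snd p) \<in> M \<Otimes>\<^sub>M M \<rightarrow>\<^sub>M M"
      by (cases "i < k"; cases "i = k") (auto simp: sM)
  qed
  have im: "g p ` {..<k+2} = insert (fst p) (insert (snd p) S)" for p
  proof -
    have "{..<k+2} = insert k (insert (Suc k) {..<k})" by auto
    then show ?thesis by (auto simp: g_def s)
  qed
  have "(\<lambda>p. F (g p ` {..<k+2})) \<in> borel_measurable (M \<Otimes>\<^sub>M M)"
    using measurable_compose[OF g admissible_measurable[OF F]] .
  then show ?thesis by (simp only: im)
qed

lemma measurable_insert1:
  assumes F: "admissible F" and S: "S \<in> cfg"
  shows "(\<lambda>x. F (insert x S)) \<in> borel_measurable M"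
proof -
  have "(\<lambda>x. (x, x)) \<in> M \<rightarrow>\<^sub>M M \<Otimes>\<^sub>M M" by simp
  from measurable_compose[OF this measurable_insert2[OF F S]] show ?thesis by simp
qed

lemma card_insert_power_le:
  assumes "finite S" "1 \<le> (K::real)"
  shows "K ^ card (insert x S) \<le> K * K ^ card S"
  using assms by (auto simp: card_insert_if)

lemma addop_norm_le:
  assumes w: "weight w" and B: "0 \<le> B" and "\<And>x. x \<in> space M \<Longrightarrow> norm (F (insert x S)) \<le> B"
  shows "norm (addop w F S) \<le> mass w * B"
proof -
  have "norm (\<integral>x. w x *\<^sub>R F (insert x S) \<partial>M) \<le> (\<integral>x. norm (w x *\<^sub>R F (insert x S)) \<partial>M)"
    by (rule integral_norm_bound)
  also have "\<dots> \<le> (\<integral>x. \<bar>w x\<bar> * B \<partial>M)"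
    using weight_integrable[OF w] assms(3) B
    by (intro integral_mono_AE') (auto intro!: mult_left_mono AE_I2)
  also have "\<dots> = mass w * B" by (simp add: mass_def)
  finally show ?thesis
    using mass_nonneg[of w] B by (auto simp: addop_def)
qed

lemma integrable_insert:
  assumes F: "admissible F" and S: "S \<in> cfg" and w: "weight w"
  shows "integrable M (\<lambda>x. w x *\<^sub>R F (insert x S))"
proof -
  obtain C where C: "0 \<le> C" "\<And>S. S \<in> cfg \<Longrightarrow> norm (F S) \<le> C * R ^ card S"
    using admissible_bound[OF F] by blast
  obtain K where K: "\<forall>x\<in>space M. \<bar>w x\<bar> \<le> K" using w unfolding weight_def by blast
  have [measurable]: "(\<lambda>x. F (insert x S)) \<in> borel_measurable M"
    by (rule measurable_insert1[OF F S])
  have [measurable]: "w \<in> borel_measurable M" using w by (simp add: weight_def)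
  show ?thesis
  proof (rule integrable_const_bound[of _ "K * (C * (R * R ^ card S))"])
    show "AE x in M. norm (w x *\<^sub>R F (insert x S)) \<le> K * (C * (R * R ^ card S))"
    proof (rule AE_I2)
      fix x assume x: "x \<in> space M"
      have "norm (F (insert x S)) \<le> C * R ^ card (insert x S)"
        using C(2) x S by simp
      also have "\<dots> \<le> C * (R * R ^ card S)"
        using C(1) card_insert_power_le[OF cfg_finite[OF S] R_ge1] by (intro mult_left_mono)
      finally show "norm (w x *\<^sub>R F (insert x S)) \<le> K * (C * (R * R ^ card S))"
        using K x by (auto intro!: mult_mono intro: order_trans[OF abs_ge_zero])
    qed
  qed measurable
qed

section \<open>Addition operators: growth, measurability, commutation\<close>

lemma addop_bound_power:
  assumes w: "weight w" and "0 \<le> C" and C: "\<And>S. S \<in> cfg \<Longrightarrow> norm (F S) \<le> C * R ^ card S"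
    and S: "S \<in> cfg"
  shows "norm (addop w F S) \<le> mass w * R * C * R ^ card S"
proof -
  have "norm (addop w F S) \<le> mass w * (C * (R * R ^ card S))"
  proof (rule addop_norm_le[OF w])
    fix x assume x: "x \<in> space M"
    have "norm (F (insert x S)) \<le> C * R ^ card (insert x S)"
      using C x S by simp
    also have "\<dots> \<le> C * (R * R ^ card S)"
      using \<open>0 \<le> C\<close> card_insert_power_le[OF cfg_finite[OF S] R_ge1] by (intro mult_left_mono)
    finally show "norm (F (insert x S)) \<le> C * (R * R ^ card S)" .
  qed (use \<open>0 \<le> C\<close> R_ge1 in auto)
  then show ?thesis by (simp add: mult_ac)
qed

lemma admissible_addop:
  assumes F: "admissible F" and w: "weight w"
  shows "admissible (addop w F)"
  unfolding admissible_def
proof (intro conjI allI impI)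
  obtain C where C: "0 \<le> C" "\<And>S. S \<in> cfg \<Longrightarrow> norm (F S) \<le> C * R ^ card S"
    using admissible_bound[OF F] by blast
  show "\<exists>C\<ge>0. \<forall>S\<in>cfg. norm (addop w F S) \<le> C * R ^ card S"
    using addop_bound_power[OF w C] C(1) mass_nonneg[of w] R_ge1
    by (intro exI[of _ "mass w * R * C"]) auto
next
  fix n :: nat
  have [measurable]: "w \<in> borel_measurable M" using w by (simp add: weight_def)
  have "(\<lambda>(x,y). x(n := y)) \<in> measurable (PiM {..<n} (\<lambda>_. M) \<Otimes>\<^sub>M M) (PiM (insert n {..<n}) (\<lambda>_. M))"
    by (rule measurable_add_dim)
  moreover have "insert n {..<n} = {..<Suc n}" by auto
  ultimately have "(\<lambda>(x,y). x(n := y)) \<in> measurable (PiM {..<n} (\<lambda>_. M) \<Otimes>\<^sub>M M) (PiM {..<Suc n} (\<lambda>_. M))"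
    by simp
  from measurable_compose[OF this admissible_measurable[OF F]]
  have "(\<lambda>p. F (((fst p)(n := snd p)) ` {..<Suc n})) \<in> borel_measurable (PiM {..<n} (\<lambda>_. M) \<Otimes>\<^sub>M M)"
    by (simp add: case_prod_beta')
  moreover have "((fst p)(n := snd p)) ` {..<Suc n} = insert (snd p) (fst p ` {..<n})" for p :: "(nat \<Rightarrow> 'a) \<times> 'a"
    by (auto simp: lessThan_Suc)
  ultimately have [measurable]: "(\<lambda>p. F (insert (snd p) (fst p ` {..<n}))) \<in> borel_measurable (PiM {..<n} (\<lambda>_. M) \<Otimes>\<^sub>M M)"
    by simp
  have "(\<lambda>(x,y). w y *\<^sub>R F (insert y (x ` {..<n}))) \<in> borel_measurable (PiM {..<n} (\<lambda>_. M) \<Otimes>\<^sub>M M)"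
    unfolding case_prod_beta' by measurable
  from borel_measurable_lebesgue_integral[OF this]
  have "(\<lambda>x. \<integral>y. w y *\<^sub>R F (insert y (x ` {..<n})) \<partial>M) \<in> borel_measurable (PiM {..<n} (\<lambda>_. M))" .
  then show "(\<lambda>x. addop w F (x ` {..<n})) \<in> borel_measurable (PiM {..<n} (\<lambda>_. M))"
    by (rule measurable_cong[THEN iffD1, rotated]) (simp add: addop_def cfg_image)
qed (simp add: addop_def)

lemma admissible_addop_power:
  "admissible F \<Longrightarrow> weight w \<Longrightarrow> admissible ((addop w ^^ n) F)"
  by (induction n) (auto intro: admissible_addop)

text \<open>Both sides are the double integral over one \<open>v\<close>-point and one
  \<open>w\<close>-point. Fubini applies because the weights are bounded and \<open>F\<close> is
  bounded on sets with at most two points more than \<open>S\<close>.\<close>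

lemma addop_commute:
  assumes F: "admissible F" and v: "weight v" and w: "weight w"
  shows "addop v (addop w F) = addop w (addop v F)"
proof
  fix S
  show "addop v (addop w F) S = addop w (addop v F) S"
  proof (cases "S \<in> cfg")
    case S: True
    obtain C where C: "0 \<le> C" "\<And>S. S \<in> cfg \<Longrightarrow> norm (F S) \<le> C * R ^ card S"
      using admissible_bound[OF F] by blast
    obtain K where K: "\<And>x. x \<in> space M \<Longrightarrow> \<bar>w x\<bar> \<le> K" using w unfolding weight_def by blast
    obtain L where L: "\<And>x. x \<in> space M \<Longrightarrow> \<bar>v x\<bar> \<le> L" using v unfolding weight_def by blast
    have [measurable]: "w \<in> borel_measurable M" "v \<in> borel_measurable M"
      using w v by (simp_all add: weight_def)
    have [measurable]: "(\<lambda>p. F (insert (fst p) (insert (snd p) S))) \<in> borel_measurable (M \<Otimes>\<^sub>M M)"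
      by (rule measurable_insert2[OF F S])
    interpret pair_prob_space M M ..
    have "integrable (M \<Otimes>\<^sub>M M) (\<lambda>(y,x). v x *\<^sub>R w y *\<^sub>R F (insert y (insert x S)))"
      unfolding case_prod_beta'
    proof (rule P.integrable_const_bound[of _ "L * (K * (C * (R * (R * R ^ card S))))"])
      show "AE p in M \<Otimes>\<^sub>M M. norm (v (snd p) *\<^sub>R w (fst p) *\<^sub>R F (insert (fst p) (insert (snd p) S)))
          \<le> L * (K * (C * (R * (R * R ^ card S))))"
      proof (rule AE_I2)
        fix p assume "p \<in> space (M \<Otimes>\<^sub>M M)"
        then have p: "fst p \<in> space M" "snd p \<in> space M" by (auto simp: space_pair_measure)
        have "norm (F (insert (fst p) (insert (snd p) S))) \<le> C * R ^ card (insert (fst p) (insert (snd p) S))"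
          using C(2) p S by simp
        also have "\<dots> \<le> C * (R * R ^ card (insert (snd p) S))"
          using C(1) card_insert_power_le[OF _ R_ge1, of "insert (snd p) S"] cfg_finite[OF S]
          by (intro mult_left_mono) auto
        also have "\<dots> \<le> C * (R * (R * R ^ card S))"
          using C(1) card_insert_power_le[OF cfg_finite[OF S] R_ge1] R_ge1
          by (intro mult_left_mono) auto
        finally have *: "norm (F (insert (fst p) (insert (snd p) S))) \<le> C * (R * (R * R ^ card S))" .
        have "0 \<le> K" "0 \<le> L" using K[OF p(1)] L[OF p(1)] by auto
        then show "norm (v (snd p) *\<^sub>R w (fst p) *\<^sub>R F (insert (fst p) (insert (snd p) S)))
            \<le> L * (K * (C * (R * (R * R ^ card S))))"
          unfolding norm_scaleR
          by (intro mult_mono K L * p mult_nonneg_nonneg) auto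
      qed
    qed measurable
    from Fubini_integral[OF this]
    have "(\<integral>x. (\<integral>y. v x *\<^sub>R w y *\<^sub>R F (insert y (insert x S)) \<partial>M) \<partial>M)
        = (\<integral>y. (\<integral>x. v x *\<^sub>R w y *\<^sub>R F (insert y (insert x S)) \<partial>M) \<partial>M)" .
    also have "\<dots> = (\<integral>y. (\<integral>x. w y *\<^sub>R v x *\<^sub>R F (insert x (insert y S)) \<partial>M) \<partial>M)"
      by (intro Bochner_Integration.integral_cong refl) (simp add: mult.commute insert_commute)
    finally have E: "(\<integral>x. (\<integral>y. v x *\<^sub>R w y *\<^sub>R F (insert y (insert x S)) \<partial>M) \<partial>M)
        = (\<integral>y. (\<integral>x. w y *\<^sub>R v x *\<^sub>R F (insert x (insert y S)) \<partial>M) \<partial>M)" .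
    have "addop v (addop w F) S = (\<integral>x. (\<integral>y. v x *\<^sub>R w y *\<^sub>R F (insert y (insert x S)) \<partial>M) \<partial>M)"
      using S by (auto simp: addop_def simp del: scaleR_scaleR intro!: Bochner_Integration.integral_cong)
    moreover have "addop w (addop v F) S = (\<integral>y. (\<integral>x. w y *\<^sub>R v x *\<^sub>R F (insert x (insert y S)) \<partial>M) \<partial>M)"
      using S by (auto simp: addop_def simp del: scaleR_scaleR intro!: Bochner_Integration.integral_cong)
    ultimately show ?thesis using E by simp
  qed (simp add: addop_def)
qed

lemma addop_commute_power:
  assumes "admissible F" "weight v" "weight w"
  shows "addop v ((addop w ^^ n) F) = (addop w ^^ n) (addop v F)"
proof (induction n)
  case (Suc n)
  have "addop v ((addop w ^^ Suc n) F) = addop w (addop v ((addop w ^^ n) F))"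
    using addop_commute[OF admissible_addop_power[OF assms(1,3)] assms(2,3)] by simp
  then show ?case using Suc by simp
qed simp

lemma addop_add:
  assumes F: "admissible F" and v: "weight v" and w: "weight w"
  shows "addop (\<lambda>x. v x + w x) F S = addop v F S + addop w F S"
  using integrable_insert[OF F _ v, of S] integrable_insert[OF F _ w, of S]
  by (simp add: addop_def scaleR_left_distrib)

lemma addop_scale: "addop (\<lambda>x. c * w x) F S = c *\<^sub>R addop w F S"
  by (simp add: addop_def flip: scaleR_scaleR)

lemma addop_sum:
  assumes "\<And>i. i \<in> I \<Longrightarrow> admissible (F i)" and w: "weight w"
  shows "addop w (\<lambda>S. \<Sum>i\<in>I. c i *\<^sub>R F i S) S = (\<Sum>i\<in>I. c i *\<^sub>R addop w (F i) S)"
proof (cases "S \<in> cfg")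
  case S: True
  have "(\<integral>x. w x *\<^sub>R (\<Sum>i\<in>I. c i *\<^sub>R F i (insert x S)) \<partial>M)
     = (\<integral>x. (\<Sum>i\<in>I. c i *\<^sub>R (w x *\<^sub>R F i (insert x S))) \<partial>M)"
    by (simp add: scaleR_sum_right mult.commute)
  also have "\<dots> = (\<Sum>i\<in>I. \<integral>x. c i *\<^sub>R (w x *\<^sub>R F i (insert x S)) \<partial>M)"
    using integrable_insert[OF assms(1) S w]
    by (intro Bochner_Integration.integral_sum integrable_scaleR_right) auto
  also have "\<dots> = (\<Sum>i\<in>I. c i *\<^sub>R (\<integral>x. w x *\<^sub>R F i (insert x S) \<partial>M))"
    by (intro sum.cong refl integral_scaleR_right)
  finally show ?thesis using S by (simp add: addop_def)
qed (simp add: addop_def)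

lemma addop_power_add:
  assumes F: "admissible F" and v: "weight v" and w: "weight w"
  shows "(addop (\<lambda>x. v x + w x) ^^ n) F =
    (\<lambda>S. \<Sum>k\<le>n. real (n choose k) *\<^sub>R (addop v ^^ k) ((addop w ^^ (n - k)) F) S)"
proof (induction n)
  case (Suc n)
  define a where "a k j = (addop v ^^ k) ((addop w ^^ j) F)" for k j
  have adm: "admissible (a k j)" for k j
    unfolding a_def by (intro admissible_addop_power assms)
  have av: "addop v (a k j) = a (Suc k) j" for k j
    by (simp add: a_def)
  have aw: "addop w (a k j) = a k (Suc j)" for k j
    unfolding a_def
    by (subst addop_commute_power[OF admissible_addop_power[OF F w] w v]) simp
  have vw: "weight (\<lambda>x. v x + w x)" by (intro weight_add v w)
  show ?case
  proof
    fix S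
    have "(addop (\<lambda>x. v x + w x) ^^ Suc n) F S
        = addop (\<lambda>x. v x + w x) (\<lambda>S. \<Sum>k\<le>n. real (n choose k) *\<^sub>R a k (n - k) S) S"
      using Suc by (simp add: a_def)
    also have "\<dots> = (\<Sum>k\<le>n. real (n choose k) *\<^sub>R addop (\<lambda>x. v x + w x) (a k (n - k)) S)"
      by (rule addop_sum[OF adm vw])
    also have "\<dots> = (\<Sum>k\<le>n. real (n choose k) *\<^sub>R a (Suc k) (n - k) S)
        + (\<Sum>k\<le>n. real (n choose k) *\<^sub>R a k (Suc n - k) S)"
      unfolding sum.distrib[symmetric]
      by (intro sum.cong refl) (simp add: addop_add[OF adm v w] av aw scaleR_add_right Suc_diff_le)
    \<comment> \<open>Pascal's rule is prepared by an index shift; the new top term costs nothing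
      because \<open>n choose Suc n\<close> is 0.\<close>
    also have "(\<Sum>k\<le>n. real (n choose k) *\<^sub>R a k (Suc n - k) S)
       = a 0 (Suc n) S + (\<Sum>k\<le>n. real (n choose Suc k) *\<^sub>R a (Suc k) (n - k) S)"
    proof -
      have "(\<Sum>k\<le>n. real (n choose k) *\<^sub>R a k (Suc n - k) S)
          = (\<Sum>k\<le>Suc n. real (n choose k) *\<^sub>R a k (Suc n - k) S)" by simp
      also have "\<dots> = a 0 (Suc n) S + (\<Sum>k\<le>n. real (n choose Suc k) *\<^sub>R a (Suc k) (n - k) S)"
        by (subst sum.atMost_Suc_shift) simp
      finally show ?thesis .
    qed
    also have "(\<Sum>k\<le>n. real (n choose k) *\<^sub>R a (Suc k) (n - k) S)
        + (a 0 (Suc n) S + (\<Sum>k\<le>n. real (n choose Suc k) *\<^sub>R a (Suc k) (n - k) S))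
        = a 0 (Suc n) S + (\<Sum>k\<le>n. real (Suc n choose Suc k) *\<^sub>R a (Suc k) (n - k) S)"
      by (simp add: sum.distrib scaleR_left_distrib)
    also have "\<dots> = (\<Sum>k\<le>Suc n. real (Suc n choose k) *\<^sub>R a k (Suc n - k) S)"
      by (subst sum.atMost_Suc_shift) simp
    finally show "(addop (\<lambda>x. v x + w x) ^^ Suc n) F S
        = (\<Sum>k\<le>Suc n. real (Suc n choose k) *\<^sub>R (addop v ^^ k) ((addop w ^^ (Suc n - k)) F) S)"
      by (simp add: a_def)
  qed
qed simp

text \<open>Growth is required only in the points \<open>A\<close> added to a fixed
  \<open>S\<close>, at a rate \<open>K\<close> of its own. The exploration takes
  \<open>K = 4 * R\<close> and a \<open>B\<close> that already contains the cost of
  \<open>S\<close>.\<close>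

lemma addop_power_bound:
  assumes w: "weight w" and K: "1 \<le> K" and B: "0 \<le> B"
    and F: "\<And>A. A \<in> cfg \<Longrightarrow> norm (F (S \<union> A)) \<le> B * K ^ card A"
    and A: "A \<in> cfg"
  shows "norm ((addop w ^^ n) F (S \<union> A)) \<le> (mass w * K) ^ n * B * K ^ card A"
  using A
proof (induction n arbitrary: A)
  case (Suc n)
  let ?B = "(mass w * K) ^ n * B"
  have B': "0 \<le> ?B" using B K mass_nonneg[of w] by simp
  have "norm (addop w ((addop w ^^ n) F) (S \<union> A)) \<le> mass w * (?B * (K * K ^ card A))"
  proof (rule addop_norm_le[OF w])
    fix x assume x: "x \<in> space M"
    have "norm ((addop w ^^ n) F (S \<union> insert x A)) \<le> ?B * K ^ card (insert x A)"
      using Suc.IH[of "insert x A"] x Suc.prems by simp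
    also have "\<dots> \<le> ?B * (K * K ^ card A)"
      by (intro mult_left_mono B' card_insert_power_le cfg_finite Suc.prems K)
    finally show "norm ((addop w ^^ n) F (insert x (S \<union> A))) \<le> ?B * (K * K ^ card A)"
      by simp
  qed (use B' K in simp)
  then show ?case by (simp add: mult_ac)
qed (simp add: F)

section \<open>Norm bounds for the exponential series\<close>

lemma summable_exp_bound: "summable (\<lambda>n. (x::real) ^ n * B /\<^sub>R fact n)"
  using summable_mult2[OF summable_exp_generic[of x], of B] by (simp only: scaleR_conv_of_real mult.assoc)

lemma suminf_exp_bound: "(\<Sum>n. (x::real) ^ n * B /\<^sub>R fact n) = exp x * B"
  using suminf_mult2[OF summable_exp_generic[of x], of B] by (simp only: exp_def scaleR_conv_of_real mult.assoc)

context
  fixes w :: "'a \<Rightarrow> real" and F :: "'a set \<Rightarrow> complex" and S and B K :: real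
  assumes w: "weight w" and K: "1 \<le> K" and B: "0 \<le> B"
    and F: "\<And>A. A \<in> cfg \<Longrightarrow> norm (F (S \<union> A)) \<le> B * K ^ card A"
begin

lemma expop_term_bound: "norm ((addop w ^^ n) F S /\<^sub>R fact n) \<le> (mass w * K) ^ n * B /\<^sub>R fact n"
  using addop_power_bound[OF w K B F cfg_empty, of n]
  by (simp add: divide_right_mono divide_inverse mult.commute)

lemma expop_summable: "summable (\<lambda>n. norm ((addop w ^^ n) F S /\<^sub>R fact n))"
  by (rule summable_comparison_test'[OF summable_exp_bound[of "mass w * K" B], of 0])
     (simp only: real_norm_def abs_norm_cancel expop_term_bound)

lemma expop_norm_le: "norm (expop w F S) \<le> B * exp (mass w * K)"
proof -
  have "norm (expop w F S) \<le> (\<Sum>n. norm ((addop w ^^ n) F S /\<^sub>R fact n))"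
    unfolding expop_def by (rule summable_norm[OF expop_summable])
  also have "\<dots> \<le> (\<Sum>n. (mass w * K) ^ n * B /\<^sub>R fact n)"
    by (intro suminf_le expop_term_bound expop_summable summable_exp_bound)
  finally show ?thesis unfolding suminf_exp_bound by (simp add: mult.commute)
qed

text \<open>The zeroth term of the series is \<open>F S\<close>, and an exponential series without
  its first term remains. This is the source of the small factors \<open>exp (...) - 1\<close> in
  the exploration.\<close>

lemma expop_diff_norm_le: "norm (expop w F S - F S) \<le> B * (exp (mass w * K) - 1)"
proof -
  have s: "summable (\<lambda>n. (addop w ^^ n) F S /\<^sub>R fact n)"
    using expop_summable by (rule summable_norm_cancel)
  have "expop w F S - F S = (\<Sum>n. (addop w ^^ Suc n) F S /\<^sub>R fact (Suc n))"
    using suminf_split_head[OF s] by (simp add: expop_def)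
  also have "norm \<dots> \<le> (\<Sum>n. norm ((addop w ^^ Suc n) F S /\<^sub>R fact (Suc n)))"
    using expop_summable by (intro summable_norm) (subst summable_Suc_iff)
  also have "\<dots> \<le> (\<Sum>n. (mass w * K) ^ Suc n * B /\<^sub>R fact (Suc n))"
    using expop_summable summable_exp_bound[of "mass w * K" B]
    by (intro suminf_le expop_term_bound) (subst summable_Suc_iff, assumption)+
  also have "\<dots> = exp (mass w * K) * B - B"
    using suminf_split_head[OF summable_exp_bound[of "mass w * K" B]]
    by (simp only: suminf_exp_bound) simp
  finally show ?thesis by (simp add: algebra_simps)
qed

end

lemma admissible_cfg_bound:
  assumes "0 \<le> C" "\<And>S. S \<in> cfg \<Longrightarrow> norm (F S) \<le> C * R ^ card S" "S \<in> cfg" "A \<in> cfg"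
  shows "norm (F (S \<union> A)) \<le> (C * R ^ card S) * R ^ card A"
proof -
  have "norm (F (S \<union> A)) \<le> C * R ^ card (S \<union> A)" using assms by simp
  also have "\<dots> \<le> C * R ^ (card S + card A)"
    using assms(1) R_ge1 by (intro mult_left_mono power_increasing card_Un_le) auto
  finally show ?thesis by (simp add: power_add)
qed

lemma expop_sums:
  assumes F: "admissible F" and w: "weight w"
  shows "(\<lambda>n. (addop w ^^ n) F S /\<^sub>R fact n) sums expop w F S"
proof (cases "S \<in> cfg")
  case True
  obtain C where C: "0 \<le> C" "\<And>S. S \<in> cfg \<Longrightarrow> norm (F S) \<le> C * R ^ card S"
    using admissible_bound[OF F] by blast
  have "summable (\<lambda>n. norm ((addop w ^^ n) F S /\<^sub>R fact n))"
    by (rule expop_summable[OF w R_ge1 _ admissible_cfg_bound[OF C True]]) (use C R_ge1 in auto)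
  then show ?thesis unfolding expop_def by (intro summable_sums) (rule summable_norm_cancel)
next
  case False
  then have "(addop w ^^ n) F S = 0" for n
    using admissible_outside[OF admissible_addop_power[OF F w]] by simp
  then show ?thesis by (simp add: expop_def)
qed

lemma expop_outside:
  assumes F: "admissible F" and w: "weight w" and "S \<notin> cfg"
  shows "expop w F S = 0"
  using admissible_outside[OF admissible_addop_power[OF F w] assms(3)] by (simp add: expop_def)

section \<open>Interchange of addition operators with infinite series\<close>

context
  fixes G :: "nat \<Rightarrow> 'a set \<Rightarrow> complex" and c :: "nat \<Rightarrow> real"
  assumes G: "\<And>j. admissible (G j)" and c0: "\<And>j. 0 \<le> c j" and c: "summable c"
    and bound: "\<And>j S. S \<in> cfg \<Longrightarrow> norm (G j S) \<le> c j * R ^ card S"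
begin

lemma series_norm_summable: "S \<in> cfg \<Longrightarrow> summable (\<lambda>j. norm (G j S))"
  by (rule summable_comparison_test'[OF summable_mult2[OF c, of "R ^ card S"], of 0])
     (use bound in simp)

lemma series_norm_le: "S \<in> cfg \<Longrightarrow> norm (\<Sum>j. G j S) \<le> (\<Sum>j. c j) * R ^ card S"
proof -
  assume S: "S \<in> cfg"
  have "norm (\<Sum>j. G j S) \<le> (\<Sum>j. norm (G j S))"
    by (rule summable_norm[OF series_norm_summable[OF S]])
  also have "\<dots> \<le> (\<Sum>j. c j * R ^ card S)"
    by (intro suminf_le series_norm_summable S bound summable_mult2 c)
  finally show ?thesis by (simp add: suminf_mult2[OF c])
qed

lemma admissible_series: "admissible (\<lambda>S. \<Sum>j. G j S)"
  unfolding admissible_def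
proof (intro conjI allI impI)
  show "(\<Sum>j. G j S) = 0" if "S \<notin> cfg" for S
    using admissible_outside[OF G that] by simp
  show "(\<lambda>x. \<Sum>j. G j (x ` {..<n::nat})) \<in> borel_measurable (PiM {..<n} (\<lambda>_. M))" for n
    using admissible_measurable[OF G] by (intro borel_measurable_suminf)
  show "\<exists>C\<ge>0. \<forall>S\<in>cfg. norm (\<Sum>j. G j S) \<le> C * R ^ card S"
    using series_norm_le suminf_nonneg[OF c c0] by blast
qed

lemma addop_series:
  assumes w: "weight w"
  shows "addop w (\<lambda>S. \<Sum>j. G j S) = (\<lambda>S. \<Sum>j. addop w (G j) S)"
proof
  fix S
  show "addop w (\<lambda>S. \<Sum>j. G j S) S = (\<Sum>j. addop w (G j) S)"
  proof (cases "S \<in> cfg")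
    case S: True
    have int: "integrable M (\<lambda>x. w x *\<^sub>R G j (insert x S))" for j
      by (rule integrable_insert[OF G S w])
    have "(\<integral>x. w x *\<^sub>R (\<Sum>j. G j (insert x S)) \<partial>M) = (\<integral>x. (\<Sum>j. w x *\<^sub>R G j (insert x S)) \<partial>M)"
      using S by (intro Bochner_Integration.integral_cong refl suminf_scaleR_right
          summable_norm_cancel[OF series_norm_summable]) simp
    also have "\<dots> = (\<Sum>j. \<integral>x. w x *\<^sub>R G j (insert x S) \<partial>M)"
    proof (rule integral_suminf[OF int])
      show "AE x in M. summable (\<lambda>j. norm (w x *\<^sub>R G j (insert x S)))"
        using S by (intro AE_I2) (auto intro!: summable_mult series_norm_summable)
      have le: "norm (G j (insert x S)) \<le> c j * (R * R ^ card S)" if "x \<in> space M" for j x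
      proof -
        have "norm (G j (insert x S)) \<le> c j * R ^ card (insert x S)"
          using bound that S by simp
        also have "\<dots> \<le> c j * (R * R ^ card S)"
          by (intro mult_left_mono c0 card_insert_power_le cfg_finite S R_ge1)
        finally show ?thesis .
      qed
      have "(\<integral>x. norm (w x *\<^sub>R G j (insert x S)) \<partial>M) \<le> (\<integral>x. \<bar>w x\<bar> * (c j * (R * R ^ card S)) \<partial>M)" for j
        using weight_integrable[OF w] integrable_norm[OF int[of j]] le
        by (intro integral_mono_AE) (auto intro!: AE_I2 mult_left_mono)
      then have "(\<integral>x. norm (w x *\<^sub>R G j (insert x S)) \<partial>M) \<le> mass w * (R * R ^ card S) * c j" for j
        by (simp add: mass_def mult_ac)
      then show "summable (\<lambda>j. \<integral>x. norm (w x *\<^sub>R G j (insert x S)) \<partial>M)"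
        by (intro summable_comparison_test'[OF summable_mult[OF c], of 0]) auto
    qed
    finally show ?thesis using S by (simp add: addop_def)
  qed (simp add: addop_def)
qed

end

lemma addop_power_series:
  assumes G: "\<And>j. admissible (G j)" and c0: "\<And>j. 0 \<le> c j" and c: "summable (c :: nat \<Rightarrow> real)"
    and bound: "\<And>j S. S \<in> cfg \<Longrightarrow> norm (G j S) \<le> c j * R ^ card S" and w: "weight w"
  shows "(addop w ^^ n) (\<lambda>S. \<Sum>j. G j S) = (\<lambda>S. \<Sum>j. (addop w ^^ n) (G j) S)"
proof (induction n)
  case (Suc n)
  have "addop w (\<lambda>S. \<Sum>j. (addop w ^^ n) (G j) S) = (\<lambda>S. \<Sum>j. addop w ((addop w ^^ n) (G j)) S)"
  proof (rule addop_series[where c = "\<lambda>j. (mass w * R) ^ n * c j"])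
    show "admissible ((addop w ^^ n) (G j))" for j by (intro admissible_addop_power G w)
    show "0 \<le> (mass w * R) ^ n * c j" for j using c0 mass_nonneg[of w] R_ge1 by simp
    show "summable (\<lambda>j. (mass w * R) ^ n * c j)" by (intro summable_mult c)
    show "norm ((addop w ^^ n) (G j) S) \<le> (mass w * R) ^ n * c j * R ^ card S" if "S \<in> cfg" for j S
      using addop_power_bound[OF w R_ge1 c0, of "G j" "{}" j S n] bound that by simp
  qed (rule w)
  then show ?case using Suc by simp
qed simp

lemma admissible_scaleR:
  assumes F: "admissible F"
  shows "admissible (\<lambda>S. c *\<^sub>R F S)"
proof -
  obtain C where C: "0 \<le> C" "\<And>S. S \<in> cfg \<Longrightarrow> norm (F S) \<le> C * R ^ card S"
    using admissible_bound[OF F] by blast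
  show ?thesis
    unfolding admissible_def
  proof (intro conjI allI impI)
    show "\<exists>C\<ge>0. \<forall>S\<in>cfg. norm (c *\<^sub>R F S) \<le> C * R ^ card S"
      using C by (intro exI[of _ "\<bar>c\<bar> * C"]) (auto simp: mult.assoc intro!: mult_left_mono)
  qed (use admissible_outside[OF F] admissible_measurable[OF F] in auto)
qed

lemma addop_scaleR: "addop w (\<lambda>S. c *\<^sub>R F S) = (\<lambda>S. c *\<^sub>R addop w F S)"
proof
  fix S
  have "(\<integral>x. w x *\<^sub>R c *\<^sub>R F (insert x S) \<partial>M) = (\<integral>x. c *\<^sub>R w x *\<^sub>R F (insert x S) \<partial>M)"
    by (simp add: mult.commute)
  also have "\<dots> = c *\<^sub>R (\<integral>x. w x *\<^sub>R F (insert x S) \<partial>M)"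
    by (rule integral_scaleR_right)
  finally show "addop w (\<lambda>S. c *\<^sub>R F S) S = c *\<^sub>R addop w F S" by (simp add: addop_def)
qed

lemma addop_power_scaleR: "(addop w ^^ n) (\<lambda>S. c *\<^sub>R F S) = (\<lambda>S. c *\<^sub>R (addop w ^^ n) F S)"
  by (induction n) (simp_all add: addop_scaleR)

text \<open>The terms of the series grow with constants
  \<open>(mass w * R) ^ j * C / fact j\<close>, which are summable in \<open>j\<close>, so the
  integrals in \<open>addop v\<close> may be taken term by term.\<close>

lemma
  assumes F: "admissible F" and v: "weight v" and w: "weight w"
  shows admissible_expop: "admissible (expop w F)"
    and addop_power_expop: "(addop v ^^ n) (expop w F) = (\<lambda>S. \<Sum>j. (addop v ^^ n) ((addop w ^^ j) F) S /\<^sub>R fact j)"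
proof -
  obtain C where C: "0 \<le> C" "\<And>S. S \<in> cfg \<Longrightarrow> norm (F S) \<le> C * R ^ card S"
    using admissible_bound[OF F] by blast
  define G where "G j S = (addop w ^^ j) F S /\<^sub>R fact j" for j S
  have E: "expop w F = (\<lambda>S. \<Sum>j. G j S)" by (auto simp: expop_def G_def)
  have G1: "admissible (G j)" for j
    unfolding G_def by (intro admissible_scaleR admissible_addop_power F w)
  have G2: "norm (G j S) \<le> (mass w * R) ^ j * C /\<^sub>R fact j * R ^ card S" if S: "S \<in> cfg" for j S
    using addop_power_bound[OF w R_ge1 C(1), of F "{}" S j] C(2) S
    by (simp add: G_def divide_right_mono divide_inverse mult_ac)
  have G3: "0 \<le> (mass w * R) ^ j * C /\<^sub>R fact j" for j
    using C(1) mass_nonneg[of w] R_ge1 by simp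
  show "admissible (expop w F)"
    unfolding E by (rule admissible_series[OF G1 G3 summable_exp_bound G2])
  have "(addop v ^^ n) (\<lambda>S. \<Sum>j. G j S) = (\<lambda>S. \<Sum>j. (addop v ^^ n) (G j) S)"
    by (rule addop_power_series[OF G1 G3 summable_exp_bound G2 v])
  then show "(addop v ^^ n) (expop w F) = (\<lambda>S. \<Sum>j. (addop v ^^ n) ((addop w ^^ j) F) S /\<^sub>R fact j)"
    unfolding E G_def addop_power_scaleR .
qed

text \<open>The law exp(A + B) = exp(A) exp(B) for commuting operators. It covers signed weights, so
  revealing a region (positive weight) and clearing it (negative weight) both become
  compositions.\<close>

lemma expop_add:
  assumes F: "admissible F" and v: "weight v" and w: "weight w"
  shows "expop (\<lambda>x. v x + w x) F S = expop v (expop w F) S"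
proof (cases "S \<in> cfg")
  case S: True
  obtain C where C: "0 \<le> C" "\<And>S. S \<in> cfg \<Longrightarrow> norm (F S) \<le> C * R ^ card S"
    using admissible_bound[OF F] by blast
  define b where "b k j = (addop v ^^ k) ((addop w ^^ j) F) S /\<^sub>R fact j /\<^sub>R fact k" for k j
  define D where "D = C * R ^ card S"
  have D: "0 \<le> D" using C R_ge1 by (simp add: D_def)
  have mR: "0 \<le> mass u * R" for u using mass_nonneg[of u] R_ge1 by simp
  have 1: "norm (b k j) \<le> ((mass v * R) ^ k /\<^sub>R fact k) * ((mass w * R) ^ j * D /\<^sub>R fact j)" for k j
  proof -
    have "norm ((addop v ^^ k) ((addop w ^^ j) F) (S \<union> {})) \<le> (mass v * R) ^ k * ((mass w * R) ^ j * D) * R ^ card ({} :: 'a set)"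
    proof (rule addop_power_bound[where S = S and A = "{}" and F = "(addop w ^^ j) F" and B = "(mass w * R) ^ j * D" and K = R and n = k, OF v R_ge1])
      show "0 \<le> (mass w * R) ^ j * D" using D mR by simp
      show "norm ((addop w ^^ j) F (S \<union> A)) \<le> (mass w * R) ^ j * D * R ^ card A" if A: "A \<in> cfg" for A
        using addop_power_bound[OF w R_ge1 D, of F S A j] admissible_cfg_bound[OF C S] A
        unfolding D_def by auto
    qed simp
    then have "norm ((addop v ^^ k) ((addop w ^^ j) F) S) \<le> (mass v * R) ^ k * ((mass w * R) ^ j * D)"
      by simp
    then have "norm ((addop v ^^ k) ((addop w ^^ j) F) S) / (fact j * fact k)
        \<le> (mass v * R) ^ k * ((mass w * R) ^ j * D) / (fact j * fact k)"
      by (rule divide_right_mono) simp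
    then show ?thesis by (simp add: b_def divide_inverse mult_ac)
  qed
  have "expop v (expop w F) S = (\<Sum>k. (\<Sum>j. (addop v ^^ k) ((addop w ^^ j) F) S /\<^sub>R fact j) /\<^sub>R fact k)"
    unfolding expop_def[of v] addop_power_expop[OF F v w] ..
  also have "\<dots> = (\<Sum>k. \<Sum>j. b k j)"
  proof (intro suminf_cong)
    fix k
    have "norm ((addop v ^^ k) ((addop w ^^ j) F) S /\<^sub>R fact j) \<le> (mass w * R) ^ j * ((mass v * R) ^ k * D) /\<^sub>R fact j" for j
      using 1[of k j] by (simp add: b_def divide_inverse mult_ac)
    then have "summable (\<lambda>j. (addop v ^^ k) ((addop w ^^ j) F) S /\<^sub>R fact j)"
      by (intro summable_comparison_test'[OF summable_exp_bound[of "mass w * R" "(mass v * R) ^ k * D"], of 0])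
    then show "(\<Sum>j. (addop v ^^ k) ((addop w ^^ j) F) S /\<^sub>R fact j) /\<^sub>R fact k = (\<Sum>j. b k j)"
      unfolding b_def by (rule suminf_scaleR_right)
  qed
  also have "\<dots> = (\<Sum>n. \<Sum>k\<le>n. b k (n - k))"
    by (rule suminf_suminf_diagonal[OF 1 summable_exp_generic _ summable_exp_bound]) (use mR D in auto)
  also have "\<dots> = expop (\<lambda>x. v x + w x) F S"
    unfolding expop_def addop_power_add[OF F v w]
  proof (intro suminf_cong)
    fix n
    show "(\<Sum>k\<le>n. b k (n - k)) = (\<Sum>k\<le>n. real (n choose k) *\<^sub>R (addop v ^^ k) ((addop w ^^ (n - k)) F) S) /\<^sub>R fact n"
      unfolding scaleR_sum_right b_def
    proof (intro sum.cong refl)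
      fix k assume "k \<in> {..n}"
      then have "inverse (fact n) * real (n choose k) = inverse (fact k) * inverse (fact (n - k))"
        by (simp add: binomial_fact divide_inverse)
      then show "(addop v ^^ k) ((addop w ^^ (n - k)) F) S /\<^sub>R fact (n - k) /\<^sub>R fact k
          = (real (n choose k) *\<^sub>R (addop v ^^ k) ((addop w ^^ (n - k)) F) S) /\<^sub>R fact n"
        by (simp only: scaleR_scaleR)
    qed
  qed
  finally show ?thesis by simp
next
  case False
  then show ?thesis
    using expop_outside[OF F weight_add[OF v w] False] expop_outside[OF admissible_expop[OF F w] v False]
    using assms by simp
qed

section \<open>Dependence on a constant intensity\<close>

lemma addop_const_power: "(addop (\<lambda>_. t) ^^ n) F = (\<lambda>S. t ^ n *\<^sub>R (addop (\<lambda>_. 1) ^^ n) F S)"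
proof (induction n)
  case (Suc n)
  have "addop (\<lambda>_. t) G = (\<lambda>S. t *\<^sub>R addop (\<lambda>_. 1) G S)" for G
    using addop_scale[of t "\<lambda>_. 1" G] by auto
  then show ?case using Suc by (simp add: addop_scaleR mult.commute)
qed simp

text \<open>In \<open>s\<close> this is an everywhere convergent power series, and d/ds exp(sA) = A
  exp(sA): raising the intensity inserts one more point distributed as \<open>M\<close>.\<close>

lemma expop_const_has_vector_derivative:
  assumes F: "admissible F"
  shows "((\<lambda>s. expop (\<lambda>_. s) F S) has_vector_derivative addop (\<lambda>_. 1) (expop (\<lambda>_. t) F) S) (at t)"
proof -
  define c where "c n = (addop (\<lambda>_. 1) ^^ n) F S /\<^sub>R fact n" for n
  have e: "(\<lambda>n. c n * of_real s ^ n) sums expop (\<lambda>_. s) F S" for s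
    using expop_sums[OF F weight_const[of s], of S]
    unfolding addop_const_power[where t = s] by (simp add: c_def scaleR_conv_of_real mult_ac)
  have sum: "summable (\<lambda>n. c n * z ^ n)" for z
  proof (rule powser_inside)
    show "summable (\<lambda>n. c n * of_real (norm z + 1) ^ n)" using e by (rule sums_summable)
    have "norm (complex_of_real (norm z + 1)) = norm z + 1"
      by (subst norm_of_real) auto
    then show "norm z < norm (complex_of_real (norm z + 1))" by simp
  qed
  have "((\<lambda>z. \<Sum>n. c n * z ^ n) has_field_derivative (\<Sum>n. diffs c n * of_real t ^ n)) (at (of_real t))"
    by (rule termdiffs_strong_converges_everywhere[OF sum])
  then have "((\<lambda>s. \<Sum>n. c n * of_real s ^ n) has_vector_derivative (\<Sum>n. diffs c n * of_real t ^ n)) (at t)"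
    by (rule has_vector_derivative_real_field)
  moreover have "(\<Sum>n. c n * of_real s ^ n) = expop (\<lambda>_. s) F S" for s
    using e by (rule sums_unique[symmetric])
  moreover have "(\<Sum>n. diffs c n * of_real t ^ n) = addop (\<lambda>_. 1) (expop (\<lambda>_. t) F) S"
  proof -
    have "addop (\<lambda>_. 1) (expop (\<lambda>_. t) F) S = (\<Sum>j. addop (\<lambda>_. 1) ((addop (\<lambda>_. t) ^^ j) F) S /\<^sub>R fact j)"
      using addop_power_expop[OF F weight_const[of 1] weight_const[of t], of 1] by simp
    also have "\<dots> = (\<Sum>n. diffs c n * of_real t ^ n)"
      unfolding addop_const_power[where t = t] addop_scaleR
      by (intro suminf_cong) (simp add: diffs_def c_def scaleR_conv_of_real del: of_nat_Suc)
    finally show ?thesis by simp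
  qed
  ultimately show ?thesis by simp
qed

end

section \<open>Exploring neighbourhoods\<close>

text \<open>Dividing by the solution exp(zt) of the unperturbed equation leaves a function
  \<open>u\<close> whose derivative is at most \<open>\<eta>\<close> times \<open>u\<close> in norm.
  Zeros of \<open>y\<close> are not excluded beforehand; their absence is a consequence of the lower
  bound.\<close>

lemma gronwall_norm_bounds:
  fixes y :: "real \<Rightarrow> complex"
  assumes T: "0 \<le> T" and y0: "y 0 = 1"
    and d: "\<And>t. 0 \<le> t \<Longrightarrow> t \<le> T \<Longrightarrow> \<exists>d. (y has_vector_derivative d) (at t) \<and> norm (d - z * y t) \<le> \<eta> * norm (y t)"
  shows "norm (y T * exp (- z * of_real T)) \<le> exp (\<eta> * T)"
    and "exp (- \<eta> * T) \<le> norm (y T * exp (- z * of_real T))"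
proof -
  define u where "u t = y t * exp (- z * of_real t)" for t
  have u': "\<exists>e. (u has_vector_derivative e) (at t) \<and> norm e \<le> \<eta> * norm (u t)" if t: "0 \<le> t" "t \<le> T" for t
  proof -
    obtain d where d: "(y has_vector_derivative d) (at t)" "norm (d - z * y t) \<le> \<eta> * norm (y t)"
      using d[OF t] by blast
    have "((\<lambda>w. exp (- z * w)) has_field_derivative exp (- z * of_real t) * (- z)) (at (of_real t))"
      by (auto intro!: derivative_eq_intros)
    then have "((\<lambda>t. exp (- z * of_real t)) has_vector_derivative exp (- z * of_real t) * (- z)) (at t)"
      by (rule has_vector_derivative_real_field)
    from has_vector_derivative_mult[OF d(1) this]
    have "(u has_vector_derivative (y t * (exp (- z * of_real t) * (- z)) + d * exp (- z * of_real t))) (at t)"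
      by (simp add: u_def[abs_def])
    also have "y t * (exp (- z * of_real t) * (- z)) + d * exp (- z * of_real t) = (d - z * y t) * exp (- z * of_real t)"
      by (simp add: algebra_simps)
    finally show ?thesis
      using mult_right_mono[OF d(2) norm_ge_zero[of "exp (- z * of_real t)"]]
      by (intro exI[of _ "(d - z * y t) * exp (- z * of_real t)"]) (simp add: u_def[abs_def] norm_mult mult.assoc)
  qed
  \<comment> \<open>The squared norm is differentiable also where \<open>u\<close> vanishes, unlike
    the norm itself.\<close>
  have sq: "\<exists>e. ((\<lambda>t. (norm (u t))\<^sup>2) has_real_derivative e) (at t) \<and> \<bar>e\<bar> \<le> 2 * \<eta> * (norm (u t))\<^sup>2"
    if t: "0 \<le> t" "t \<le> T" for t
  proof -
    obtain e where e: "(u has_vector_derivative e) (at t)" "norm e \<le> \<eta> * norm (u t)"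
      using u'[OF t] by blast
    have "((\<lambda>t. u t \<bullet> u t) has_derivative (\<lambda>h. u t \<bullet> (h *\<^sub>R e) + (h *\<^sub>R e) \<bullet> u t)) (at t)"
      using has_derivative_inner[OF e(1)[unfolded has_vector_derivative_def] e(1)[unfolded has_vector_derivative_def]] .
    then have "((\<lambda>t. (norm (u t))\<^sup>2) has_real_derivative 2 * (u t \<bullet> e)) (at t)"
      unfolding has_field_derivative_def power2_norm_eq_inner
      by (rule has_derivative_eq_rhs) (auto simp: inner_commute algebra_simps)
    moreover have "\<bar>u t \<bullet> e\<bar> \<le> norm (u t) * (\<eta> * norm (u t))"
      using Cauchy_Schwarz_ineq2[of "u t" e] mult_left_mono[OF e(2) norm_ge_zero[of "u t"]] by linarith
    ultimately show ?thesis
      by (intro exI[of _ "2 * (u t \<bullet> e)"]) (auto simp: power2_eq_square abs_mult mult_ac)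
  qed
  have n0: "(norm (u 0))\<^sup>2 = 1" by (simp add: u_def y0)
  have "(norm (u T))\<^sup>2 * exp (- (2 * \<eta>) * T) \<le> (norm (u 0))\<^sup>2 * exp (- (2 * \<eta>) * 0)"
  proof (rule DERIV_nonpos_imp_nonincreasing[OF T])
    fix t assume "0 \<le> t" "t \<le> T"
    then obtain e where e: "((\<lambda>t. (norm (u t))\<^sup>2) has_real_derivative e) (at t)" "\<bar>e\<bar> \<le> 2 * \<eta> * (norm (u t))\<^sup>2"
      using sq by blast
    have "((\<lambda>t. (norm (u t))\<^sup>2 * exp (- (2 * \<eta>) * t)) has_real_derivative (e - 2 * \<eta> * (norm (u t))\<^sup>2) * exp (- (2 * \<eta>) * t)) (at t)"
      by (rule derivative_eq_intros e(1) refl | simp add: algebra_simps)+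
    moreover have "(e - 2 * \<eta> * (norm (u t))\<^sup>2) * exp (- (2 * \<eta>) * t) \<le> 0"
      using e(2) by (intro mult_nonpos_nonneg) auto
    ultimately show "\<exists>d. ((\<lambda>t. (norm (u t))\<^sup>2 * exp (- (2 * \<eta>) * t)) has_real_derivative d) (at t) \<and> d \<le> 0" by blast
  qed
  then have "(norm (u T))\<^sup>2 * exp (- (2 * \<eta>) * T) \<le> 1" using n0 by simp
  then have "(norm (u T))\<^sup>2 \<le> exp (2 * \<eta> * T)" by (simp add: exp_minus field_simps)
  also have "\<dots> = (exp (\<eta> * T))\<^sup>2" by (simp add: exp_double[symmetric] mult.assoc)
  finally show "norm (y T * exp (- z * of_real T)) \<le> exp (\<eta> * T)"
    unfolding u_def by (rule power2_le_imp_le) simp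
  have "(norm (u 0))\<^sup>2 * exp (2 * \<eta> * 0) \<le> (norm (u T))\<^sup>2 * exp (2 * \<eta> * T)"
  proof (rule DERIV_nonneg_imp_nondecreasing[OF T])
    fix t assume "0 \<le> t" "t \<le> T"
    then obtain e where e: "((\<lambda>t. (norm (u t))\<^sup>2) has_real_derivative e) (at t)" "\<bar>e\<bar> \<le> 2 * \<eta> * (norm (u t))\<^sup>2"
      using sq by blast
    have "((\<lambda>t. (norm (u t))\<^sup>2 * exp (2 * \<eta> * t)) has_real_derivative (e + 2 * \<eta> * (norm (u t))\<^sup>2) * exp (2 * \<eta> * t)) (at t)"
      by (rule derivative_eq_intros e(1) refl | simp add: algebra_simps)+
    moreover have "(e + 2 * \<eta> * (norm (u t))\<^sup>2) * exp (2 * \<eta> * t) \<ge> 0"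
      using e(2) by (intro mult_nonneg_nonneg) auto
    ultimately show "\<exists>d. ((\<lambda>t. (norm (u t))\<^sup>2 * exp (2 * \<eta> * t)) has_real_derivative d) (at t) \<and> 0 \<le> d" by blast
  qed
  then have "1 \<le> (norm (u T))\<^sup>2 * exp (2 * \<eta> * T)" using n0 by simp
  then have "exp (- (2 * \<eta> * T)) \<le> (norm (u T))\<^sup>2" by (simp add: exp_minus field_simps)
  also have "exp (- (2 * \<eta> * T)) = (exp (- \<eta> * T))\<^sup>2" by (simp add: exp_double[symmetric] mult.assoc)
  finally show "exp (- \<eta> * T) \<le> norm (y T * exp (- z * of_real T))"
    unfolding u_def by (rule power2_le_imp_le) simp
qed

text \<open>\<open>\<kappa>\<close> bounds the expected number of neighbours of a point at intensity T; \<open>f_mult\<close> is the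
  multiplicativity over unconnected parts of z to the power of the independence number.\<close>

locale exploration = config_model M R for M :: "'a measure" and R :: real +
  fixes f :: "'a set \<Rightarrow> complex" and nb :: "'a \<Rightarrow> 'a \<Rightarrow> bool" and \<kappa> T :: real
  assumes f_admissible: "admissible f"
    and f_bound: "S \<in> cfg \<Longrightarrow> norm (f S) \<le> R ^ card S"
    and f_mult: "D \<in> cfg \<Longrightarrow> Y \<in> cfg \<Longrightarrow> (\<And>d y. d \<in> D \<Longrightarrow> y \<in> Y \<Longrightarrow> \<not> nb d y) \<Longrightarrow> f (D \<union> Y) = f D * f Y"
    and nb_sets: "x \<in> space M \<Longrightarrow> {y \<in> space M. nb x y} \<in> sets M"
    and nb_measure: "x \<in> space M \<Longrightarrow> T * measure M {y \<in> space M. nb x y} \<le> \<kappa>"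
    and \<kappa>: "0 \<le> \<kappa>" "exp (4 * R * \<kappa>) \<le> 3 / 2"
begin

definition Xi :: "real \<Rightarrow> complex" where
  "Xi t = expop (\<lambda>_. t) f {}"

section \<open>The exploration at a fixed intensity\<close>

context
  fixes t :: real
  assumes t: "0 \<le> t" "t \<le> T"
begin

text \<open>The intensity left after the neighbourhoods of all points of \<open>D\<close> have been
  searched: no further point can appear in them.\<close>

definition off :: "'a set \<Rightarrow> 'a \<Rightarrow> real" where
  "off D y = (if \<exists>d\<in>D. nb d y then 0 else t)"

text \<open>D consists of the explored points, all of whose neighbours are already in X \<union> D; X consists
  of the revealed points whose neighbourhoods are still unknown.\<close>

definition explored :: "'a set \<Rightarrow> 'a set \<Rightarrow> complex" where
  "explored X D = expop (off D) f (X \<union> D)"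

lemma nbs_sets: "D \<in> cfg \<Longrightarrow> {y \<in> space M. \<exists>d\<in>D. nb d y} \<in> sets M"
proof -
  assume D: "D \<in> cfg"
  have "{y \<in> space M. \<exists>d\<in>D. nb d y} = (\<Union>d\<in>D. {y \<in> space M. nb d y})" by auto
  also have "\<dots> \<in> sets M"
    using D nb_sets by (intro sets.finite_UN) (auto simp: cfg_def)
  finally show ?thesis .
qed

lemma weight_indicator: "A \<in> sets M \<Longrightarrow> weight (\<lambda>y. c * indicator A y)"
  unfolding weight_def by (auto intro!: exI[of _ "\<bar>c\<bar>"] simp: indicator_def)

lemma mass_indicator: "A \<in> sets M \<Longrightarrow> mass (\<lambda>y. c * indicator A y) = \<bar>c\<bar> * measure M A"
  by (simp add: mass_def abs_mult)

lemma t_measure_nb_le: "x \<in> space M \<Longrightarrow> t * measure M {y \<in> space M. nb x y} \<le> \<kappa>"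
  using nb_measure[of x] t by (auto intro: order_trans[OF mult_right_mono])

lemma expop_cong:
  assumes "\<And>x. x \<in> space M \<Longrightarrow> v x = w x"
  shows "expop v F = expop w F"
proof -
  have "addop v F = addop w F" for F
  proof
    fix S
    show "addop v F S = addop w F S"
      using assms by (auto simp: addop_def intro!: Bochner_Integration.integral_cong)
  qed
  then have "addop v = addop w" by auto
  then show ?thesis unfolding expop_def by simp
qed

lemma off_empty: "off {} = (\<lambda>_. t)"
  by (auto simp: off_def)

text \<open>Clearing the neighbourhood of \<open>D\<close> means adding the weight -t on it, whose
  mass is at most \<open>\<kappa>\<close> per point of \<open>D\<close>. A cleared configuration
  thereby becomes comparable with full intensity \<open>t\<close>.\<close>

lemma expop_off:
  assumes D: "D \<in> cfg"
  shows "weight (off D)"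
    and "expop (off D) f = expop (\<lambda>y. - t * indicator {y \<in> space M. \<exists>d\<in>D. nb d y} y) (expop (\<lambda>_. t) f)"
    and "mass (\<lambda>y. - t * indicator {y \<in> space M. \<exists>d\<in>D. nb d y} y) \<le> \<kappa> * card D"
proof -
  let ?N = "{y \<in> space M. \<exists>d\<in>D. nb d y}"
  have eq: "off D y = - t * indicator ?N y + t" if "y \<in> space M" for y
    using that by (auto simp: off_def indicator_def)
  have w: "weight (\<lambda>y. - t * indicator ?N y)"
    by (rule weight_indicator[OF nbs_sets[OF D]])
  have "weight (\<lambda>y. - t * indicator ?N y + t)"
    by (rule weight_add[OF w weight_const])
  moreover have "off D \<in> borel_measurable M \<longleftrightarrow> (\<lambda>y. - t * indicator ?N y + t) \<in> borel_measurable M"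
    by (rule measurable_cong) (rule eq)
  ultimately show "weight (off D)"
    unfolding weight_def using eq by auto
  show "expop (off D) f = expop (\<lambda>y. - t * indicator ?N y) (expop (\<lambda>_. t) f)"
    using expop_cong[of "off D" "\<lambda>y. - t * indicator ?N y + t"] eq
      expop_add[OF f_admissible w weight_const[of t]] by auto
  have "t * measure M ?N \<le> t * (\<Sum>d\<in>D. measure M {y \<in> space M. nb d y})"
  proof (rule mult_left_mono[OF _ t(1)])
    have "?N = (\<Union>d\<in>D. {y \<in> space M. nb d y})" by auto
    then show "measure M ?N \<le> (\<Sum>d\<in>D. measure M {y \<in> space M. nb d y})"
      using D nb_sets by (auto simp: cfg_def intro!: finite_measure_subadditive_finite)
  qed
  also have "\<dots> = (\<Sum>d\<in>D. t * measure M {y \<in> space M. nb d y})"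
    by (rule sum_distrib_left)
  also have "\<dots> \<le> (\<Sum>d\<in>D. \<kappa>)"
    using D by (intro sum_mono t_measure_nb_le) (auto simp: cfg_def)
  finally show "mass (\<lambda>y. - t * indicator ?N y) \<le> \<kappa> * card D"
    using t mass_indicator[OF nbs_sets[OF D], of "- t"] by (simp add: mult.commute)
qed

text \<open>The weight \<open>v\<close> generates those neighbours of \<open>x\<close> that
  \<open>D\<close> has not excluded already. The points it adds join the frontier while
  \<open>x\<close> moves to the explored set.\<close>

lemma explored_step:
  assumes x: "x \<in> space M" and D: "D \<in> cfg"
  obtains v where "weight v" "mass v \<le> \<kappa>" "expop (off D) f = expop v (expop (off (insert x D)) f)"
proof
  let ?A = "{y \<in> space M. nb x y} - {y \<in> space M. \<exists>d\<in>D. nb d y}"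
  have A: "?A \<in> sets M" using nb_sets[OF x] nbs_sets[OF D] by auto
  show w: "weight (\<lambda>y. t * indicator ?A y)" by (rule weight_indicator[OF A])
  have "t * measure M ?A \<le> t * measure M {y \<in> space M. nb x y}"
    using nb_sets[OF x] t by (intro mult_left_mono finite_measure_mono) auto
  also have "\<dots> \<le> \<kappa>" by (rule t_measure_nb_le[OF x])
  finally show "mass (\<lambda>y. t * indicator ?A y) \<le> \<kappa>"
    using t by (simp add: mass_indicator[OF A])
  have "off D y = t * indicator ?A y + off (insert x D) y" if "y \<in> space M" for y
    using that by (auto simp: off_def indicator_def)
  then have "expop (off D) f = expop (\<lambda>y. t * indicator ?A y + off (insert x D) y) f"
    by (rule expop_cong)
  also have "\<dots> = expop (\<lambda>y. t * indicator ?A y) (expop (off (insert x D)) f)"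
    using expop_add[OF f_admissible w expop_off(1)[of "insert x D"]] x D by auto
  finally show "expop (off D) f = expop (\<lambda>y. t * indicator ?A y) (expop (off (insert x D)) f)" .
qed

text \<open>With no frontier left, the remaining points avoid every neighbourhood of
  \<open>D\<close>, so \<open>f\<close> factorises. In the induction an added point near
  \<open>D\<close> has weight 0, and any other point keeps the hypothesis on \<open>Y\<close>
  intact.\<close>

lemma explored_terminal:
  assumes D: "D \<in> cfg"
  shows "explored {} D = f D * expop (off D) f {}"
proof -
  have *: "(addop (off D) ^^ n) f (D \<union> Y) = f D * (addop (off D) ^^ n) f Y"
    if "Y \<in> cfg" "\<And>d y. d \<in> D \<Longrightarrow> y \<in> Y \<Longrightarrow> \<not> nb d y" for n Y
    using that
  proof (induction n arbitrary: Y)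
    case 0
    then show ?case using f_mult[OF D] by simp
  next
    case (Suc n)
    have "(\<integral>x. off D x *\<^sub>R (addop (off D) ^^ n) f (insert x (D \<union> Y)) \<partial>M)
        = (\<integral>x. f D * (off D x *\<^sub>R (addop (off D) ^^ n) f (insert x Y)) \<partial>M)"
    proof (rule Bochner_Integration.integral_cong[OF refl])
      fix x assume x: "x \<in> space M"
      show "off D x *\<^sub>R (addop (off D) ^^ n) f (insert x (D \<union> Y))
          = f D * (off D x *\<^sub>R (addop (off D) ^^ n) f (insert x Y))"
      proof (cases "\<exists>d\<in>D. nb d x")
        case False
        then have "(addop (off D) ^^ n) f (D \<union> insert x Y) = f D * (addop (off D) ^^ n) f (insert x Y)"
          using Suc.prems x by (intro Suc.IH) auto
        then show ?thesis by simp
      qed (simp add: off_def)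
    qed
    also have "\<dots> = f D * (\<integral>x. off D x *\<^sub>R (addop (off D) ^^ n) f (insert x Y) \<partial>M)"
      by (rule integral_mult_right_zero)
    finally show ?case
      using Suc.prems D by (simp add: addop_def[of "off D" "(addop (off D) ^^ n) f"])
  qed
  have "(\<lambda>n. f D * ((addop (off D) ^^ n) f {} /\<^sub>R fact n)) sums (f D * expop (off D) f {})"
    by (intro sums_mult expop_sums f_admissible expop_off(1) D)
  moreover have "f D * ((addop (off D) ^^ n) f {} /\<^sub>R fact n) = (addop (off D) ^^ n) f D /\<^sub>R fact n" for n
    using *[of "{}" n] by simp
  ultimately have "(\<lambda>n. (addop (off D) ^^ n) f D /\<^sub>R fact n) sums (f D * expop (off D) f {})" by simp
  then show ?thesis
    unfolding explored_def expop_def by (simp add: sums_iff)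
qed

lemma mass_off_le: "mass (off D) \<le> T"
proof -
  have "mass (off D) \<le> (\<integral>x. T \<partial>M)"
    unfolding mass_def using t by (intro integral_mono_AE') (auto simp: off_def)
  then show ?thesis by (simp add: prob_space)
qed

text \<open>A weighted supremum bound over all states at once, without reference to
  \<open>Xi t\<close>, which might still vanish. The rate \<open>2 * R\<close> leaves room above the
  growth \<open>R\<close> of \<open>f\<close>, and \<open>4 * R\<close> makes a frontier point
  dearer than an explored one.\<close>

definition explored_le :: "real \<Rightarrow> bool" where
  "explored_le B \<longleftrightarrow> 0 \<le> B \<and>
     (\<forall>X\<in>cfg. \<forall>D\<in>cfg. norm (explored X D) \<le> B * (4 * R) ^ card X * (2 * R) ^ card D)"

text \<open>The trivial growth of \<open>f\<close> and total mass at most \<open>T\<close> give the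
  starting value of the iteration.\<close>

lemma explored_le_initial: "explored_le (exp (T * R))"
  unfolding explored_le_def
proof (intro conjI ballI)
  fix X D assume X: "X \<in> cfg" and D: "D \<in> cfg"
  have "norm (explored X D) \<le> R ^ card (X \<union> D) * exp (mass (off D) * R)"
    unfolding explored_def
  proof (rule expop_norm_le[OF expop_off(1)[OF D] R_ge1])
    show "norm (f (X \<union> D \<union> A)) \<le> R ^ card (X \<union> D) * R ^ card A" if "A \<in> cfg" for A
      using admissible_cfg_bound[of 1 f "X \<union> D" A] f_bound X D that by simp
  qed (use R_ge1 in simp)
  also have "\<dots> \<le> R ^ (card X + card D) * exp (T * R)"
    using R_ge1 mass_off_le[of D]
    by (intro mult_mono power_increasing card_Un_le) (auto intro!: mult_right_mono)
  also have "\<dots> \<le> ((4 * R) ^ card X * (2 * R) ^ card D) * exp (T * R)"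
    unfolding power_add using R_ge1 by (intro mult_right_mono mult_mono power_mono) auto
  finally show "norm (explored X D) \<le> exp (T * R) * (4 * R) ^ card X * (2 * R) ^ card D"
    by (simp add: mult_ac)
qed simp

text \<open>Recasts the weighted bound as the growth hypothesis of \<open>expop_norm_le\<close>:
  added points count as frontier points, hence the rate \<open>4 * R\<close>.\<close>

lemma explored_bound_Un:
  assumes B: "explored_le B" and X: "X \<in> cfg" and D: "D \<in> cfg" and A: "A \<in> cfg"
  shows "norm (expop (off D) f (X \<union> D \<union> A)) \<le> B * (4 * R) ^ card X * (2 * R) ^ card D * (4 * R) ^ card A"
proof -
  have "X \<union> D \<union> A = (X \<union> A) \<union> D" by auto
  then have "norm (expop (off D) f (X \<union> D \<union> A)) \<le> B * (4 * R) ^ card (X \<union> A) * (2 * R) ^ card D"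
    using B X D A unfolding explored_le_def explored_def by (metis cfg_Un)
  also have "\<dots> \<le> B * (4 * R) ^ (card X + card A) * (2 * R) ^ card D"
    using B R_ge1 unfolding explored_le_def
    by (intro mult_right_mono mult_left_mono power_increasing card_Un_le) auto
  finally show ?thesis by (simp add: power_add mult_ac)
qed

text \<open>Passing between cleared and full intensity costs at most a factor exp(4 R kappa) per
  point of \<open>D\<close>. \<open>Xi t\<close> appears because it is the full intensity with no
  points present.\<close>

lemma expop_off_terminal_bound:
  assumes B: "explored_le B" and D: "D \<in> cfg"
  shows "norm (expop (off D) f {}) \<le> B * exp (4 * R * \<kappa> * card D)"
    and "norm (expop (off D) f {} - Xi t) \<le> B * (exp (4 * R * \<kappa> * card D) - 1)"
proof -
  let ?v = "\<lambda>y. - t * indicator {y \<in> space M. \<exists>d\<in>D. nb d y} y :: real"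
  have v: "weight ?v" by (rule weight_indicator[OF nbs_sets[OF D]])
  have b: "norm (expop (\<lambda>_. t) f ({} \<union> A)) \<le> B * (4 * R) ^ card A" if "A \<in> cfg" for A
    using explored_bound_Un[OF B cfg_empty cfg_empty that] by (simp add: off_empty)
  have B0: "0 \<le> B" using B by (simp add: explored_le_def)
  have K: "1 \<le> 4 * R" using R_ge1 by simp
  have m: "exp (mass ?v * (4 * R)) \<le> exp (4 * R * \<kappa> * card D)"
    using mult_right_mono[OF expop_off(3)[OF D], of "4 * R"] R_ge1 by (simp add: mult_ac)
  have "norm (expop (off D) f {}) \<le> B * exp (mass ?v * (4 * R))"
    unfolding expop_off(2)[OF D] by (rule expop_norm_le[OF v K B0 b])
  also have "\<dots> \<le> B * exp (4 * R * \<kappa> * card D)"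
    by (rule mult_left_mono[OF m B0])
  finally show "norm (expop (off D) f {}) \<le> B * exp (4 * R * \<kappa> * card D)" .
  have "norm (expop (off D) f {} - Xi t) \<le> B * (exp (mass ?v * (4 * R)) - 1)"
    unfolding expop_off(2)[OF D] Xi_def by (rule expop_diff_norm_le[OF v K B0 b])
  also have "\<dots> \<le> B * (exp (4 * R * \<kappa> * card D) - 1)"
    using m by (intro mult_left_mono[OF _ B0]) simp
  finally show "norm (expop (off D) f {} - Xi t) \<le> B * (exp (4 * R * \<kappa> * card D) - 1)" .
qed

text \<open>Moving a point from X to D gains a factor 2R / 4R = 1 / 2 and costs exp(4 R \<kappa>) \<le> 3 / 2; closing a
  nonempty component costs (3 / 2 R) per point of D, against 2R. Iterating drives the a priori
  bound down to \<bar>Xi t\<bar>, which enters at X = D = {}.\<close>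

lemma explored_le_step:
  assumes B: "explored_le B" and B': "norm (Xi t) \<le> B'" "3 / 4 * B \<le> B'"
  shows "explored_le B'"
  unfolding explored_le_def
proof (intro conjI ballI)
  show B'0: "0 \<le> B'" using B'(1) norm_ge_zero order_trans by blast
  have B0: "0 \<le> B" using B by (simp add: explored_le_def)
  fix X D assume X: "X \<in> cfg" and D: "D \<in> cfg"
  show "norm (explored X D) \<le> B' * (4 * R) ^ card X * (2 * R) ^ card D"
  proof (cases "X = {}")
    case True
    show ?thesis
    proof (cases "D = {}")
      case True
      then show ?thesis using B'(1) \<open>X = {}\<close> by (simp add: explored_def off_empty Xi_def)
    next
      case False
      then have c: "1 \<le> card D" using cfg_finite[OF D] by (simp add: Suc_le_eq card_gt_0_iff)
      have "norm (explored X D) = norm (f D) * norm (expop (off D) f {})"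
        using explored_terminal[OF D] \<open>X = {}\<close> by (simp add: norm_mult)
      also have "\<dots> \<le> R ^ card D * (B * exp (4 * R * \<kappa> * card D))"
        using R_ge1 by (intro mult_mono f_bound D expop_off_terminal_bound(1)[OF B D]) auto
      also have "exp (4 * R * \<kappa> * card D) = exp (4 * R * \<kappa>) ^ card D"
        by (rule exp_of_nat2_mult)
      also have "R ^ card D * (B * exp (4 * R * \<kappa>) ^ card D) \<le> R ^ card D * (B * (3 / 2) ^ card D)"
        using R_ge1 B0 \<kappa>(2) by (intro mult_left_mono power_mono) auto
      also have "\<dots> = B * (3 / 4) ^ card D * (2 * R) ^ card D"
      proof -
        have "(3 / 4) ^ card D * (2 * R) ^ card D = R ^ card D * (3 / 2) ^ card D"
          unfolding power_mult_distrib[symmetric] by (simp add: mult.commute)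
        then show ?thesis by (metis mult.assoc mult.left_commute)
      qed
      also have "\<dots> \<le> B * (3 / 4) * (2 * R) ^ card D"
        using R_ge1 B0 power_decreasing[OF c, of "3/4 :: real"]
        by (intro mult_right_mono mult_left_mono) auto
      also have "\<dots> \<le> B' * (2 * R) ^ card D"
        using B'(2) R_ge1 by (intro mult_right_mono) auto
      finally show ?thesis using \<open>X = {}\<close> by simp
    qed
  next
    case False
    then obtain x where x: "x \<in> X" by auto
    define X' where "X' = X - {x}"
    have xM: "x \<in> space M" and X': "X' \<in> cfg" using X x by (auto simp: cfg_def X'_def)
    have cX: "card X = Suc (card X')" unfolding X'_def using cfg_finite[OF X] x by (rule card.remove)
    let ?D = "insert x D"
    have D': "?D \<in> cfg" using xM D by simp
    obtain v where v: "weight v" "mass v \<le> \<kappa>" "expop (off D) f = expop v (expop (off ?D) f)"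
      using explored_step[OF xM D] by blast
    define C where "C = B * (4 * R) ^ card X' * (2 * R) ^ card ?D"
    have C0: "0 \<le> C" using B0 R_ge1 by (simp add: C_def)
    have "norm (expop v (expop (off ?D) f) (X' \<union> ?D)) \<le> C * exp (mass v * (4 * R))"
      using R_ge1 explored_bound_Un[OF B X' D'] C0
      by (intro expop_norm_le[OF v(1)]) (auto simp: C_def)
    also have "\<dots> \<le> C * (3 / 2)"
    proof (rule mult_left_mono[OF _ C0])
      have "exp (mass v * (4 * R)) \<le> exp (4 * R * \<kappa>)"
        using mult_right_mono[OF v(2), of "4 * R"] R_ge1 by (simp add: algebra_simps)
      then show "exp (mass v * (4 * R)) \<le> 3 / 2" by (rule order_trans[OF _ \<kappa>(2)])
    qed
    \<comment> \<open>\<open>x\<close> may already lie in \<open>D\<close>, so the cardinality grows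
      by at most one. The product \<open>2 * R * (3 / 2)\<close> is 3/4 of the weight
      \<open>4 * R\<close> of the frontier point removed.\<close>
    also have "\<dots> \<le> (B * (4 * R) ^ card X' * (2 * R * (2 * R) ^ card D)) * (3 / 2)"
      unfolding C_def using B0 R_ge1 card_insert_power_le[OF cfg_finite[OF D], of "2 * R" x]
      by (intro mult_right_mono mult_left_mono) auto
    also have "\<dots> = (3 / 4 * B) * (4 * R) ^ card X * (2 * R) ^ card D"
      by (simp add: cX)
    also have "\<dots> \<le> B' * (4 * R) ^ card X * (2 * R) ^ card D"
      using B'(2) R_ge1 by (intro mult_right_mono) auto
    also have "X' \<union> ?D = X \<union> D" using x by (auto simp: X'_def)
    finally show ?thesis by (simp add: explored_def v(3))
  qed
qed

lemma explored_le_Xi: "explored_le (norm (Xi t))"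
proof -
  \<comment> \<open>The floor \<open>norm (Xi t)\<close> survives each step because 3/4 of it lies
    below it; the other entry tends to 0.\<close>
  define B where "B n = max (norm (Xi t)) ((3 / 4) ^ n * exp (T * R))" for n
  have B: "explored_le (B n)" for n
  proof (induction n)
    case 0
    show ?case
    proof (rule explored_le_step[OF explored_le_initial])
      have "3 / 4 * exp (T * R) \<le> exp (T * R)" by simp
      also have "\<dots> \<le> B 0" by (simp add: B_def)
      finally show "3 / 4 * exp (T * R) \<le> B 0" .
    qed (simp add: B_def)
  next
    case (Suc n)
    show ?case
    proof (rule explored_le_step[OF Suc])
      have "3 / 4 * max a b \<le> max a (3 / 4 * b)" if "0 \<le> a" for a b :: real
        using that by (auto simp: max_def)
      from this[of "norm (Xi t)" "(3 / 4) ^ n * exp (T * R)"]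
      show "3 / 4 * B n \<le> B (Suc n)" by (simp add: B_def mult.assoc)
    qed (simp add: B_def)
  qed
  have "(\<lambda>n. (3 / 4) ^ n * exp (T * R) :: real) \<longlonglongrightarrow> 0 * exp (T * R)"
    by (intro tendsto_intros LIMSEQ_power_zero) auto
  then have "B \<longlonglongrightarrow> max (norm (Xi t)) 0"
    unfolding B_def by (intro tendsto_max) auto
  then have lim: "B \<longlonglongrightarrow> norm (Xi t)" by (simp add: max_absorb1)
  show ?thesis
    unfolding explored_le_def
  proof (intro conjI ballI)
    fix X D assume X: "X \<in> cfg" and D: "D \<in> cfg"
    have "(\<lambda>n. B n * (4 * R) ^ card X * (2 * R) ^ card D) \<longlonglongrightarrow> norm (Xi t) * (4 * R) ^ card X * (2 * R) ^ card D"
      by (intro tendsto_intros lim)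
    then show "norm (explored X D) \<le> norm (Xi t) * (4 * R) ^ card X * (2 * R) ^ card D"
      by (rule LIMSEQ_le_const) (use B X D in \<open>auto simp: explored_le_def\<close>)
  qed simp
qed

text \<open>The constant \<open>3 * R\<close> is a sum: \<open>2 * R\<close>, the weight of the
  explored point \<open>x\<close>, for suppressing its neighbours, and \<open>R\<close>, the bound
  on \<open>f {x}\<close>, for restoring the cleared intensity once \<open>f {x}\<close> has been
  split off.\<close>

lemma expop_singleton_bound:
  assumes x: "x \<in> space M"
  shows "norm (expop (\<lambda>_. t) f {x} - f {x} * Xi t) \<le> 3 * R * (exp (4 * R * \<kappa>) - 1) * norm (Xi t)"
proof -
  let ?E = "exp (4 * R * \<kappa>) - 1"
  have E: "0 \<le> ?E" using \<kappa>(1) R_ge1 by simp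
  have X: "{x} \<in> cfg" using x by simp
  obtain v where v: "weight v" "mass v \<le> \<kappa>" "expop (off {}) f = expop v (expop (off {x}) f)"
    using explored_step[OF x cfg_empty] by blast
  have "norm (expop v (expop (off {x}) f) {x} - expop (off {x}) f {x}) \<le> (norm (Xi t) * (2 * R)) * (exp (mass v * (4 * R)) - 1)"
    using R_ge1 explored_bound_Un[OF explored_le_Xi cfg_empty X]
    by (intro expop_diff_norm_le[OF v(1)]) auto
  also have "\<dots> \<le> (norm (Xi t) * (2 * R)) * ?E"
    using mult_right_mono[OF v(2), of "4 * R"] R_ge1 by (intro mult_left_mono) (auto simp: mult_ac)
  finally have 1: "norm (expop (\<lambda>_. t) f {x} - expop (off {x}) f {x}) \<le> 2 * R * ?E * norm (Xi t)"
    using v(3) by (simp add: off_empty algebra_simps)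
  have 2: "expop (off {x}) f {x} = f {x} * expop (off {x}) f {}"
    using explored_terminal[OF X] by (simp add: explored_def)
  have "norm (f {x} * (expop (off {x}) f {} - Xi t)) \<le> R * (norm (Xi t) * ?E)"
    unfolding norm_mult
    using expop_off_terminal_bound(2)[OF explored_le_Xi X] f_bound[OF X] R_ge1
    by (intro mult_mono) auto
  then have 3: "norm (expop (off {x}) f {x} - f {x} * Xi t) \<le> R * ?E * norm (Xi t)"
    unfolding 2 by (simp add: right_diff_distrib mult_ac)
  show ?thesis
    using norm_triangle_ineq[of "expop (\<lambda>_. t) f {x} - expop (off {x}) f {x}" "expop (off {x}) f {x} - f {x} * Xi t"] 1 3
    by (simp add: algebra_simps)
qed

text \<open>Differentiation inserts one point averaged over \<open>M\<close>; as \<open>M\<close>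
  has total mass 1, the pointwise bound of \<open>expop_singleton_bound\<close> survives the
  averaging.\<close>

lemma Xi_derivative:
  assumes z: "\<And>x. x \<in> space M \<Longrightarrow> f {x} = z"
  obtains d where "(Xi has_vector_derivative d) (at t)"
    "norm (d - z * Xi t) \<le> 3 * R * (exp (4 * R * \<kappa>) - 1) * norm (Xi t)"
proof
  let ?e = "expop (\<lambda>_. t) f"
  show "(Xi has_vector_derivative addop (\<lambda>_. 1) ?e {}) (at t)"
    using expop_const_has_vector_derivative[OF f_admissible, of "{}" t] by (simp add: Xi_def[abs_def])
  have int: "integrable M (\<lambda>x. ?e {x})"
    using integrable_insert[OF admissible_expop[OF f_admissible weight_const[of t] weight_const[of t]] cfg_empty weight_const[of 1]]
    by simp
  have "addop (\<lambda>_. 1) ?e {} - z * Xi t = (\<integral>x. ?e {x} - z * Xi t \<partial>M)"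
    using int by (simp add: addop_def prob_space)
  also have "norm \<dots> \<le> (\<integral>x. norm (?e {x} - z * Xi t) \<partial>M)"
    by (rule integral_norm_bound)
  also have "\<dots> \<le> (\<integral>x. 3 * R * (exp (4 * R * \<kappa>) - 1) * norm (Xi t) \<partial>M)"
    using int expop_singleton_bound z by (intro integral_mono_AE) (auto intro!: AE_I2)
  finally show "norm (addop (\<lambda>_. 1) ?e {} - z * Xi t) \<le> 3 * R * (exp (4 * R * \<kappa>) - 1) * norm (Xi t)"
    by (simp add: prob_space)
qed

end

lemma Xi_bounds:
  assumes T: "0 \<le> T" and z: "\<And>x. x \<in> space M \<Longrightarrow> f {x} = z" and "f {} = 1"
  defines "\<eta> \<equiv> 3 * R * (exp (4 * R * \<kappa>) - 1)"
  shows "norm (Xi T * exp (- z * of_real T)) \<le> exp (\<eta> * T)"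
    and "exp (- \<eta> * T) \<le> norm (Xi T * exp (- z * of_real T))"
proof -
  have "addop (\<lambda>_. 0) F = (\<lambda>_. 0)" for F by (auto simp: addop_def)
  then have "(addop (\<lambda>_. 0) ^^ Suc n) F = (\<lambda>_. 0)" for n F by simp
  then have "expop (\<lambda>_. 0) f {} = (\<Sum>n. if n = 0 then f {} else 0)"
    unfolding expop_def by (intro suminf_cong) (auto simp del: funpow.simps(2) simp: gr0_conv_Suc)
  then have 0: "Xi 0 = 1" using \<open>f {} = 1\<close> sums_single[of 0 "\<lambda>_. f {}"] by (simp add: Xi_def sums_iff)
  have d: "\<exists>d. (Xi has_vector_derivative d) (at t) \<and> norm (d - z * Xi t) \<le> \<eta> * norm (Xi t)" if "0 \<le> t" "t \<le> T" for t
    using Xi_derivative[OF that z] unfolding \<eta>_def by blast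
  show "norm (Xi T * exp (- z * of_real T)) \<le> exp (\<eta> * T)"
    "exp (- \<eta> * T) \<le> norm (Xi T * exp (- z * of_real T))"
    by (rule gronwall_norm_bounds[OF T 0 d]; assumption)+
qed

end

section \<open>Analytic estimates\<close>

text \<open>The Schwarz lemma for h / (2B - h), where h(u) = g(a + u) - g(a).\<close>

lemma borel_caratheodory_half:
  assumes g: "g holomorphic_on ball a 1" and B: "\<And>w. w \<in> ball a 1 \<Longrightarrow> Re (g w - g a) < B"
    and w: "norm (w - a) \<le> 1 / 2"
  shows "norm (g w - g a) \<le> 2 * B"
proof -
  have B0: "0 < B" using B[of a] by simp
  define h where "h u = g (a + u) - g a" for u
  have h_hol: "h holomorphic_on ball 0 1"
    unfolding h_def
    by (intro holomorphic_intros holomorphic_on_compose_gen[OF _ g, unfolded o_def])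
       (auto simp: dist_norm)
  have Re_h: "Re (h u) < B" if "norm u < 1" for u
    using B[of "a + u"] that by (simp add: h_def dist_norm)
  have ne: "2 * of_real B - h u \<noteq> 0" if "norm u < 1" for u
  proof
    assume "2 * of_real B - h u = 0"
    then have "Re (h u) = 2 * B" by (auto simp: complex_eq_iff)
    then show False using Re_h[OF that] B0 by simp
  qed
  have lt: "norm (h u) < norm (2 * of_real B - h u)" if "norm u < 1" for u
  proof -
    have "(norm (2 * of_real B - h u))\<^sup>2 - (norm (h u))\<^sup>2 = 4 * B * (B - Re (h u))"
      unfolding cmod_power2 by (simp add: power2_eq_square algebra_simps)
    moreover have "0 < 4 * B * (B - Re (h u))" using B0 Re_h[OF that] by simp
    ultimately show ?thesis by (intro power2_less_imp_less[of "norm (h u)"]) auto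
  qed
  define \<phi> where "\<phi> u = h u / (2 * of_real B - h u)" for u
  have "\<phi> holomorphic_on ball 0 1"
    unfolding \<phi>_def using ne by (intro holomorphic_intros h_hol) auto
  moreover have "\<phi> 0 = 0" by (simp add: \<phi>_def h_def)
  moreover have "norm (\<phi> u) < 1" if "norm u < 1" for u
    using lt[OF that] ne[OF that] by (simp add: \<phi>_def norm_divide)
  ultimately have "norm (\<phi> (w - a)) \<le> norm (w - a)"
    using w by (intro Schwarz_Lemma) auto
  then have "norm (h (w - a)) \<le> norm (w - a) * norm (2 * of_real B - h (w - a))"
    using ne[of "w - a"] w by (simp add: \<phi>_def norm_divide divide_simps)
  \<comment> \<open>This reads |h| \<le> B + |h| / 2 and is solved for |h|.\<close>
  also have "\<dots> \<le> 1 / 2 * (2 * B + norm (h (w - a)))"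
    using w B0 norm_triangle_ineq4[of "2 * of_real B" "h (w - a)"]
    by (intro mult_mono) (auto simp: norm_mult)
  finally show ?thesis by (simp add: h_def)
qed

text \<open>A bound on the real part alone suffices. Here \<open>6 * A\<close> is twice
  \<open>3 * A\<close>, which strictly exceeds the oscillation \<open>2 * A\<close> of the real
  part, and the powers of 2 come from Cauchy's inequality on radius 1/2. Subtracting
  \<open>g a\<close> does not change the derivatives.\<close>

lemma higher_deriv_bound_of_Re:
  assumes g: "g holomorphic_on ball a 1" and A: "0 < A" and B: "\<And>w. w \<in> ball a 1 \<Longrightarrow> \<bar>Re (g w)\<bar> \<le> A"
  shows "norm ((deriv ^^ Suc n) g a) \<le> fact (Suc n) * (6 * A) * 2 ^ Suc n"
proof -
  have bd: "norm (g w - g a) \<le> 6 * A" if "norm (w - a) \<le> 1 / 2" for w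
  proof -
    have "norm (g w - g a) \<le> 2 * (3 * A)"
    proof (rule borel_caratheodory_half[OF g _ that])
      fix u assume "u \<in> ball a 1"
      then show "Re (g u - g a) < 3 * A" using B[of u] B[of a] A by auto
    qed
    then show ?thesis by simp
  qed
  have sub: "cball a (1 / 2) \<subseteq> ball a 1" by auto
  have hol: "(\<lambda>w. g w - g a) holomorphic_on ball a 1" by (intro holomorphic_intros g)
  have "norm ((deriv ^^ Suc n) (\<lambda>w. g w - g a) a) \<le> fact (Suc n) * (6 * A) / (1 / 2) ^ Suc n"
  proof (rule Cauchy_inequality)
    show "(\<lambda>w. g w - g a) holomorphic_on ball a (1 / 2)"
      by (rule holomorphic_on_subset[OF hol]) auto
    show "continuous_on (cball a (1 / 2)) (\<lambda>w. g w - g a)"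
      by (rule holomorphic_on_imp_continuous_on[OF holomorphic_on_subset[OF hol sub]])
    show "norm (g x - g a) \<le> 6 * A" if "norm (a - x) = 1 / 2" for x
      using that by (intro bd) (simp add: norm_minus_commute)
  qed simp
  moreover have "(deriv ^^ Suc n) (\<lambda>w. g w - g a) a = (deriv ^^ Suc n) g a"
    using higher_deriv_diff[OF g holomorphic_on_const[of "g a"] open_ball, of a "Suc n"] by simp
  ultimately show ?thesis by (simp add: power_divide)
qed

lemma norm_exp_diff_le:
  fixes a b :: complex
  assumes "Re a \<le> c" "Re b \<le> c"
  shows "norm (exp a - exp b) \<le> exp c * norm (a - b)"
proof (rule field_differentiable_bound)
  show "convex {z. Re z \<le> c}" by (rule convex_halfspace_Re_le)
  show "(exp has_field_derivative exp z) (at z within {z. Re z \<le> c})" for z :: complex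
    by (auto intro!: derivative_eq_intros)
qed (use assms in auto)

lemma norm_iexp_taylor2: "norm (exp (\<i> * of_real x) - 1 - \<i> * of_real x + of_real (x\<^sup>2) / 2) \<le> \<bar>x\<bar> ^ 3 / 6"
proof -
  have "(\<Sum>k\<le>2. (\<i> * of_real x) ^ k / fact k) = 1 + \<i> * of_real x - of_real (x\<^sup>2) / 2"
  proof -
    have "{..2::nat} = {0, 1, 2}" by auto
    then show ?thesis by (simp add: power_mult_distrib)
  qed
  then show ?thesis
    using iexp_approx1[of x 2] by (simp add: algebra_simps eval_nat_numeral)
qed

lemma cos_le_quadratic: "cos x - 1 \<le> - x\<^sup>2 / 12" if "\<bar>x\<bar> \<le> pi"
proof -
  define e where "e = 1 + \<i> * complex_of_real x - complex_of_real x ^ 2 / 2 - \<i> * complex_of_real x ^ 3 / 6"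
  have "{..3::nat} = {0, 1, 2, 3}" by auto
  moreover have "\<i> ^ 3 = - \<i>" by (simp add: power3_eq_cube)
  ultimately have "(\<Sum>k\<le>3. (\<i> * of_real x) ^ k / fact k) = e"
    by (simp add: power_mult_distrib fact_numeral e_def)
  then have "norm (exp (\<i> * of_real x) - e) \<le> x ^ 4 / 24"
    using iexp_approx1[of x 3] by (simp add: fact_numeral)
  moreover have "Re (exp (\<i> * of_real x) - e) = cos x - 1 + x\<^sup>2 / 2"
    by (simp add: Re_exp e_def)
  ultimately have "cos x - 1 + x\<^sup>2 / 2 \<le> x ^ 4 / 24"
    by (metis abs_Re_le_cmod abs_le_D1 order_trans)
  \<comment> \<open>As pi^2 is below 10, the share 1/2 - 10/24 = 1/12 of the quadratic term
    remains.\<close>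
  moreover have "x ^ 4 \<le> 10 * x\<^sup>2"
  proof -
    have "\<bar>x\<bar> \<le> 3.15" using that pi_approx by simp
    then have "x\<^sup>2 \<le> 3.15\<^sup>2" by (metis abs_ge_zero power2_abs power_mono)
    also have "\<dots> \<le> 10" by (simp add: power2_eq_square)
    finally have "x\<^sup>2 * x\<^sup>2 \<le> 10 * x\<^sup>2" by (intro mult_right_mono) auto
    then show ?thesis by (simp add: eval_nat_numeral)
  qed
  ultimately show ?thesis by simp
qed

text \<open>The majorant 1 / (1 + u^2) is chosen for its elementary antiderivative. For u > 1 the
  factor u^3 (1 + u^2) is at most 2 u^6 = 2 * 24^3 y^3, and y^3 \<le> 27 exp(y); the product of the
  constants is 746496.\<close>

lemma cube_exp_bound:
  fixes u :: real
  assumes u: "0 \<le> u"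
  shows "u ^ 3 * exp (- (u\<^sup>2 / 24)) \<le> 1000000 / (1 + u\<^sup>2)"
proof -
  define y where "y = u\<^sup>2 / 24"
  have y: "0 \<le> y" by (simp add: y_def)
  have "(y / 3) ^ 3 \<le> exp (y / 3) ^ 3"
  proof (rule power_mono)
    show "y / 3 \<le> exp (y / 3)" using exp_ge_add_one_self[of "y / 3"] by linarith
  qed (use y in simp)
  also have "\<dots> = exp y" by (simp add: exp_of_nat_mult[symmetric])
  finally have y3: "y ^ 3 \<le> 27 * exp y" by (simp add: power_divide)
  have e1: "1 \<le> exp y" using y by simp
  have "u ^ 3 * (1 + u\<^sup>2) \<le> 1000000 * exp y"
  proof (cases "u \<le> 1")
    case True
    have "u ^ 3 * (1 + u\<^sup>2) \<le> 1 * (1 + 1)"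
      using True u by (intro mult_mono add_mono power_le_one) auto
    also have "\<dots> \<le> 1000000 * exp y"
      by (rule order_trans[OF _ mult_left_mono[OF e1, of 1000000]]) auto
    finally show ?thesis .
  next
    case False
    have "u ^ 3 * (1 + u\<^sup>2) = u ^ 3 + u ^ 5" by (simp add: eval_nat_numeral algebra_simps)
    also have "\<dots> \<le> u ^ 6 + u ^ 6" using False by (intro add_mono power_increasing) auto
    also have "\<dots> = 27648 * y ^ 3" by (simp add: y_def power_divide power_mult[symmetric])
    also have "\<dots> \<le> 27648 * (27 * exp y)" using y3 by simp
    also have "\<dots> \<le> 1000000 * exp y" by simp
    finally show ?thesis .
  qed
  moreover have "0 < 1 + u\<^sup>2" by (simp add: add_pos_nonneg)
  ultimately show ?thesis
    unfolding y_def[symmetric] exp_minus by (simp add: field_simps)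
qed

section \<open>Fourier inversion on the integers\<close>

lemma has_integral_iexp_int:
  "((\<lambda>t. exp (\<i> * of_int k * of_real t)) has_integral complex_of_real (if k = 0 then 2 * pi else 0)) {- pi..pi}"
proof (cases "k = 0")
  case True
  then show ?thesis using has_integral_const_real[of "1::complex" "- pi" pi] by (simp add: scaleR_conv_of_real)
next
  case False
  define F where "F t = exp (\<i> * of_int k * of_real t) / (\<i> * of_int k)" for t :: real
  have "(F has_vector_derivative exp (\<i> * of_int k * of_real t)) (at t within {- pi..pi})" for t
  proof -
    have "((\<lambda>z. exp (\<i> * of_int k * z) / (\<i> * of_int k)) has_field_derivative exp (\<i> * of_int k * of_real t)) (at (of_real t))"
      using False by (auto intro!: derivative_eq_intros)
    then have "((\<lambda>t. exp (\<i> * of_int k * of_real t) / (\<i> * of_int k)) has_vector_derivative exp (\<i> * of_int k * of_real t)) (at t within {- pi..pi})"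
      by (rule has_vector_derivative_real_field)
    then show ?thesis unfolding F_def .
  qed
  then have "((\<lambda>t. exp (\<i> * of_int k * of_real t)) has_integral (F pi - F (- pi))) {- pi..pi}"
    by (intro fundamental_theorem_of_calculus) auto
  moreover have "exp (\<i> * of_int k * of_real pi) = exp (\<i> * of_int k * of_real (- pi))"
  proof -
    have "\<i> * of_int k * of_real pi = \<i> * of_int k * of_real (- pi) + of_int (2 * k) * (of_real pi * \<i>)"
      by (simp add: algebra_simps)
    then show ?thesis by (simp add: exp_eq)
  qed
  ultimately show ?thesis using False by (simp add: F_def)
qed

text \<open>Integration over a period picks out one coefficient; it may be done term by term by the
  M-test with majorant \<open>a\<close>. The shift \<open>m\<close> serves the translated law, and
  \<open>m = 0\<close> serves \<open>p\<close>.\<close>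

lemma fourier_coefficient:
  fixes a :: "nat \<Rightarrow> real" and m j :: int
  assumes a: "summable a" "\<And>n. 0 \<le> a n"
  defines "\<phi> \<equiv> \<lambda>t :: real. exp (\<i> * of_int m * of_real t) * (\<Sum>n. of_real (a n) * exp (\<i> * of_real t) ^ n)"
  shows "((\<lambda>t. exp (- (\<i> * of_int j * of_real t)) * \<phi> t) has_integral
     of_real (2 * pi * (if j < m then 0 else a (nat (j - m))))) {- pi..pi}"
proof -
  define g where "g t n = of_real (a n) * exp (\<i> * of_int (int n + m - j) * of_real t)" for t :: real and n
  have gn: "norm (g t n) = a n" for t n
    using a(2)[of n] by (simp add: g_def norm_mult norm_exp_eq_Re)
  have e: "exp (- (\<i> * of_int j * of_real t)) * (exp (\<i> * of_int m * of_real t) * (of_real (a n) * exp (\<i> * of_real t) ^ n)) = g t n" for t n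
  proof -
    have "exp (\<i> * of_real t) ^ n = exp (of_nat n * (\<i> * of_real t))" by (rule exp_of_nat_mult[symmetric])
    moreover have "g t n = of_real (a n) * (exp (- (\<i> * of_int j * of_real t)) * (exp (\<i> * of_int m * of_real t) * exp (of_nat n * (\<i> * of_real t))))"
      unfolding g_def exp_add[symmetric] by (simp add: algebra_simps)
    ultimately show ?thesis by simp
  qed
  have sum: "summable (\<lambda>n. of_real (a n) * exp (\<i> * of_real t) ^ n :: complex)" for t :: real
    by (rule summable_comparison_test'[OF a(1), of 0]) (use a(2) in \<open>simp add: norm_mult norm_power\<close>)
  have eq: "exp (- (\<i> * of_int j * of_real t)) * \<phi> t = (\<Sum>n. g t n)" for t
    unfolding \<phi>_def e[symmetric]
    by (simp add: suminf_mult[OF sum] suminf_mult[OF summable_mult[OF sum]])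
  have u: "uniform_limit {- pi..pi} (\<lambda>N t. \<Sum>n<N. g t n) (\<lambda>t. \<Sum>n. g t n) sequentially"
    by (rule Weierstrass_m_test[OF _ a(1)]) (simp add: gn)
  have c: "continuous_on {- pi..pi} (\<lambda>t. \<Sum>n<N. g t n)" for N
    unfolding g_def by (intro continuous_intros)
  obtain I J where IJ: "\<And>N. ((\<lambda>t. \<Sum>n<N. g t n) has_integral I N) {- pi..pi}"
    "((\<lambda>t. \<Sum>n. g t n) has_integral J) {- pi..pi}" "I \<longlonglongrightarrow> J"
    using uniform_limit_integral[OF u c trivial_limit_sequentially] by metis
  have "I N = (\<Sum>n<N. complex_of_real (a n) * complex_of_real (if int n + m - j = 0 then 2 * pi else 0))" for N
  proof (rule has_integral_unique[OF IJ(1)])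
    show "((\<lambda>t. \<Sum>n<N. g t n) has_integral (\<Sum>n<N. complex_of_real (a n) * complex_of_real (if int n + m - j = 0 then 2 * pi else 0))) {- pi..pi}"
      unfolding g_def by (intro has_integral_sum has_integral_mult_right has_integral_iexp_int) auto
  qed
  then have I: "I = (\<lambda>N. \<Sum>n<N. complex_of_real (a n) * complex_of_real (if int n + m - j = 0 then 2 * pi else 0))" by auto
  have "(\<lambda>n. complex_of_real (a n) * complex_of_real (if int n + m - j = 0 then 2 * pi else 0) :: complex) sums
      of_real (2 * pi * (if j < m then 0 else a (nat (j - m))))"
  proof (cases "j < m")
    case False
    have "(\<lambda>n. complex_of_real (a n) * complex_of_real (if int n + m - j = 0 then 2 * pi else 0) :: complex)
        = (\<lambda>n. if n = nat (j - m) then of_real (2 * pi * a n) else 0)"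
      using False by (auto simp: fun_eq_iff)
    then show ?thesis using False sums_single[of "nat (j - m)" "\<lambda>n. complex_of_real (2 * pi * a n)"] by simp
  next
    case True
    then have "(\<lambda>n. complex_of_real (a n) * complex_of_real (if int n + m - j = 0 then 2 * pi else 0) :: complex) = (\<lambda>n. 0)" by auto
    then show ?thesis using True by simp
  qed
  then have "I \<longlonglongrightarrow> of_real (2 * pi * (if j < m then 0 else a (nat (j - m))))"
    unfolding I sums_def .
  then have "J = of_real (2 * pi * (if j < m then 0 else a (nat (j - m))))"
    using IJ(3) LIMSEQ_unique by blast
  then show ?thesis using IJ(2) by (simp add: eq)
qed

lemma poisson_pgf:
  assumes "0 < \<nu>"
  shows "(\<Sum>n. of_real (pmf (poisson_pmf \<nu>) n) * z ^ n) = exp (of_real \<nu> * (z - 1) :: complex)"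
proof -
  have "of_real (pmf (poisson_pmf \<nu>) n) * z ^ n = ((of_real \<nu> * z) ^ n /\<^sub>R fact n) * of_real (exp (- \<nu>))" for n
    using assms by (simp add: scaleR_conv_of_real power_mult_distrib divide_inverse mult_ac)
  then have "(\<Sum>n. of_real (pmf (poisson_pmf \<nu>) n) * z ^ n) = exp (of_real \<nu> * z) * of_real (exp (- \<nu>))"
    using suminf_mult2[OF summable_exp_generic[of "of_real \<nu> * z"], of "of_real (exp (- \<nu>))"]
    by (simp only: exp_def[where 'a = complex])
  also have "\<dots> = exp (of_real \<nu> * (z - 1))"
    by (simp add: algebra_simps exp_add[symmetric] flip: exp_of_real)
  finally show ?thesis .
qed

section \<open>Laws with a nearly Poisson generating function\<close>

locale entire_pgf =
  fixes p :: "nat \<Rightarrow> real"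
  assumes p_nonneg: "0 \<le> p k" and p_summable: "1 \<le> r \<Longrightarrow> summable (\<lambda>k. p k * r ^ k)"
begin

text \<open>The factor real k ^ j comes from applying z d/dz to the generating function j times, so that
  s \<mapsto> moment_series j (exp (is)) has derivative i moment_series (j + 1) (exp (is)).\<close>

definition moment_series :: "nat \<Rightarrow> complex \<Rightarrow> complex" where
  "moment_series j z = (\<Sum>k. of_real (real k ^ j * p k) * z ^ k)"

text \<open>The polynomial factor is absorbed into the radius, since k^j \<le> (2^k)^j =
  (2^j)^k.\<close>

lemma moment_summable_real:
  assumes r: "1 \<le> r"
  shows "summable (\<lambda>k. real k ^ j * p k * r ^ k)"
proof (rule summable_comparison_test'[OF p_summable[of "2 ^ j * r"], of 0])
  show "1 \<le> 2 ^ j * r" using mult_mono[of 1 "2 ^ j" 1 r] r by simp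
  fix k
  have "real k ^ j \<le> (2 ^ k) ^ j"
    using of_nat_less_two_power[of k, where 'a = real] by (intro power_mono) auto
  also have "\<dots> = (2 ^ j) ^ k" by (simp add: power_mult[symmetric] mult.commute)
  finally have "real k ^ j * (p k * r ^ k) \<le> (2 ^ j) ^ k * (p k * r ^ k)"
    using p_nonneg r by (intro mult_right_mono) auto
  then show "norm (real k ^ j * p k * r ^ k) \<le> p k * (2 ^ j * r) ^ k"
    using p_nonneg[of k] r by (simp add: abs_mult power_mult_distrib mult_ac)
qed

lemma moment_summable: "summable (\<lambda>k. complex_of_real (real k ^ j * p k) * z ^ k)"
proof (rule summable_comparison_test'[OF moment_summable_real[of "max 1 (norm z)" j], of 0])
  fix k
  have "norm z ^ k \<le> max 1 (norm z) ^ k" by (intro power_mono) auto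
  then have "real k ^ j * p k * norm z ^ k \<le> real k ^ j * p k * max 1 (norm z) ^ k"
    using p_nonneg[of k] by (intro mult_left_mono) auto
  then show "norm (complex_of_real (real k ^ j * p k) * z ^ k) \<le> real k ^ j * p k * max 1 (norm z) ^ k"
    using p_nonneg[of k] by (simp add: norm_mult norm_power abs_mult)
qed simp

lemma moment_series_derivative:
  obtains d where "(moment_series j has_field_derivative d) (at z)" "z * d = moment_series (Suc j) z"
proof
  let ?c = "\<lambda>k. complex_of_real (real k ^ j * p k)"
  show "(moment_series j has_field_derivative (\<Sum>k. diffs ?c k * z ^ k)) (at z)"
    unfolding moment_series_def by (rule termdiffs_strong_converges_everywhere[OF moment_summable])
  have s: "summable (\<lambda>k. diffs ?c k * z ^ k)"
    by (rule termdiff_converges_all[OF moment_summable])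
  have "z * (\<Sum>k. diffs ?c k * z ^ k) = (\<Sum>k. z * (diffs ?c k * z ^ k))"
    by (rule suminf_mult[OF s, symmetric])
  also have "\<dots> = (\<Sum>k. of_real (real (Suc k) ^ Suc j * p (Suc k)) * z ^ Suc k)"
    by (intro suminf_cong) (simp add: diffs_def del: of_nat_Suc)
  also have "\<dots> = moment_series (Suc j) z"
    unfolding moment_series_def
    using suminf_split_head[OF moment_summable[of "Suc j" z]] by simp
  finally show "z * (\<Sum>k. diffs ?c k * z ^ k) = moment_series (Suc j) z" .
qed

lemma moment_series_iexp_derivative:
  "((\<lambda>s. moment_series j (exp (\<i> * s))) has_field_derivative \<i> * moment_series (Suc j) (exp (\<i> * s))) (at s)"
proof -
  obtain d where d: "(moment_series j has_field_derivative d) (at (exp (\<i> * s)))"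
    "exp (\<i> * s) * d = moment_series (Suc j) (exp (\<i> * s))"
    by (rule moment_series_derivative)
  have "((\<lambda>s. exp (\<i> * s)) has_field_derivative exp (\<i> * s) * \<i>) (at s)"
    by (auto intro!: derivative_eq_intros)
  from DERIV_chain2[OF d(1) this] show ?thesis
    using d(2) by (simp add: mult_ac)
qed

lemma moment_series_1: "moment_series j 1 = of_real (\<Sum>k. real k ^ j * p k)"
  using suminf_of_real[OF moment_summable_real[of 1 j], where 'a = complex]
  by (simp add: moment_series_def)

lemma variance_series:
  assumes "(\<Sum>k. p k) = 1"
  defines "\<mu> \<equiv> (\<Sum>k. real k * p k)"
  shows "(\<Sum>k. (real k - \<mu>)\<^sup>2 * p k) = (\<Sum>k. real k ^ 2 * p k) - \<mu>\<^sup>2"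
proof -
  have s: "summable (\<lambda>k. real k ^ j * p k)" for j using moment_summable_real[of 1 j] by simp
  have s0: "p sums 1" using s[of 0] assms(1) by (simp add: sums_iff)
  have s1: "(\<lambda>k. real k * p k) sums \<mu>" using s[of 1] by (simp add: \<mu>_def sums_iff)
  have s2: "(\<lambda>k. real k ^ 2 * p k) sums (\<Sum>k. real k ^ 2 * p k)" using s[of 2] by (rule summable_sums)
  have "(\<lambda>k. real k ^ 2 * p k - 2 * \<mu> * (real k * p k) + \<mu>\<^sup>2 * p k) sums
      ((\<Sum>k. real k ^ 2 * p k) - 2 * \<mu> * \<mu> + \<mu>\<^sup>2 * 1)"
    by (intro sums_add sums_diff sums_mult s0 s1 s2)
  moreover have "real k ^ 2 * p k - 2 * \<mu> * (real k * p k) + \<mu>\<^sup>2 * p k = (real k - \<mu>)\<^sup>2 * p k" for k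
    by (simp add: power2_eq_square algebra_simps)
  ultimately show ?thesis by (simp add: sums_iff power2_eq_square)
qed

end

text \<open>The bound on \<open>\<eta>\<close> is used in three forms: 48 eta \<le> 1/24 for the
  real part of the logarithm, 144 eta \<le> 1 for its cubic remainder, and 48 eta \<le> 1/2 for the
  variance.\<close>

locale near_poisson = entire_pgf p for p :: "nat \<Rightarrow> real" +
  fixes lam \<eta> :: real
  assumes p_sum: "(\<Sum>k. p k) = 1" and lam: "1 \<le> lam" and \<eta>: "0 < \<eta>" "\<eta> \<le> 1 / 2000"
    and upper: "norm z \<le> 3 \<Longrightarrow> norm (moment_series 0 z * exp (- of_real lam * (z - 1))) \<le> exp (\<eta> * lam)"
    and lower: "norm z \<le> 3 \<Longrightarrow> exp (- \<eta> * lam) \<le> norm (moment_series 0 z * exp (- of_real lam * (z - 1)))"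
begin

definition \<mu> :: real where "\<mu> = (\<Sum>k. real k * p k)"
definition v :: real where "v = (\<Sum>k. (real k - \<mu>)\<^sup>2 * p k)"

text \<open>The lower bound excludes zeros of the quotient on the strip, which is convex and hence
  contractible, so a holomorphic logarithm exists. It is normalised at 0, where the quotient is
  1.\<close>

lemma ex_log_ratio:
  obtains g :: "complex \<Rightarrow> complex" where
    "g holomorphic_on {s. \<bar>Im s\<bar> < 1}" "g 0 = 0"
    "\<And>s. \<bar>Im s\<bar> < 1 \<Longrightarrow> moment_series 0 (exp (\<i> * s)) = exp (of_real lam * (exp (\<i> * s) - 1) + g s)"
    "\<And>s. \<bar>Im s\<bar> < 1 \<Longrightarrow> \<bar>Re (g s)\<bar> \<le> \<eta> * lam"
proof -
  let ?S = "{s. \<bar>Im s\<bar> < 1}"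
  define q where "q s = moment_series 0 (exp (\<i> * s)) * exp (- of_real lam * (exp (\<i> * s) - 1))" for s
  have S: "?S = {s. Im s < 1} \<inter> {s. Im s > - 1}" by auto
  have conv: "convex ?S" unfolding S by (intro convex_Int convex_halfspace_Im_lt convex_halfspace_Im_gt)
  have op: "open ?S" unfolding S by (intro open_Int open_halfspace_Im_lt open_halfspace_Im_gt)
  have n3: "norm (exp (\<i> * s)) \<le> 3" if "\<bar>Im s\<bar> < 1" for s
  proof -
    have "norm (exp (\<i> * s)) = exp (- Im s)" by (simp add: norm_exp_eq_Re)
    also have "\<dots> \<le> exp 1" using that by simp
    also have "\<dots> \<le> 3" using exp_le by simp
    finally show ?thesis .
  qed
  have qb: "norm (q s) \<le> exp (\<eta> * lam)" "exp (- \<eta> * lam) \<le> norm (q s)" if "\<bar>Im s\<bar> < 1" for s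
    unfolding q_def using upper[OF n3[OF that]] lower[OF n3[OF that]] by auto
  have q0: "q s \<noteq> 0" if "s \<in> ?S" for s
  proof
    assume "q s = 0"
    then show False using qb(2)[of s] that by simp
  qed
  have mh: "(\<lambda>s. moment_series 0 (exp (\<i> * s))) holomorphic_on ?S"
    using moment_series_iexp_derivative by (auto simp: holomorphic_on_open[OF op])
  have qh: "q holomorphic_on ?S"
    unfolding q_def by (intro holomorphic_intros mh)
  obtain h where h: "h holomorphic_on ?S" "\<And>s. s \<in> ?S \<Longrightarrow> q s = exp (h s)"
    using contractible_imp_holomorphic_log[OF qh convex_imp_contractible[OF conv] q0] by metis
  define g where "g s = h s - h 0" for s
  have "q 0 = 1" using p_sum moment_series_1[of 0] by (simp add: q_def)
  then have h0: "exp (h 0) = 1" using h(2)[of 0] by simp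
  have qg: "q s = exp (g s)" if "\<bar>Im s\<bar> < 1" for s
    using h(2)[of s] h0 that by (simp add: g_def exp_diff)
  show thesis
  proof (rule that[of g])
    show "g holomorphic_on ?S" unfolding g_def by (intro holomorphic_intros h)
    show "g 0 = 0" by (simp add: g_def)
    fix s assume s: "\<bar>Im s\<bar> < 1"
    have "moment_series 0 (exp (\<i> * s)) = q s * exp (of_real lam * (exp (\<i> * s) - 1))"
      unfolding q_def by (simp add: mult.assoc exp_add[symmetric])
    then show "moment_series 0 (exp (\<i> * s)) = exp (of_real lam * (exp (\<i> * s) - 1) + g s)"
      using qg[OF s] by (simp add: exp_add mult.commute)
    have "exp (Re (g s)) \<le> exp (\<eta> * lam)" "exp (- \<eta> * lam) \<le> exp (Re (g s))"
      using qb[OF s] qg[OF s] by (simp_all add: norm_exp_eq_Re)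
    then show "\<bar>Re (g s)\<bar> \<le> \<eta> * lam" by (simp add: abs_le_iff)
  qed
qed

lemma log_characteristic_function:
  obtains g :: "real \<Rightarrow> complex" where
    "\<And>t. moment_series 0 (exp (\<i> * of_real t)) = exp (of_real lam * (exp (\<i> * of_real t) - 1) + g t)"
    "\<And>t. Re (g t) \<le> lam * t\<^sup>2 / 24"
    "\<And>t. norm (g t - \<i> * of_real ((\<mu> - lam) * t) + of_real ((v - lam) * t\<^sup>2 / 2)) \<le> lam * \<bar>t\<bar> ^ 3"
    "\<bar>v - lam\<bar> \<le> lam / 2"
proof -
  obtain g :: "complex \<Rightarrow> complex" where g: "g holomorphic_on {s. \<bar>Im s\<bar> < 1}" "g 0 = 0"
    "\<And>s. \<bar>Im s\<bar> < 1 \<Longrightarrow> moment_series 0 (exp (\<i> * s)) = exp (of_real lam * (exp (\<i> * s) - 1) + g s)"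
    "\<And>s. \<bar>Im s\<bar> < 1 \<Longrightarrow> \<bar>Re (g s)\<bar> \<le> \<eta> * lam"
    using ex_log_ratio by blast
  let ?S = "{s. \<bar>Im s\<bar> < 1}"
  have S: "?S = {s. Im s < 1} \<inter> {s. Im s > - 1}" by auto
  have op: "open ?S" unfolding S by (intro open_Int open_halfspace_Im_lt open_halfspace_Im_gt)
  define G where "G n = (deriv ^^ n) g" for n
  have G_deriv: "(G n has_field_derivative G (Suc n) s) (at s)" if "s \<in> ?S" for n s
    unfolding G_def using holomorphic_derivI[OF holomorphic_higher_deriv[OF g(1) op, of n] op that] by simp
  have G_bound: "norm (G (Suc n) (of_real t)) \<le> fact (Suc n) * (6 * (\<eta> * lam)) * 2 ^ Suc n" for n t
    unfolding G_def
  proof (rule higher_deriv_bound_of_Re)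
    have sub: "ball (of_real t) 1 \<subseteq> ?S"
    proof
      fix w assume "w \<in> ball (complex_of_real t) 1"
      then have "norm (w - of_real t) < 1" by (simp add: dist_norm norm_minus_commute)
      then show "w \<in> ?S" using abs_Im_le_cmod[of "w - of_real t"] by simp
    qed
    show "g holomorphic_on ball (of_real t) 1" by (rule holomorphic_on_subset[OF g(1) sub])
    show "0 < \<eta> * lam" using \<eta> lam by simp
    show "\<bar>Re (g w)\<bar> \<le> \<eta> * lam" if "w \<in> ball (of_real t) 1" for w
      using g(4)[of w] that sub by auto
  qed
  have seg: "s \<in> ?S \<and> (\<exists>x. s = of_real x)" if "s \<in> closed_segment 0 (of_real t)" for s t
    using that by (auto simp: in_segment scaleR_conv_of_real simp flip: of_real_mult)
  \<comment> \<open>The segment from 0 to t consists of real points, so \<open>G_bound\<close>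
    controls the remainder.\<close>
  have taylor: "norm (g (of_real t) - (\<Sum>i\<le>n. G i 0 * of_real t ^ i / fact i)) \<le> (fact (Suc n) * (6 * (\<eta> * lam)) * 2 ^ Suc n) * \<bar>t\<bar> ^ Suc n / fact n" for n t
  proof -
    have "norm (G 0 (of_real t) - (\<Sum>i\<le>n. G i 0 * (of_real t - 0) ^ i / fact i)) \<le> (fact (Suc n) * (6 * (\<eta> * lam)) * 2 ^ Suc n) * norm (of_real t - 0 :: complex) ^ Suc n / fact n"
    proof (rule field_Taylor[of "closed_segment 0 (of_real t)"])
      show "(G i has_field_derivative G (Suc i) x) (at x within closed_segment 0 (complex_of_real t))"
        if "x \<in> closed_segment 0 (complex_of_real t)" for i x
        using G_deriv[of x i] seg[OF that] by (auto intro: has_field_derivative_at_within)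
      show "norm (G (Suc n) x) \<le> fact (Suc n) * (6 * (\<eta> * lam)) * 2 ^ Suc n"
        if "x \<in> closed_segment 0 (complex_of_real t)" for x
        using seg[OF that] G_bound by auto
    qed auto
    then show ?thesis by (simp add: G_def)
  qed
  define L where "L s = of_real lam * (exp (\<i> * s) - 1) + g s" for s
  define L1 where "L1 s = of_real lam * (\<i> * exp (\<i> * s)) + G 1 s" for s
  have dL: "(L has_field_derivative L1 s) (at s)" if "s \<in> ?S" for s
    unfolding L_def L1_def using G_deriv[OF that, of 0]
    by (auto intro!: derivative_eq_intros simp: G_def)
  have dL1: "(L1 has_field_derivative (- of_real lam * exp (\<i> * s) + G 2 s)) (at s)" if "s \<in> ?S" for s
  proof -
    have "(L1 has_field_derivative (of_real lam * (\<i> * (exp (\<i> * s) * \<i>)) + G 2 s)) (at s)"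
      unfolding L1_def using G_deriv[OF that, of 1]
      by (auto intro!: derivative_eq_intros simp: numeral_2_eq_2)
    moreover have "\<i> * (exp (\<i> * s) * \<i>) = - exp (\<i> * s)"
      by (simp add: mult.commute[of "exp (\<i> * s)"])
    ultimately show ?thesis by simp
  qed
  have L0: "L 0 = 0" by (simp add: L_def g)
  \<comment> \<open>One function is differentiated in two ways, as a power series and as an
    exponential. At 0 this identifies \<open>L1 0\<close> with \<i> times the mean; the second
    differentiation below yields the variance.\<close>
  have first: "\<i> * moment_series 1 (exp (\<i> * s)) = exp (L s) * L1 s" if "s \<in> ?S" for s
  proof -
    have "((\<lambda>s. exp (L s)) has_field_derivative exp (L s) * L1 s) (at s)"
      by (auto intro!: derivative_eq_intros dL that)
    then have "((\<lambda>s. moment_series 0 (exp (\<i> * s))) has_field_derivative exp (L s) * L1 s) (at s)"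
      by (rule has_field_derivative_transform_within_open[OF _ op that]) (simp add: g(3) L_def)
    then show ?thesis
      using DERIV_unique moment_series_iexp_derivative[of 0 s] by simp
  qed
  have second: "- moment_series 2 1 = L1 0 ^ 2 + (- of_real lam + G 2 0)"
  proof -
    have "((\<lambda>s. exp (L s) * L1 s) has_field_derivative exp (L 0) * L1 0 * L1 0 + (- of_real lam * exp (\<i> * 0) + G 2 0) * exp (L 0)) (at 0)"
    proof (rule DERIV_mult)
      show "((\<lambda>s. exp (L s)) has_field_derivative exp (L 0) * L1 0) (at 0)"
        by (auto intro!: derivative_eq_intros dL)
      show "(L1 has_field_derivative (- of_real lam * exp (\<i> * 0) + G 2 0)) (at 0)"
        by (rule dL1) simp
    qed
    then have "((\<lambda>s. \<i> * moment_series 1 (exp (\<i> * s))) has_field_derivative exp (L 0) * L1 0 * L1 0 + (- of_real lam * exp (\<i> * 0) + G 2 0) * exp (L 0)) (at 0)"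
      by (rule has_field_derivative_transform_within_open[OF _ op]) (auto simp: first[symmetric])
    moreover have "((\<lambda>s. \<i> * moment_series 1 (exp (\<i> * s))) has_field_derivative \<i> * (\<i> * moment_series 2 (exp (\<i> * 0)))) (at 0)"
      using DERIV_cmult[OF moment_series_iexp_derivative[of 1 0], of \<i>] by (simp add: numeral_2_eq_2)
    ultimately have "exp (L 0) * L1 0 * L1 0 + (- of_real lam * exp (\<i> * 0) + G 2 0) * exp (L 0) = \<i> * (\<i> * moment_series 2 (exp (\<i> * 0)))"
      by (rule DERIV_unique)
    then show ?thesis by (simp add: L0 power2_eq_square mult.assoc[symmetric])
  qed
  have m1: "moment_series 1 1 = of_real \<mu>" using moment_series_1[of 1] by (simp add: \<mu>_def)
  have L1_0: "L1 0 = \<i> * of_real \<mu>" using first[of 0] m1 by (simp add: L0)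
  then have G1: "G 1 0 = \<i> * of_real (\<mu> - lam)" by (simp add: L1_def algebra_simps)
  have m2: "moment_series 2 1 = of_real (v + \<mu>\<^sup>2)"
    using moment_series_1[of 2] variance_series[OF p_sum] by (simp add: \<mu>_def v_def)
  have G2: "G 2 0 = of_real (lam - v)"
    using second unfolding L1_0 m2 by (simp add: power_mult_distrib algebra_simps)
  show thesis
  proof (rule that[of "\<lambda>t. g (of_real t)"])
    show "moment_series 0 (exp (\<i> * of_real t)) = exp (of_real lam * (exp (\<i> * of_real t) - 1) + g (of_real t))" for t
      by (rule g(3)) simp
    \<comment> \<open>The linear coefficient is purely imaginary, so the real part starts at second
      order; 48 = 2! * 6 * 2^2.\<close>
    show "Re (g (of_real t)) \<le> lam * t\<^sup>2 / 24" for t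
    proof -
      have "norm (g (of_real t) - G 1 0 * of_real t) \<le> 48 * \<eta> * lam * t\<^sup>2"
        using taylor[of t 1] g(2) by (simp add: G_def power2_eq_square)
      then have "Re (g (of_real t) - G 1 0 * of_real t) \<le> 48 * \<eta> * lam * t\<^sup>2"
        using complex_Re_le_cmod order_trans by blast
      moreover have "48 * \<eta> * (lam * t\<^sup>2) \<le> 1 / 24 * (lam * t\<^sup>2)"
        using \<eta> lam by (intro mult_right_mono) auto
      moreover have "Re (G 1 0 * of_real t) = 0" unfolding G1 by simp
      ultimately show ?thesis unfolding minus_complex.sel by linarith
    qed
    show "norm (g (of_real t) - \<i> * of_real ((\<mu> - lam) * t) + of_real ((v - lam) * t\<^sup>2 / 2)) \<le> lam * \<bar>t\<bar> ^ 3" for t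
    proof -
      have "{..2::nat} = {0, 1, 2}" by auto
      moreover have "G 0 0 = 0" by (simp add: G_def g)
      ultimately have "(\<Sum>i\<le>2. G i 0 * of_real t ^ i / fact i) = \<i> * of_real ((\<mu> - lam) * t) + of_real ((lam - v) * t\<^sup>2 / 2)"
        by (simp add: G1[simplified] G2)
      moreover have "(v - lam) * t\<^sup>2 / 2 = - ((lam - v) * t\<^sup>2 / 2)" by (simp add: field_simps)
      ultimately have "g (of_real t) - \<i> * of_real ((\<mu> - lam) * t) + of_real ((v - lam) * t\<^sup>2 / 2)
          = g (of_real t) - (\<Sum>i\<le>2. G i 0 * of_real t ^ i / fact i)"
        by (simp only: of_real_minus) simp
      also have "norm \<dots> \<le> (fact (Suc 2) * (6 * (\<eta> * lam)) * 2 ^ Suc 2) * \<bar>t\<bar> ^ Suc 2 / fact 2"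
        by (rule taylor)
      \<comment> \<open>144 = 3! * 6 * 2^3 / 2!.\<close>
      also have "\<dots> = 144 * \<eta> * (lam * \<bar>t\<bar> ^ 3)" by (simp add: fact_numeral eval_nat_numeral)
      also have "\<dots> \<le> 1 * (lam * \<bar>t\<bar> ^ 3)"
        using \<eta> lam by (intro mult_right_mono) auto
      finally show ?thesis by simp
    qed
    have "norm (G 2 0) \<le> 48 * (\<eta> * lam)"
      using G_bound[of 1 0] by (simp add: numeral_2_eq_2)
    moreover have "norm (G 2 0) = \<bar>lam - v\<bar>" unfolding G2 by (rule norm_of_real)
    moreover have "48 * \<eta> * lam \<le> 1 / 2 * lam"
      using \<eta> lam by (intro mult_right_mono) auto
    ultimately show "\<bar>v - lam\<bar> \<le> lam / 2" by linarith
  qed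
qed

section \<open>An integrable majorant and the comparison of the two laws\<close>

lemma majorant_integral:
  defines "h \<equiv> \<lambda>t. 12 / lam + 2000000 / (sqrt lam * (1 + (sqrt lam * t)\<^sup>2))"
  shows "h integrable_on {- pi..pi}" "integral {- pi..pi} h \<le> 2 * pi * (2000000 / lam)"
proof -
  define H where "H t = 12 / lam * t + 2000000 / lam * arctan (sqrt lam * t)" for t
  have "(H has_vector_derivative h t) (at t within {- pi..pi})" for t
  proof -
    have "sqrt lam / lam = 1 / sqrt lam"
      using lam by (simp add: real_div_sqrt divide_simps)
    moreover have "(H has_real_derivative 12 / lam + 2000000 / lam * (1 / (1 + (sqrt lam * t)\<^sup>2) * sqrt lam)) (at t)"
      unfolding H_def by (auto intro!: derivative_eq_intros simp: divide_inverse)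
    moreover have "2000000 / lam * (1 / (1 + (sqrt lam * t)\<^sup>2) * sqrt lam)
       = 2000000 * (sqrt lam / lam) * (1 / (1 + (sqrt lam * t)\<^sup>2))" by simp
    ultimately have "(H has_real_derivative h t) (at t)" by (simp add: h_def)
    then show ?thesis
      by (simp add: has_real_derivative_iff_has_vector_derivative has_vector_derivative_at_within)
  qed
  then have I: "(h has_integral H pi - H (- pi)) {- pi..pi}"
    by (intro fundamental_theorem_of_calculus) auto
  then show "h integrable_on {- pi..pi}" by blast
  have "arctan (sqrt lam * pi) \<le> pi / 2" using arctan_ubound less_imp_le by blast
  then have a: "2000000 / lam * arctan (sqrt lam * pi) \<le> 2000000 / lam * (pi / 2)"
    using lam by (intro mult_left_mono) auto
  have "integral {- pi..pi} h = 2 * (12 / lam * pi) + 2 * (2000000 / lam * arctan (sqrt lam * pi))"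
    unfolding integral_unique[OF I] by (simp add: H_def arctan_minus)
  also have "\<dots> \<le> 2 * (12 / lam * pi) + 2 * (2000000 / lam * (pi / 2))"
    by (intro add_left_mono mult_left_mono a) simp
  also have "\<dots> = 2 * pi * (1000012 / lam)"
    using lam by (simp add: field_simps)
  also have "\<dots> \<le> 2 * pi * (2000000 / lam)"
    using lam by (intro mult_left_mono divide_right_mono) auto
  finally show "integral {- pi..pi} h \<le> 2 * pi * (2000000 / lam)" .
qed

text \<open>With x = lam t^2 / 24 the quadratic term is (12 / lam) x exp(-x), at most 12 / lam,
  which suffices on a bounded interval. The cubic term needs decay: in u = sqrt(lam) |t| it is of
  size u^3 exp(-u^2 / 24) / sqrt(lam), and integration over t gains the second factor 1 /
  sqrt(lam).\<close>

lemma gaussian_moment_bound: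
  "(t\<^sup>2 / 2 + 2 * lam * \<bar>t\<bar> ^ 3) * exp (- (lam * t\<^sup>2 / 24))
    \<le> 12 / lam + 2000000 / (sqrt lam * (1 + (sqrt lam * t)\<^sup>2))"
proof -
  define x where "x = lam * t\<^sup>2 / 24"
  have "x \<le> exp x" using exp_ge_add_one_self[of x] by linarith
  then have "x * exp (- x) \<le> 1" by (simp add: exp_minus field_simps)
  then have "12 / lam * (x * exp (- x)) \<le> 12 / lam * 1" using lam by (intro mult_left_mono) auto
  moreover have "t\<^sup>2 / 2 = 12 / lam * x" using lam by (simp add: x_def)
  then have "t\<^sup>2 / 2 * exp (- x) = 12 / lam * (x * exp (- x))" by (simp only: mult.assoc)
  ultimately have 1: "t\<^sup>2 / 2 * exp (- x) \<le> 12 / lam" by (simp only: mult_1_right)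
  define u where "u = sqrt lam * \<bar>t\<bar>"
  have u: "0 \<le> u" and u2: "u\<^sup>2 = lam * t\<^sup>2" and u2': "(sqrt lam * t)\<^sup>2 = u\<^sup>2"
    using lam by (auto simp: u_def power_mult_distrib)
  have "lam * \<bar>t\<bar> ^ 3 = u ^ 3 / sqrt lam"
  proof -
    have "u ^ 3 = (sqrt lam * \<bar>t\<bar>) * (lam * t\<^sup>2)"
      unfolding u2[symmetric] u_def[symmetric] by (simp add: power3_eq_cube power2_eq_square)
    moreover have "\<bar>t\<bar> ^ 3 = \<bar>t\<bar> * t\<^sup>2" by (simp add: power3_eq_cube power2_eq_square)
    ultimately show ?thesis using lam by simp
  qed
  then have "2 * lam * \<bar>t\<bar> ^ 3 * exp (- x) = 2 / sqrt lam * (u ^ 3 * exp (- (u\<^sup>2 / 24)))"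
    by (simp only: mult.assoc[of 2 lam] x_def u2) simp
  also have "\<dots> \<le> 2 / sqrt lam * (1000000 / (1 + u\<^sup>2))"
    using lam by (intro mult_left_mono cube_exp_bound u) auto
  also have "\<dots> = 2000000 / (sqrt lam * (1 + (sqrt lam * t)\<^sup>2))" unfolding u2' by simp
  finally show ?thesis using 1 unfolding x_def[symmetric] by (simp add: distrib_right)
qed

text \<open>The characteristic functions exp(a) and exp(b) are compared under the inversion
  integral. The translated Poisson law has mean exactly \<open>\<mu>\<close> and variance
  \<open>v + \<gamma>\<close>, so the exponents differ by a quadratic term with
  \<open>\<gamma> < 1\<close> and by cubic remainders.\<close>

lemma abs_diff_tp_pmf_le:
  "\<bar>(if j < 0 then 0 else p (nat j)) - tp_pmf \<mu> v j\<bar> \<le> 2000000 / lam"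
proof -
  obtain g :: "real \<Rightarrow> complex" where
    g: "\<And>t. moment_series 0 (exp (\<i> * of_real t)) = exp (of_real lam * (exp (\<i> * of_real t) - 1) + g t)"
    and Re_g: "\<And>t. Re (g t) \<le> lam * t\<^sup>2 / 24"
    and g3: "\<And>t. norm (g t - \<i> * of_real ((\<mu> - lam) * t) + of_real ((v - lam) * t\<^sup>2 / 2)) \<le> lam * \<bar>t\<bar> ^ 3"
    and v: "\<bar>v - lam\<bar> \<le> lam / 2"
    using log_characteristic_function by blast
  define m where "m = \<lfloor>\<mu> - v\<rfloor>"
  define \<gamma> where "\<gamma> = \<mu> - v - of_int m"
  define \<nu> where "\<nu> = v + \<gamma>"
  have \<gamma>: "0 \<le> \<gamma>" "\<gamma> < 1" unfolding \<gamma>_def m_def by linarith+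
  \<comment> \<open>The deviation is at most lam / 2 + 1, and \<open>1 \<le> lam\<close> absorbs the
    1.\<close>
  have \<nu>: "lam / 2 \<le> \<nu>" "\<bar>lam - \<nu>\<bar> \<le> 3 * lam / 2" using \<gamma> v lam unfolding \<nu>_def by linarith+
  have tp: "tp_pmf \<mu> v j = (if j < m then 0 else pmf (poisson_pmf \<nu>) (nat (j - m)))"
    by (simp add: tp_pmf_def Let_def m_def \<nu>_def \<gamma>_def)
  define a where "a t = of_real lam * (exp (\<i> * of_real t) - 1) + g t" for t
  define b where "b t = \<i> * of_int m * of_real t + of_real \<nu> * (exp (\<i> * of_real t) - 1)" for t
  define h where "h t = 12 / lam + 2000000 / (sqrt lam * (1 + (sqrt lam * t)\<^sup>2))" for t
  have "((\<lambda>t. exp (- (\<i> * of_int j * of_real t)) * exp (a t)) has_integral of_real (2 * pi * (if j < 0 then 0 else p (nat j)))) {- pi..pi}"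
  proof -
    have "summable p" using p_summable[of 1] by simp
    from fourier_coefficient[OF this p_nonneg, where m = 0 and j = j, unfolded diff_0_right]
    show ?thesis using g unfolding moment_series_def a_def by simp
  qed
  moreover have "((\<lambda>t. exp (- (\<i> * of_int j * of_real t)) * exp (b t)) has_integral of_real (2 * pi * tp_pmf \<mu> v j)) {- pi..pi}"
  proof -
    have \<nu>0: "0 < \<nu>" using \<nu>(1) lam by linarith
    have "pmf (poisson_pmf \<nu>) = (\<lambda>n. (\<nu> ^ n /\<^sub>R fact n) * exp (- \<nu>))"
      using \<nu>0 by (auto simp: divide_inverse)
    then have "summable (pmf (poisson_pmf \<nu>))"
      by (simp only:) (intro summable_mult2 summable_exp_generic)
    from fourier_coefficient[OF this pmf_nonneg, where m = m and j = j]
    show ?thesis unfolding tp b_def exp_add poisson_pgf[OF \<nu>0] .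
  qed
  ultimately have I: "((\<lambda>t. exp (- (\<i> * of_int j * of_real t)) * exp (a t) - exp (- (\<i> * of_int j * of_real t)) * exp (b t))
      has_integral of_real (2 * pi * (if j < 0 then 0 else p (nat j))) - of_real (2 * pi * tp_pmf \<mu> v j)) {- pi..pi}"
    by (rule has_integral_diff)
  have bound: "norm (exp (- (\<i> * of_int j * of_real t)) * exp (a t) - exp (- (\<i> * of_int j * of_real t)) * exp (b t)) \<le> h t"
    if t: "t \<in> {- pi..pi}" for t
  proof -
    define E where "E = exp (\<i> * of_real t) - 1 - \<i> * of_real t + of_real (t\<^sup>2) / 2"
    define G where "G = g t - \<i> * of_real ((\<mu> - lam) * t) + of_real ((v - lam) * t\<^sup>2 / 2)"
    \<comment> \<open>The linear terms cancel since \<open>\<mu> = \<nu> + m\<close>; the quadratic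
      ones leave \<open>\<nu> - v = \<gamma>\<close>.\<close>
    have ab: "a t - b t = of_real (lam - \<nu>) * E + G + of_real (\<gamma> * t\<^sup>2 / 2)"
    proof -
      have "\<mu> = \<nu> + of_int m" by (simp add: \<nu>_def \<gamma>_def)
      then have \<mu>: "complex_of_real \<mu> = of_real \<nu> + of_int m" by simp
      have \<gamma>': "complex_of_real \<gamma> = of_real \<nu> - of_real v" by (simp add: \<nu>_def)
      show ?thesis
        unfolding a_def b_def E_def G_def by (simp add: \<mu> \<gamma>' algebra_simps diff_divide_distrib add_divide_distrib)
    qed
    have "norm (of_real (lam - \<nu>) * E) \<le> 3 * lam / 2 * (\<bar>t\<bar> ^ 3 / 6)"
      unfolding norm_mult norm_of_real E_def using lam by (intro mult_mono \<nu>(2) norm_iexp_taylor2) auto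
    moreover have "norm G \<le> lam * \<bar>t\<bar> ^ 3" unfolding G_def by (rule g3)
    moreover have "norm (complex_of_real (\<gamma> * t\<^sup>2 / 2)) \<le> t\<^sup>2 / 2"
      unfolding norm_of_real using \<gamma> by (simp add: mult_left_le_one_le)
    moreover have "3 * lam / 2 * (\<bar>t\<bar> ^ 3 / 6) \<le> lam * \<bar>t\<bar> ^ 3" using lam by simp
    ultimately have ab_le: "norm (a t - b t) \<le> t\<^sup>2 / 2 + 2 * lam * \<bar>t\<bar> ^ 3"
      unfolding ab
      using norm_triangle_ineq[of "of_real (lam - \<nu>) * E + G" "of_real (\<gamma> * t\<^sup>2 / 2)"]
        norm_triangle_ineq[of "of_real (lam - \<nu>) * E" G] by linarith
    \<comment> \<open>Both exponents keep the decay lam t^2 / 24: for \<open>a\<close> it is what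
      \<open>Re_g\<close> leaves of lam t^2 / 12, and for \<open>b\<close> it comes from
      \<open>\<nu>\<close> being at least lam / 2.\<close>
    have c: "cos t - 1 \<le> - t\<^sup>2 / 12" using t by (intro cos_le_quadratic) auto
    have "lam * (cos t - 1) \<le> lam * (- t\<^sup>2 / 12)" using c lam by (intro mult_left_mono) auto
    moreover have "Re (a t) = lam * (cos t - 1) + Re (g t)" by (simp add: a_def Re_exp)
    ultimately have Re_a: "Re (a t) \<le> - (lam * t\<^sup>2 / 24)" using Re_g[of t] by simp
    have "\<nu> * (cos t - 1) \<le> \<nu> * (- t\<^sup>2 / 12)" using c \<nu> lam by (intro mult_left_mono) auto
    moreover have "lam / 2 * t\<^sup>2 \<le> \<nu> * t\<^sup>2" using \<nu>(1) by (intro mult_right_mono) auto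
    moreover have "Re (b t) = \<nu> * (cos t - 1)" by (simp add: b_def Re_exp)
    ultimately have Re_b: "Re (b t) \<le> - (lam * t\<^sup>2 / 24)" by simp
    have "norm (exp (- (\<i> * of_int j * of_real t)) * exp (a t) - exp (- (\<i> * of_int j * of_real t)) * exp (b t))
        = norm (exp (a t) - exp (b t))"
      unfolding right_diff_distrib[symmetric] norm_mult by (simp add: norm_exp_eq_Re)
    also have "\<dots> \<le> exp (- (lam * t\<^sup>2 / 24)) * norm (a t - b t)"
      by (rule norm_exp_diff_le[OF Re_a Re_b])
    also have "\<dots> \<le> exp (- (lam * t\<^sup>2 / 24)) * (t\<^sup>2 / 2 + 2 * lam * \<bar>t\<bar> ^ 3)"
      by (intro mult_left_mono ab_le) auto
    also have "\<dots> \<le> h t"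
      using gaussian_moment_bound[of t] by (simp add: h_def mult.commute)
    finally show ?thesis .
  qed
  have "norm (complex_of_real (2 * pi * (if j < 0 then 0 else p (nat j))) - of_real (2 * pi * tp_pmf \<mu> v j)) \<le> integral {- pi..pi} h"
    using integral_norm_bound_integral[OF has_integral_integrable[OF I] _ bound] integral_unique[OF I]
      majorant_integral(1) by (simp add: h_def[abs_def])
  also have "\<dots> \<le> 2 * pi * (2000000 / lam)"
    using majorant_integral(2) by (simp add: h_def[abs_def])
  finally have "norm (complex_of_real (2 * pi * ((if j < 0 then 0 else p (nat j)) - tp_pmf \<mu> v j))) \<le> 2 * pi * (2000000 / lam)"
    by (simp only: of_real_diff[symmetric] right_diff_distrib)
  then have "2 * pi * \<bar>(if j < 0 then 0 else p (nat j)) - tp_pmf \<mu> v j\<bar> \<le> 2 * pi * (2000000 / lam)"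
    unfolding norm_of_real abs_mult by simp
  then show ?thesis by (rule mult_left_le_imp_le) simp
qed

end

section \<open>The independence number of uniform points\<close>

definition separated :: "real \<Rightarrow> 'a::metric_space set \<Rightarrow> bool" where
  "separated r S \<longleftrightarrow> (\<forall>x\<in>S. \<forall>y\<in>S. x \<noteq> y \<longrightarrow> r < dist x y)"

text \<open>A version on sets of points, as functionals on \<open>cfg\<close> require;
  \<open>indep_num\<close> works with indices instead.\<close>

definition alpha :: "real \<Rightarrow> 'a::metric_space set \<Rightarrow> nat" where
  "alpha r S = Max {card T | T. T \<subseteq> S \<and> separated r T}"

lemma alpha_set:
  assumes "finite S"
  shows "finite {card T | T. T \<subseteq> S \<and> separated r T}" "{card T | T. T \<subseteq> S \<and> separated r T} \<noteq> {}"
  using assms by (auto simp: separated_def intro: exI[of _ "{}"])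

lemma alpha_ge: "finite S \<Longrightarrow> T \<subseteq> S \<Longrightarrow> separated r T \<Longrightarrow> card T \<le> alpha r S"
  unfolding alpha_def using alpha_set(1)[of S r] by (intro Max_ge) auto

lemma alpha_attained:
  assumes "finite S"
  obtains T where "T \<subseteq> S" "separated r T" "card T = alpha r S"
  using Max_in[OF alpha_set[OF assms, of r]] that unfolding alpha_def by auto

lemma alpha_le_card: "finite S \<Longrightarrow> alpha r S \<le> card S"
  by (metis alpha_attained card_mono)

lemma alpha_empty [simp]: "alpha r {} = 0"
  using alpha_le_card[of "{}" r] by simp

lemma alpha_singleton [simp]: "alpha r {x} = 1"
  using alpha_le_card[of "{x}" r] alpha_ge[of "{x}" "{x}" r] by (auto simp: separated_def)

text \<open>No edge joins the two parts, so independent sets split into their traces and can be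
  recombined. Since \<open>0 \<le> r\<close>, the parts are disjoint: a common point would have
  distance 0 to itself.\<close>

lemma alpha_Un:
  assumes D: "finite D" and Y: "finite Y" and r: "0 \<le> r" and far: "\<And>d y. d \<in> D \<Longrightarrow> y \<in> Y \<Longrightarrow> r < dist d y"
  shows "alpha r (D \<union> Y) = alpha r D + alpha r Y"
proof (rule antisym)
  obtain T where T: "T \<subseteq> D \<union> Y" "separated r T" "card T = alpha r (D \<union> Y)"
    using alpha_attained[of "D \<union> Y"] D Y by blast
  have "card T \<le> card (T \<inter> D) + card (T \<inter> Y)"
    using T(1) card_Un_le[of "T \<inter> D" "T \<inter> Y"] by (simp add: Int_Un_distrib[symmetric] Int_absorb2)
  also have "\<dots> \<le> alpha r D + alpha r Y"
    using T(2) D Y by (intro add_mono alpha_ge) (auto simp: separated_def)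
  finally show "alpha r (D \<union> Y) \<le> alpha r D + alpha r Y" using T(3) by simp
next
  obtain S where S: "S \<subseteq> D" "separated r S" "card S = alpha r D" using alpha_attained[OF D] by blast
  obtain T where T: "T \<subseteq> Y" "separated r T" "card T = alpha r Y" using alpha_attained[OF Y] by blast
  have disj: "S \<inter> T = {}"
  proof (rule ccontr)
    assume "S \<inter> T \<noteq> {}"
    then obtain x where "x \<in> D" "x \<in> Y" using S(1) T(1) by auto
    with far[of x x] r show False by simp
  qed
  have "separated r (S \<union> T)"
    using S T far unfolding separated_def by (metis Un_iff dist_commute subsetD)
  then have "card (S \<union> T) \<le> alpha r (D \<union> Y)" using S T D Y by (intro alpha_ge) auto
  then show "alpha r D + alpha r Y \<le> alpha r (D \<union> Y)"
    using card_Un_disjoint[OF _ _ disj] finite_subset[OF S(1) D] finite_subset[OF T(1) Y] S(3) T(3) by simp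
qed

text \<open>Coinciding sample points have distance 0, hence are adjacent, so an independent index
  set never contains two of them and corresponds to a set of distinct points.\<close>

lemma indep_num_eq_alpha:
  assumes r: "0 \<le> r"
  shows "indep_num r xs n = alpha r (xs ` {..<n})"
proof -
  have "{card S | S. S \<subseteq> {..<n} \<and> (\<forall>i\<in>S. \<forall>j\<in>S. i \<noteq> j \<longrightarrow> r < dist (xs i) (xs j))}
      = {card T | T. T \<subseteq> xs ` {..<n} \<and> separated r T}" (is "?A = ?B")
  proof (intro antisym subsetI)
    fix c assume "c \<in> ?A"
    then obtain S where S: "c = card S" "S \<subseteq> {..<n}" "\<forall>i\<in>S. \<forall>j\<in>S. i \<noteq> j \<longrightarrow> r < dist (xs i) (xs j)"
      by auto
    have "inj_on xs S"
    proof (rule inj_onI, rule ccontr)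
      fix i j assume "i \<in> S" "j \<in> S" "xs i = xs j" "i \<noteq> j"
      then show False using S(3) r by force
    qed
    then have "c = card (xs ` S)" by (simp add: S(1) card_image)
    moreover have "separated r (xs ` S)" using S(3) by (auto simp: separated_def)
    ultimately show "c \<in> ?B" using S(2) by auto
  next
    fix c assume "c \<in> ?B"
    then obtain T where T: "c = card T" "T \<subseteq> xs ` {..<n}" "separated r T" by auto
    then obtain S where S: "S \<subseteq> {..<n}" "inj_on xs S" "T = xs ` S"
      by (metis subset_image_inj)
    then have "c = card S" using T(1) by (simp add: card_image)
    moreover have "\<forall>i\<in>S. \<forall>j\<in>S. i \<noteq> j \<longrightarrow> r < dist (xs i) (xs j)"
      using S T(3) unfolding separated_def by (metis image_eqI inj_on_def)
    ultimately show "c \<in> ?A" using S(1) by auto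
  qed
  then show ?thesis by (simp add: indep_num_def alpha_def)
qed

text \<open>Turns the maximum into a finite disjunction of conditions on pairwise distances, from
  which the measurability of \<open>alpha\<close> is read off.\<close>

lemma alpha_image_ge_iff:
  assumes r: "0 \<le> r"
  shows "k \<le> alpha r (x ` {..<n::nat}) \<longleftrightarrow>
    (\<exists>S\<in>Pow {..<n}. k \<le> card S \<and> (\<forall>i\<in>S. \<forall>j\<in>S. i = j \<or> r < dist (x i) (x j)))"
proof -
  let ?A = "{card S | S. S \<subseteq> {..<n} \<and> (\<forall>i\<in>S. \<forall>j\<in>S. i \<noteq> j \<longrightarrow> r < dist (x i) (x j))}"
  have "finite ?A" by simp
  moreover have "?A \<noteq> {}" by (auto intro: exI[of _ "{}"])
  ultimately have "k \<le> Max ?A \<longleftrightarrow> (\<exists>a\<in>?A. k \<le> a)" by (rule Max_ge_iff)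
  moreover have "(\<exists>a\<in>?A. k \<le> a) \<longleftrightarrow>
      (\<exists>S\<in>Pow {..<n}. k \<le> card S \<and> (\<forall>i\<in>S. \<forall>j\<in>S. i = j \<or> r < dist (x i) (x j)))"
    by blast
  ultimately show ?thesis
    unfolding indep_num_eq_alpha[OF r, symmetric] indep_num_def by simp
qed

locale uniform_points =
  fixes U :: "'a::euclidean_space set" and r :: real
  assumes U: "open U" "emeasure lborel U = 1" and r: "0 \<le> r"
begin

abbreviation "MU \<equiv> restrict_space lborel U"

lemma space_MU: "space MU = U"
  by (simp add: space_restrict_space)

lemma prob_space_MU: "prob_space MU"
  using U by (intro prob_spaceI) (simp add: space_MU emeasure_restrict_space)

text \<open>The growth rate is the radius of the disc of generating-function arguments: there
  \<open>z ^ alpha r S\<close> is at most \<open>3 ^ card S\<close> in norm.\<close>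

sublocale config_model MU "3 :: real"
  by (intro config_model.intro prob_space_MU config_model_axioms.intro) simp

lemma alpha_measurable: "(\<lambda>x. alpha r (x ` {..<n::nat})) \<in> measurable (PiM {..<n} (\<lambda>_. MU)) (count_space UNIV)"
proof -
  have d: "(\<lambda>x. dist (x i) (x j)) \<in> borel_measurable (PiM {..<n} (\<lambda>_. MU))" if "i < n" "j < n" for i j
  proof -
    have "(\<lambda>x. x) \<in> MU \<rightarrow>\<^sub>M borel"
      by (rule measurable_restrict_space1) simp
    then have "(\<lambda>x. x i) \<in> borel_measurable (PiM {..<n} (\<lambda>_. MU))" if "i < n" for i
      using that measurable_compose[OF measurable_component_singleton] by fastforce
    then show ?thesis using that by (intro borel_measurable_dist) auto
  qed
  have ge: "Measurable.pred (PiM {..<n} (\<lambda>_. MU)) (\<lambda>x. k \<le> alpha r (x ` {..<n}))" for k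
    unfolding alpha_image_ge_iff[OF r]
  proof (intro pred_intros_finite pred_intros_logic)
    show "finite S" if "S \<in> Pow {..<n}" for S using that finite_subset by auto
    show "Measurable.pred (PiM {..<n} (\<lambda>_. MU)) (\<lambda>x. r < dist (x i) (x j))"
      if "S \<in> Pow {..<n}" "i \<in> S" "j \<in> S" for S i j
      using that by (intro borel_measurable_pred_less d) auto
  qed (auto intro: finite_subset)
  show ?thesis
  proof (rule measurable_count_space_eq2_countable[THEN iffD2], intro conjI ballI)
    fix k
    have "(\<lambda>x. alpha r (x ` {..<n})) -` {k} \<inter> space (PiM {..<n} (\<lambda>_. MU))
      = {x \<in> space (PiM {..<n} (\<lambda>_. MU)). k \<le> alpha r (x ` {..<n}) \<and> \<not> Suc k \<le> alpha r (x ` {..<n})}"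
      by auto
    also have "\<dots> \<in> sets (PiM {..<n} (\<lambda>_. MU))"
      using ge[of k] ge[of "Suc k"] by measurable
    finally show "(\<lambda>x. alpha r (x ` {..<n})) -` {k} \<inter> space (PiM {..<n} (\<lambda>_. MU)) \<in> sets (PiM {..<n} (\<lambda>_. MU))" .
  qed auto
qed

definition gen :: "complex \<Rightarrow> 'a set \<Rightarrow> complex" where
  "gen z S = (if S \<in> cfg then z ^ alpha r S else 0)"

lemma gen_bound: "norm z \<le> 3 \<Longrightarrow> S \<in> cfg \<Longrightarrow> norm (gen z S) \<le> 3 ^ card S"
proof -
  assume z: "norm z \<le> 3" and S: "S \<in> cfg"
  have "norm z ^ alpha r S \<le> 3 ^ alpha r S" using z by (intro power_mono) auto
  also have "\<dots> \<le> 3 ^ card S"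
    using alpha_le_card[OF cfg_finite[OF S]] by (intro power_increasing) auto
  finally show ?thesis using S by (simp add: gen_def norm_power)
qed

lemma admissible_gen: "norm z \<le> 3 \<Longrightarrow> admissible (gen z)"
  unfolding admissible_def
proof (intro conjI allI impI)
  fix n :: nat
  have "(\<lambda>x. z ^ alpha r (x ` {..<n})) \<in> borel_measurable (PiM {..<n} (\<lambda>_. MU))"
    by (rule measurable_compose[OF alpha_measurable]) simp
  then show "(\<lambda>x. gen z (x ` {..<n})) \<in> borel_measurable (PiM {..<n} (\<lambda>_. MU))"
    by (rule measurable_cong[THEN iffD1, rotated]) (simp add: gen_def cfg_image)
  assume "norm z \<le> 3"
  then show "\<exists>C\<ge>0. \<forall>S\<in>cfg. norm (gen z S) \<le> C * 3 ^ card S"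
    using gen_bound by (intro exI[of _ 1]) auto
qed (simp add: gen_def)

text \<open>Links the operator powers with \<open>n\<close> independent uniform points. The
  induction runs over all \<open>F\<close>: the innermost addition is absorbed into
  \<open>F\<close>, and the resulting iterated integral is merged into one over \<open>Suc n\<close>
  coordinates.\<close>

lemma addop_one_power_eq_integral:
  assumes F: "admissible F"
  shows "(addop (\<lambda>_. 1) ^^ n) F {} = (\<integral>x. F (x ` {..<n}) \<partial>PiM {..<n} (\<lambda>_. MU))"
  using F
proof (induction n arbitrary: F)
  case 0
  show ?case by (simp add: PiM_empty lebesgue_integral_count_space_finite)
next
  case (Suc n)
  interpret product_prob_space "\<lambda>_. MU" "{..<n}" ..
  obtain C where C: "0 \<le> C" "\<And>S. S \<in> cfg \<Longrightarrow> norm (F S) \<le> C * 3 ^ card S"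
    using admissible_bound[OF Suc.prems] by blast
  have I: "{..<Suc n} = insert n {..<n}" by auto
  have PP: "prob_space (PiM {..<Suc n} (\<lambda>_. MU))"
    by (rule prob_space_PiM) (rule prob_space_MU)
  have int: "integrable (PiM {..<Suc n} (\<lambda>_. MU)) (\<lambda>x. F (x ` {..<Suc n}))"
  proof (rule finite_measure.integrable_const_bound[OF prob_space.finite_measure[OF PP], of _ "C * 3 ^ Suc n"])
    show "AE x in PiM {..<Suc n} (\<lambda>_. MU). norm (F (x ` {..<Suc n})) \<le> C * 3 ^ Suc n"
    proof (rule AE_I2)
      fix x assume "x \<in> space (PiM {..<Suc n} (\<lambda>_. MU))"
      then have "norm (F (x ` {..<Suc n})) \<le> C * 3 ^ card (x ` {..<Suc n})"
        by (intro C cfg_image)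
      also have "\<dots> \<le> C * 3 ^ Suc n"
        using C(1) card_image_le[of "{..<Suc n}" x] by (intro mult_left_mono power_increasing) auto
      finally show "norm (F (x ` {..<Suc n})) \<le> C * 3 ^ Suc n" .
    qed
  qed (rule admissible_measurable[OF Suc.prems])
  have "(addop (\<lambda>_. 1) ^^ Suc n) F {} = (addop (\<lambda>_. 1) ^^ n) (addop (\<lambda>_. 1) F) {}"
    by (simp add: funpow_swap1)
  also have "\<dots> = (\<integral>x. addop (\<lambda>_. 1) F (x ` {..<n}) \<partial>PiM {..<n} (\<lambda>_. MU))"
    by (rule Suc.IH[OF admissible_addop[OF Suc.prems weight_const]])
  also have "\<dots> = (\<integral>x. (\<integral>y. F ((x(n := y)) ` {..<Suc n}) \<partial>MU) \<partial>PiM {..<n} (\<lambda>_. MU))"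
  proof (rule Bochner_Integration.integral_cong[OF refl])
    fix x assume x: "x \<in> space (PiM {..<n} (\<lambda>_. MU))"
    have "(x(n := y)) ` {..<Suc n} = insert y (x ` {..<n})" for y by (auto simp: lessThan_Suc)
    then show "addop (\<lambda>_. 1) F (x ` {..<n}) = (\<integral>y. F ((x(n := y)) ` {..<Suc n}) \<partial>MU)"
      using cfg_image[OF x] by (simp add: addop_def)
  qed
  also have "\<dots> = (\<integral>x. F (x ` {..<Suc n}) \<partial>PiM {..<Suc n} (\<lambda>_. MU))"
    using product_integral_insert[of "{..<n}" n "\<lambda>x. F (x ` {..<Suc n})"] int
    unfolding I by simp
  finally show ?case .
qed

section \<open>The Poisson mixture of the laws for n points\<close>

definition indep_prob :: "nat \<Rightarrow> nat \<Rightarrow> real" where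
  "indep_prob n k = measure (PiM {..<n} (\<lambda>_. MU))
     {xs \<in> space (PiM {..<n} (\<lambda>_. MU)). indep_num r xs n = k}"

lemma prob_space_PiM_MU: "prob_space (PiM I (\<lambda>_. MU))"
  by (rule prob_space_PiM) (rule prob_space_MU)

lemma indep_prob_sets:
  "{xs \<in> space (PiM {..<n} (\<lambda>_. MU)). indep_num r xs n = k} \<in> sets (PiM {..<n} (\<lambda>_. MU))"
proof -
  have "(\<lambda>x. alpha r (x ` {..<n})) -` {k} \<inter> space (PiM {..<n} (\<lambda>_. MU)) \<in> sets (PiM {..<n} (\<lambda>_. MU))"
    by (rule measurable_sets[OF alpha_measurable]) simp
  also have "(\<lambda>x. alpha r (x ` {..<n})) -` {k} \<inter> space (PiM {..<n} (\<lambda>_. MU))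
     = {xs \<in> space (PiM {..<n} (\<lambda>_. MU)). indep_num r xs n = k}"
    by (auto simp: indep_num_eq_alpha[OF r])
  finally show ?thesis .
qed

lemma alpha_image_le: "alpha r (x ` {..<n::nat}) \<le> n"
  using alpha_le_card[of "x ` {..<n}" r] card_image_le[of "{..<n}" x] by simp

lemma indep_prob_eq_0: "n < k \<Longrightarrow> indep_prob n k = 0"
proof -
  assume "n < k"
  then have "{xs \<in> space (PiM {..<n} (\<lambda>_. MU)). indep_num r xs n = k} = {}"
    using alpha_image_le[of _ n] by (auto simp: indep_num_eq_alpha[OF r] simp flip: not_le)
  then show ?thesis unfolding indep_prob_def by (simp only: measure_empty)
qed

lemma indep_prob_nonneg: "0 \<le> indep_prob n k"
  by (simp add: indep_prob_def)

lemma indep_prob_le_1: "indep_prob n k \<le> 1"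
  unfolding indep_prob_def by (rule prob_space.prob_le_1[OF prob_space_PiM_MU])

lemma integral_gen:
  "(\<integral>x. gen z (x ` {..<n}) \<partial>PiM {..<n} (\<lambda>_. MU)) = (\<Sum>k\<le>n. of_real (indep_prob n k) * z ^ k)"
proof -
  let ?P = "PiM {..<n} (\<lambda>_. MU)"
  let ?A = "\<lambda>k. {xs \<in> space ?P. indep_num r xs n = k}"
  interpret P: finite_measure ?P using prob_space.finite_measure[OF prob_space_PiM_MU] .
  have "(\<integral>x. gen z (x ` {..<n}) \<partial>?P) = (\<integral>x. (\<Sum>k\<le>n. indicat_real (?A k) x *\<^sub>R z ^ k) \<partial>?P)"
  proof (rule Bochner_Integration.integral_cong[OF refl])
    fix x assume x: "x \<in> space ?P"
    have "(\<Sum>k\<le>n. indicat_real (?A k) x *\<^sub>R z ^ k) = (\<Sum>k\<le>n. if k = alpha r (x ` {..<n}) then z ^ k else 0)"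
      using x by (intro sum.cong) (auto simp: indicator_def indep_num_eq_alpha[OF r])
    also have "\<dots> = z ^ alpha r (x ` {..<n})"
      using alpha_image_le[of x n] by simp
    finally show "gen z (x ` {..<n}) = (\<Sum>k\<le>n. indicat_real (?A k) x *\<^sub>R z ^ k)"
      using cfg_image[OF x] by (simp add: gen_def)
  qed
  also have "\<dots> = (\<Sum>k\<le>n. (\<integral>x. indicat_real (?A k) x *\<^sub>R z ^ k \<partial>?P))"
    using indep_prob_sets
    by (intro Bochner_Integration.integral_sum integrable_scaleR_left integrable_real_indicator)
       (auto simp: P.emeasure_finite less_top[symmetric])
  also have "\<dots> = (\<Sum>k\<le>n. of_real (indep_prob n k) * z ^ k)"
    using indep_prob_sets
    by (intro sum.cong refl)
       (simp add: integral_scaleR_left integrable_real_indicator P.emeasure_finite less_top[symmetric]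
         indep_prob_def scaleR_conv_of_real)
  finally show ?thesis .
qed

context
  fixes lam :: real
  assumes lam: "0 < lam"
begin

lemma pmf_poisson_eq: "pmf (poisson_pmf lam) n = (lam ^ n /\<^sub>R fact n) * exp (- lam)"
  using lam by (simp add: divide_inverse)

lemma summable_pmf_poisson: "summable (pmf (poisson_pmf lam))"
  unfolding pmf_poisson_eq[abs_def] by (intro summable_mult2 summable_exp_generic)

definition indep_pmf :: "nat \<Rightarrow> real" where
  "indep_pmf k = (\<Sum>n. pmf (poisson_pmf lam) n * indep_prob n k)"

context
  fixes R :: real
  assumes R1: "1 \<le> R"
begin

text \<open>The spare factor \<open>2 ^ n\<close> pays for a factor \<open>(1 / 2) ^ k\<close>,
  because only \<open>k \<le> n\<close> occurs. The terms are then bounded by a product of a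
  summable function of \<open>n\<close> and one of \<open>k\<close>, as the interchange of sums
  requires.\<close>

definition pgf_majorant :: "nat \<Rightarrow> real" where "pgf_majorant n = pmf (poisson_pmf lam) n * (2 * R) ^ n"

lemma pgf_majorant: "summable pgf_majorant" "0 \<le> pgf_majorant n"
proof -
  have "pgf_majorant n = ((lam * (2 * R)) ^ n /\<^sub>R fact n) * exp (- lam)" for n
    unfolding pgf_majorant_def pmf_poisson_eq power_mult_distrib[of lam] by simp
  then have "pgf_majorant = (\<lambda>n. ((lam * (2 * R)) ^ n /\<^sub>R fact n) * exp (- lam))" by (rule ext)
  then show "summable pgf_majorant"
    by (simp only:) (intro summable_mult2 summable_exp_generic)
  show "0 \<le> pgf_majorant n" using R1 by (simp add: pgf_majorant_def)
qed

lemma term_bound: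
  fixes z :: complex
  assumes z: "norm z \<le> R"
  shows "norm (of_real (pmf (poisson_pmf lam) n * indep_prob n k) * z ^ k) \<le> pgf_majorant n * (1 / 2) ^ k"
proof (cases "k \<le> n")
  case True
  have "norm z ^ k \<le> R ^ k" using z by (intro power_mono) auto
  also have "\<dots> = (2 * R) ^ k * (1 / 2) ^ k" unfolding power_mult_distrib[symmetric] by simp
  also have "\<dots> \<le> (2 * R) ^ n * (1 / 2) ^ k"
    using True R1 by (intro mult_right_mono power_increasing) auto
  finally have "norm z ^ k \<le> (2 * R) ^ n * (1 / 2) ^ k" .
  then have "indep_prob n k * norm z ^ k \<le> 1 * ((2 * R) ^ n * (1 / 2) ^ k)"
    using indep_prob_le_1 by (intro mult_mono) auto
  then have "pmf (poisson_pmf lam) n * (indep_prob n k * norm z ^ k) \<le> pmf (poisson_pmf lam) n * ((2 * R) ^ n * (1 / 2) ^ k)"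
    by (intro mult_left_mono) auto
  then show ?thesis
    using indep_prob_nonneg[of n k] by (simp add: pgf_majorant_def norm_mult norm_power mult.assoc)
next
  case False
  then show ?thesis using pgf_majorant(2) by (simp add: indep_prob_eq_0)
qed

lemma indep_pmf_power_bound: "0 \<le> indep_pmf k" "indep_pmf k * R ^ k \<le> (\<Sum>n. pgf_majorant n) * (1 / 2) ^ k"
proof -
  let ?t = "\<lambda>n. pmf (poisson_pmf lam) n * indep_prob n k"
  have le: "?t n * R ^ k \<le> pgf_majorant n * (1 / 2) ^ k" for n
    using term_bound[of "of_real R" n k] R1 indep_prob_nonneg[of n k] by (simp add: norm_mult norm_power)
  have "?t n \<le> pgf_majorant n * (1 / 2) ^ k" for n
  proof -
    have "?t n * 1 \<le> ?t n * R ^ k"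
      using R1 indep_prob_nonneg by (intro mult_left_mono) auto
    then show ?thesis using le[of n] by simp
  qed
  then have s: "summable ?t"
    by (intro summable_comparison_test'[OF summable_mult2[OF pgf_majorant(1), of "(1 / 2) ^ k"], of 0])
       (simp add: abs_mult indep_prob_nonneg)
  show "0 \<le> indep_pmf k"
    unfolding indep_pmf_def by (intro suminf_nonneg s) (simp add: indep_prob_nonneg)
  have "indep_pmf k * R ^ k = (\<Sum>n. ?t n * R ^ k)" unfolding indep_pmf_def by (rule suminf_mult2[OF s])
  also have "\<dots> \<le> (\<Sum>n. pgf_majorant n * (1 / 2) ^ k)"
    by (intro suminf_le le summable_mult2 s pgf_majorant)
  also have "\<dots> = (\<Sum>n. pgf_majorant n) * (1 / 2) ^ k"
    by (rule suminf_mult2[OF pgf_majorant(1), symmetric])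
  finally show "indep_pmf k * R ^ k \<le> (\<Sum>n. pgf_majorant n) * (1 / 2) ^ k" .
qed

lemma summable_indep_pmf_power: "summable (\<lambda>k. indep_pmf k * R ^ k)"
  using indep_pmf_power_bound R1
  by (intro summable_comparison_test'[OF summable_mult[OF summable_geometric, of "1/2"], of 0]) auto

lemma pgf_swap:
  fixes z :: complex
  assumes z: "norm z \<le> R"
  shows "(\<Sum>k. of_real (indep_pmf k) * z ^ k) = (\<Sum>n. of_real (pmf (poisson_pmf lam) n) * (\<Sum>k\<le>n. of_real (indep_prob n k) * z ^ k))"
proof -
  define b where "b n k = of_real (pmf (poisson_pmf lam) n * indep_prob n k) * z ^ k" for n k
  have b: "norm (b n k) \<le> pgf_majorant n * (1 / 2) ^ k" for n k
    unfolding b_def by (rule term_bound[OF z])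
  have g: "summable (\<lambda>k. (1 / 2 :: real) ^ k)" by (intro summable_geometric) simp
  have "of_real (indep_pmf k) * z ^ k = (\<Sum>n. b n k)" for k
  proof -
    have "pmf (poisson_pmf lam) n * indep_prob n k \<le> pmf (poisson_pmf lam) n" for n
      using mult_left_mono[OF indep_prob_le_1, of "pmf (poisson_pmf lam) n" n k] by simp
    then have s: "summable (\<lambda>n. pmf (poisson_pmf lam) n * indep_prob n k)"
      by (intro summable_comparison_test'[OF summable_pmf_poisson, of 0]) (auto simp: abs_mult indep_prob_nonneg)
    have "of_real (indep_pmf k) = (\<Sum>n. of_real (pmf (poisson_pmf lam) n * indep_prob n k) :: complex)"
      unfolding indep_pmf_def by (rule suminf_of_real[OF s])
    then show ?thesis
      unfolding b_def using suminf_mult2[OF summable_of_real[OF s], of "z ^ k"] by simp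
  qed
  then have "(\<Sum>k. of_real (indep_pmf k) * z ^ k) = (\<Sum>k. \<Sum>n. b n k)" by simp
  also have "\<dots> = (\<Sum>n. \<Sum>k. b n k)"
    using suminf_suminf_swap[of b, OF b pgf_majorant g] by simp
  also have "\<dots> = (\<Sum>n. of_real (pmf (poisson_pmf lam) n) * (\<Sum>k\<le>n. of_real (indep_prob n k) * z ^ k))"
  proof (intro suminf_cong)
    fix n
    have "(\<Sum>k. b n k) = (\<Sum>k\<le>n. b n k)"
      by (intro suminf_finite) (auto simp: b_def indep_prob_eq_0)
    then show "(\<Sum>k. b n k) = of_real (pmf (poisson_pmf lam) n) * (\<Sum>k\<le>n. of_real (indep_prob n k) * z ^ k)"
      by (simp add: b_def sum_distrib_left mult.assoc)
  qed
  finally show ?thesis .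
qed

end

text \<open>The Poisson weight of \<open>n\<close> times the expectation over \<open>n\<close>
  points is exp(-lam) times the \<open>n\<close>-th term of \<open>expop\<close>, factorial
  included.\<close>

lemma pgf_eq_expop:
  assumes z: "norm z \<le> 3"
  shows "(\<Sum>k. of_real (indep_pmf k) * z ^ k) = of_real (exp (- lam)) * expop (\<lambda>_. lam) (gen z) {}"
proof -
  have "(\<Sum>k. of_real (indep_pmf k) * z ^ k)
      = (\<Sum>n. of_real (pmf (poisson_pmf lam) n) * (\<Sum>k\<le>n. of_real (indep_prob n k) * z ^ k))"
    by (rule pgf_swap[OF _ z]) simp
  also have "\<dots> = (\<Sum>n. of_real (exp (- lam)) * ((addop (\<lambda>_. lam) ^^ n) (gen z) {} /\<^sub>R fact n))"
    unfolding integral_gen[symmetric] addop_one_power_eq_integral[OF admissible_gen[OF z], symmetric]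
      addop_const_power[where t = lam]
    using lam by (intro suminf_cong) (simp add: scaleR_conv_of_real divide_inverse mult_ac)
  also have "\<dots> = of_real (exp (- lam)) * expop (\<lambda>_. lam) (gen z) {}"
    using sums_mult[OF expop_sums[OF admissible_gen[OF z] weight_const]] by (rule sums_unique[symmetric])
  finally show ?thesis .
qed

text \<open>At \<open>z = 1\<close> the functional is 1 on \<open>cfg\<close>, and
  \<open>expop\<close> reduces to the exponential series of \<open>lam\<close>.\<close>

lemma indep_pmf_sums_1: "indep_pmf sums 1"
proof -
  have "(\<Sum>k. complex_of_real (indep_pmf k) * 1 ^ k) = of_real (exp (- lam)) * expop (\<lambda>_. lam) (gen 1) {}"
    by (rule pgf_eq_expop) simp
  also have "expop (\<lambda>_. lam) (gen 1) {} = of_real (exp lam)"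
  proof -
    have "(addop (\<lambda>_. 1) ^^ n) (gen 1) {} = 1" for n
    proof -
      have "(\<integral>x. gen 1 (x ` {..<n}) \<partial>PiM {..<n} (\<lambda>_. MU)) = (\<integral>x. 1 \<partial>PiM {..<n} (\<lambda>_. MU))"
        by (rule Bochner_Integration.integral_cong[OF refl]) (simp add: gen_def cfg_image)
      then show ?thesis
        using addop_one_power_eq_integral[OF admissible_gen[of 1], of n]
          prob_space.prob_space[OF prob_space_PiM_MU[of "{..<n}"]] by simp
    qed
    then have "expop (\<lambda>_. lam) (gen 1) {} = (\<Sum>n. of_real (lam ^ n /\<^sub>R fact n))"
      unfolding expop_def addop_const_power[where t = lam]
      by (intro suminf_cong) (simp add: scaleR_conv_of_real)
    also have "\<dots> = of_real (exp lam)"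
      unfolding exp_def by (rule suminf_of_real[OF summable_exp_generic, symmetric])
    finally show ?thesis .
  qed
  finally have "(\<Sum>k. complex_of_real (indep_pmf k)) = of_real (exp (- lam) * exp lam)" by simp
  then have "(\<Sum>k. complex_of_real (indep_pmf k)) = 1" by (simp add: exp_minus)
  moreover have s: "summable indep_pmf" using summable_indep_pmf_power[of 1] by simp
  ultimately have "complex_of_real (suminf indep_pmf) = of_real 1"
    using suminf_of_real[OF s, where 'a = complex] by simp
  then have "suminf indep_pmf = 1" by (simp only: of_real_eq_iff)
  then show ?thesis using s by (simp add: sums_iff)
qed

end

text \<open>The neighbours of a point lie in the part of a ball inside \<open>U\<close>, so the
  boundary only lowers their expected number. The constant 12 is 4 R at R = 3.\<close>

lemma exploration_gen:
  assumes z: "norm z \<le> 3" and lam: "0 < lam" and \<kappa>: "exp (12 * \<kappa>) \<le> 3 / 2"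
    and ball: "lam * (unit_ball_vol (real DIM('a)) * r ^ DIM('a)) \<le> \<kappa>"
  shows "exploration MU 3 (gen z) (\<lambda>d y. dist d y \<le> r) \<kappa> lam"
proof (intro exploration.intro exploration_axioms.intro config_model_axioms)
  show "admissible (gen z)" by (rule admissible_gen[OF z])
  show "norm (gen z S) \<le> 3 ^ card S" if "S \<in> cfg" for S by (rule gen_bound[OF z that])
  show "gen z (D \<union> Y) = gen z D * gen z Y"
    if "D \<in> cfg" "Y \<in> cfg" "\<And>d y. d \<in> D \<Longrightarrow> y \<in> Y \<Longrightarrow> \<not> dist d y \<le> r" for D Y
  proof -
    have "alpha r (D \<union> Y) = alpha r D + alpha r Y"
      using that cfg_finite r by (intro alpha_Un) (auto simp: not_le)
    then show ?thesis using that by (simp add: gen_def power_add)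
  qed
  have eq: "{y \<in> space MU. dist x y \<le> r} = U \<inter> cball x r" for x
    by (auto simp: space_MU)
  have sets: "U \<inter> cball x r \<in> sets lborel" for x
    using U(1) by (intro sets.Int) auto
  show "{y \<in> space MU. dist x y \<le> r} \<in> sets MU" for x
    unfolding eq using U(1) sets by (subst sets_restrict_space_iff) auto
  show "lam * measure MU {y \<in> space MU. dist x y \<le> r} \<le> \<kappa>" for x
  proof -
    have "measure MU (U \<inter> cball x r) = measure lborel (U \<inter> cball x r)"
      using U(1) by (intro measure_restrict_space) auto
    also have "\<dots> \<le> measure lborel (cball x r)"
      using sets emeasure_bounded_finite[of "cball x r"]
      by (intro measure_mono_fmeasurable) (auto simp: fmeasurable_def)
    also have "\<dots> = unit_ball_vol (real DIM('a)) * r ^ DIM('a)"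
      by (rule content_cball[OF r])
    finally have "lam * measure MU (U \<inter> cball x r) \<le> lam * (unit_ball_vol (real DIM('a)) * r ^ DIM('a))"
      using lam by (intro mult_left_mono) auto
    then show ?thesis unfolding eq using ball by linarith
  qed
  have "0 \<le> unit_ball_vol (real DIM('a)) * r ^ DIM('a)" using r by simp
  then show "0 \<le> \<kappa>" using ball lam by (meson less_imp_le mult_nonneg_nonneg order_trans)
  show "exp (4 * 3 * \<kappa>) \<le> 3 / 2" using \<kappa> by simp
qed

text \<open>The error rate is \<open>3 * R * (exp (4 * R * \<kappa>) - 1)\<close> at R = 3. The
  factor exp(-lam) of the Poisson weights cancels against exp(-lam (z - 1)) up to exp(-lam z), which
  is the form in \<open>Xi_bounds\<close>.\<close>

lemma near_poisson_indep_pmf: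
  assumes lam: "1 \<le> lam" and \<kappa>: "0 < \<kappa>" "9 * (exp (12 * \<kappa>) - 1) \<le> 1 / 2000"
    and ball: "lam * (unit_ball_vol (real DIM('a)) * r ^ DIM('a)) \<le> \<kappa>"
  shows "near_poisson (indep_pmf lam) lam (9 * (exp (12 * \<kappa>) - 1))"
proof -
  have lam0: "0 < lam" using lam by simp
  interpret entire_pgf "indep_pmf lam"
    by unfold_locales (auto intro: indep_pmf_power_bound(1)[OF lam0, of 1] summable_indep_pmf_power[OF lam0])
  have *: "norm (moment_series 0 z * exp (- of_real lam * (z - 1))) \<le> exp (9 * (exp (12 * \<kappa>) - 1) * lam)
      \<and> exp (- (9 * (exp (12 * \<kappa>) - 1)) * lam) \<le> norm (moment_series 0 z * exp (- of_real lam * (z - 1)))"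
    if z: "norm z \<le> 3" for z
  proof -
    interpret ex: exploration MU 3 "gen z" "\<lambda>d y. dist d y \<le> r" \<kappa> lam
      by (rule exploration_gen[OF z lam0 _ ball]) (use \<kappa> in simp)
    have "moment_series 0 z = of_real (exp (- lam)) * ex.Xi lam"
      using pgf_eq_expop[OF lam0 z] by (simp add: moment_series_def ex.Xi_def)
    moreover have "exp (- of_real lam * (z - 1)) = exp (of_real lam) * exp (- z * of_real lam)"
      by (simp add: exp_add[symmetric] algebra_simps)
    moreover have "complex_of_real (exp (- lam)) * exp (of_real lam) = 1"
      by (simp add: exp_of_real exp_minus flip: of_real_mult)
    ultimately have "moment_series 0 z * exp (- of_real lam * (z - 1)) = ex.Xi lam * exp (- z * of_real lam)"
      by (simp add: mult_ac)
    then show ?thesis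
      using ex.Xi_bounds[of z] lam0 by (simp add: gen_def space_MU)
  qed
  show ?thesis
  proof (unfold_locales)
    show "suminf (indep_pmf lam) = 1" using indep_pmf_sums_1[OF lam0] by (simp add: sums_iff)
    show "0 < 9 * (exp (12 * \<kappa>) - 1)" using \<kappa>(1) by simp
  qed (use lam \<kappa> * in auto)
qed

end

section \<open>The local limit theorem\<close>

text \<open>The uniform bound makes the family bounded above, so the real supremum dominates its
  entries; nonnegativity serves the absolute value in \<open>d_loc_pW_le\<close>.\<close>

lemma d_loc_le:
  assumes "\<And>j. \<bar>p j - q j\<bar> \<le> C"
  shows "0 \<le> d_loc p q" "d_loc p q \<le> C"
proof -
  have bdd: "bdd_above (range (\<lambda>j. \<bar>p j - q j\<bar>))" using assms by (auto intro!: bdd_aboveI)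
  have "\<bar>p 0 - q 0\<bar> \<le> d_loc p q" unfolding d_loc_def by (rule cSUP_upper[OF _ bdd]) simp
  then show "0 \<le> d_loc p q" by linarith
  show "d_loc p q \<le> C" unfolding d_loc_def by (rule cSUP_least) (use assms in auto)
qed

lemma d_loc_pW_le:
  fixes U :: "'a::euclidean_space set"
  assumes U: "open U" "emeasure lborel U = 1" and b: "0 < b" and lam: "1 \<le> lam"
    and small: "9 * (exp (12 * (unit_ball_vol (real DIM('a)) * b ^ DIM('a))) - 1) \<le> 1 / 2000"
  shows "\<bar>d_loc (pW_int U lam b) (tp_pmf (meanW U lam b) (varW U lam b))\<bar> \<le> 2000000 / lam"
proof -
  let ?d = "DIM('a)" and ?V = "unit_ball_vol (real DIM('a))"
  let ?r = "b * lam powr (-1 / real ?d)"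
  interpret uniform_points U ?r
    using U b by unfold_locales auto
  \<comment> \<open>The scaling of the radius gives lam r^d = b^d, so kappa does not depend on
    lam.\<close>
  have "?r ^ ?d = b ^ ?d * (lam powr (-1 / real ?d)) powr real ?d"
    using lam by (simp add: power_mult_distrib powr_realpow)
  also have "\<dots> = b ^ ?d / lam"
  proof -
    have "(lam powr (-1 / real ?d)) powr real ?d = lam powr (-1)" by (simp only: powr_powr) simp
    also have "\<dots> = 1 / lam" using lam by (simp add: powr_minus divide_inverse)
    finally show ?thesis by simp
  qed
  finally have "lam * (?V * ?r ^ ?d) \<le> ?V * b ^ ?d" using lam by simp
  moreover have "0 < ?V * b ^ ?d" using b by simp
  ultimately interpret near_poisson "indep_pmf lam" lam "9 * (exp (12 * (?V * b ^ ?d)) - 1)"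
    using small lam by (intro near_poisson_indep_pmf)
  have pW: "pW U lam b = indep_pmf lam"
  proof
    have "0 < lam" using lam by simp
    show "pW U lam b k = indep_pmf lam k" for k
      unfolding pW_def indep_pmf_def[OF \<open>0 < lam\<close>] indep_prob_def by (rule refl)
  qed
  have mean: "meanW U lam b = \<mu>"
    unfolding meanW_def \<mu>_def pW by (rule refl)
  moreover have "varW U lam b = v"
    unfolding varW_def v_def pW mean by (rule refl)
  moreover have "pW_int U lam b j = (if j < 0 then 0 else indep_pmf lam (nat j))" for j
    unfolding pW_int_def pW by (rule refl)
  ultimately have "\<bar>pW_int U lam b j - tp_pmf (meanW U lam b) (varW U lam b) j\<bar> \<le> 2000000 / lam" for j
    using abs_diff_tp_pmf_le[of j] by simp
  from d_loc_le[of "pW_int U lam b", OF this] show ?thesis by simp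
qed

theorem theorem7:
  fixes U :: "'a::euclidean_space set"
  assumes "open U" and "emeasure lborel U = 1"
  shows "\<exists>b0>0. \<forall>b. 0 < b \<and> b < b0 \<longrightarrow> (\<forall>\<epsilon>>0.
     (\<lambda>lam. d_loc (pW_int U lam b) (tp_pmf (meanW U lam b) (varW U lam b)))
       \<in> O[at_top](\<lambda>lam. lam powr (-1 + \<epsilon>)))"
proof -
  let ?V = "unit_ball_vol (real DIM('a))"
  have V: "0 < ?V" by simp
  \<comment> \<open>Chosen so that 9 (exp(delta) - 1) = 9 / 18000 = 1 / 2000.\<close>
  define \<delta> :: real where "\<delta> = ln (1 + 1 / 18000)"
  have \<delta>: "0 < \<delta>" by (simp add: \<delta>_def)
  \<comment> \<open>The cap 1 gives \<open>b ^ DIM('a) \<le> b\<close>; the other entry keeps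
    \<open>12 * ?V * b\<close> at most \<open>\<delta>\<close>.\<close>
  define b0 where "b0 = min 1 (\<delta> / (12 * ?V))"
  show ?thesis
  proof (intro exI[of _ b0] conjI allI impI)
    show "0 < b0" using \<delta> V by (simp add: b0_def)
    fix b \<epsilon> :: real
    assume b: "0 < b \<and> b < b0" and \<epsilon>: "0 < \<epsilon>"
    have "b ^ DIM('a) \<le> b ^ 1"
      using b DIM_positive[where 'a = 'a] by (intro power_decreasing) (auto simp: b0_def Suc_le_eq)
    then have "12 * (?V * b ^ DIM('a)) \<le> 12 * (?V * b)" using V by (intro mult_left_mono) auto
    also have "\<dots> \<le> 12 * (?V * (\<delta> / (12 * ?V)))"
      using b V by (intro mult_left_mono) (auto simp: b0_def)
    also have "?V \<noteq> 0" using V by (metis less_irrefl)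
    then have "12 * (?V * (\<delta> / (12 * ?V))) = \<delta>" by simp
    finally have "exp (12 * (?V * b ^ DIM('a))) \<le> exp \<delta>" by simp
    also have "\<dots> = 1 + 1 / 18000" by (simp add: \<delta>_def)
    finally have small: "9 * (exp (12 * (?V * b ^ DIM('a))) - 1) \<le> 1 / 2000" by simp
    show "(\<lambda>lam. d_loc (pW_int U lam b) (tp_pmf (meanW U lam b) (varW U lam b)))
       \<in> O[at_top](\<lambda>lam. lam powr (-1 + \<epsilon>))"
    proof (rule bigoI[where c = 2000000])
      show "\<forall>\<^sub>F lam in at_top. norm (d_loc (pW_int U lam b) (tp_pmf (meanW U lam b) (varW U lam b)))
          \<le> 2000000 * norm (lam powr (-1 + \<epsilon>))"
        using eventually_ge_at_top[of 1]
      proof eventually_elim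
        case (elim lam)
        have "lam powr (-1) \<le> lam powr (-1 + \<epsilon>)" using elim \<epsilon> by (intro powr_mono) auto
        then have "2000000 / lam \<le> 2000000 * lam powr (-1 + \<epsilon>)"
          using elim by (simp add: powr_minus divide_inverse)
        moreover have "\<bar>d_loc (pW_int U lam b) (tp_pmf (meanW U lam b) (varW U lam b))\<bar> \<le> 2000000 / lam"
          using d_loc_pW_le[OF assms _ elim small] b by simp
        ultimately show ?case by simp
      qed
    qed
  qed
qed

end
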